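(* Let $k$ be a field, $m\ge1$, $K_m=\{\sigma\subseteq[m] : \#\sigma\le m-2\}$, and let $\mathcal{L}(K_m)$ be the category of $K_m$-localized persistence modules with full subcategories $\mathcal{T},\mathcal{F}$ and endofunctors $T,F$ as defined in the context. (1) For any $M$ in $\mathcal{L}(K_m)$, $T(M)\in\mathcal{T}$, $F(M)\in\mathcal{F}$, and there is a short exact sequence $0\to T(M)\to M\to F(M)\to 0$. Also, for any $A\in\mathcal{T}$ and $B\in\mathcal{F}$, $\mathrm{Hom}(A,B)=0$. Hence $(\mathcal{T},\mathcal{F})$ is a torsion pair in $\mathcal{L}(K_m)$. (2) For any $M$ in $\mathcal{L}(K_m)$, the short exact sequence in part (1) splits, and thus $M\cong T(M)\oplus F(M)$.
   Context: $R=k[t_1,\dots,t_m]$ is $\mathbb{N}^m$-graded ($0\in\mathbb{N}$) with $|t_i|=\vec e_i$. All modules are multigraded and morphisms preserve multidegree. For $\sigma\subseteq[m]=\{1,\dots,m\}$, let $\sigma^{-1}\mathbb{N}^m=\{\vec d\in\mathbb{Z}^m : d_i\ge 0 \text{ for } i\notin\sigma\}$ and $R_\sigma=R[t_i^{-1}\mid i\in\sigma]$; $R_\sigma$-modules are $\sigma^{-1}\mathbb{N}^m$-graded (extended by zero to larger grading sets when necessary). Write $\sigma_i=[m]\setminus\{i\}$. The subsets of $[m]$ not in $K_m$ are $[m],\sigma_1,\dots,\sigma_m$. An object $M$ of $\mathcal{L}(K_m)$ consists of finitely generated $R_{\sigma_i}$-modules $M_{\sigma_i}$ ($1\le i\le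 m$), a finitely generated $R_{[m]}$-module $M_{[m]}$, and $R_{\sigma_i}$-module maps $\varphi_i\colon M_{\sigma_i}\to M_{[m]}$ whose induced maps $R_{[m]}\otimes_{R_{\sigma_i}}M_{\sigma_i}\to M_{[m]}$ are isomorphisms. Morphisms are families of module maps commuting with the $\varphi_i$; $\mathcal{L}(K_m)$ is abelian with kernels and cokernels computed pointwise. For a finitely generated $R_{\sigma_i}$-module $N$, let $T_i(N)=\{x\in N : t_i^n x=0\text{ for some }n\}$. Let $\mathcal{T}$ be the full subcategory of objects $M$ with $T_i(M_{\sigma_i})=M_{\sigma_i}$ for all $i$ (equivalently $M_{[m]}=0$), and $\mathcal{F}$ the full subcategory of objects with $T_i(M_{\sigma_i})=0$ for all $i$. The functor $T$ is given by $T(M)_{\sigma_i}=T_i(M_{\sigma_i})$, $T(M)_{[m]}=0$, and $F(M)_\sigma=M_\sigma/T(M)_\sigma$. A torsion pair in an abelian category is a pair of full subcategories $(\mathcal{T},\mathcal{F})$, closed under isomorphisms, such that every object $M$ sits in a short exact sequence $0\to T(M)\to M\to F(M)\to0$ with $T(M)\in\mathcal{T}$, $F(M)\in\mathcal{F}$, and $\mathrm{Hom}(A,B)=0$ for $A\in\mathcal{T}$, $B\in\mathcal{F}$. *)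

theory Defs
  imports
    "HOL-Algebra.Module"
    "HOL-Algebra.AbelCoset"
    "HOL-Algebra.Generated_Groups"
    "HOL-Algebra.Free_Abelian_Groups"
    "HOL-Analysis.Finite_Cartesian_Product"
begin

text \<open>
  The index set \<open>[m]\<close> is a finite type \<open>'m\<close> with \<open>m = CARD('m) \<ge> 1\<close>, the field \<open>k\<close> is a type
  \<open>'k\<close> of class \<open>field\<close>, and multidegrees are vectors in \<open>int ^ 'm\<close>.  The Laurent polynomial
  ring \<open>k[t\<^sub>i, t\<^sub>i\<^sup>-\<^sup>1 | i \<in> [m]]\<close> is the group algebra \<open>(int ^ 'm) \<Rightarrow>\<^sub>0 'k\<close>; all the rings
  \<open>R\<^sub>\<sigma>\<close> are realised as subrings of it.
\<close>


section \<open>The rings \<open>R\<^sub>\<sigma>\<close>\<close>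

type_synonym ('k, 'm) laurent = "(int ^ 'm) \<Rightarrow>\<^sub>0 'k"

definition tvar :: "'m::finite \<Rightarrow> ('k::field, 'm) laurent" where
  "tvar i = Poly_Mapping.single (axis i 1) 1"

definition cone :: "'m::finite set \<Rightarrow> (int ^ 'm) set" where
  "cone \<sigma> = {d. \<forall>i. i \<notin> \<sigma> \<longrightarrow> 0 \<le> d $ i}"

text \<open>\<open>Rloc {}\<close> is the polynomial ring \<open>R\<close>; \<open>Rloc \<sigma>\<close> is \<open>R[t\<^sub>i\<^sup>-\<^sup>1 | i \<in> \<sigma>]\<close>, see
  \<open>Rloc_iff_monomial_multiple\<close> below.\<close>

definition Rloc :: "'m::finite set \<Rightarrow> ('k::field, 'm) laurent ring" where
  "Rloc \<sigma> = \<lparr>carrier = {p. Poly_Mapping.keys p \<subseteq> cone \<sigma>},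
             monoid.mult = (*), monoid.one = 1, ring.zero = 0, add = (+)\<rparr>"

definition Rgrade :: "'m::finite set \<Rightarrow> int ^ 'm \<Rightarrow> ('k::field, 'm) laurent set" where
  "Rgrade \<sigma> d = {p \<in> carrier (Rloc \<sigma>). Poly_Mapping.keys p \<subseteq> {d}}"

lemma cring_Rloc: "cring (Rloc \<sigma> :: ('k::field, 'm::finite) laurent ring)"
proof -
  have times: "Poly_Mapping.keys (p * q) \<subseteq> cone \<sigma>"
    if "Poly_Mapping.keys p \<subseteq> cone \<sigma>" "Poly_Mapping.keys q \<subseteq> cone \<sigma>"
    for p q :: "('k, 'm) laurent"
  proof
    fix d assume "d \<in> Poly_Mapping.keys (p * q)"
    then obtain a b where "d = a + b" "a \<in> Poly_Mapping.keys p" "b \<in> Poly_Mapping.keys q"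
      using keys_mult[of p q] by auto
    with that show "d \<in> cone \<sigma>" by (auto simp: cone_def subset_iff)
  qed
  have plus: "Poly_Mapping.keys (p + q) \<subseteq> cone \<sigma>"
    if "Poly_Mapping.keys p \<subseteq> cone \<sigma>" "Poly_Mapping.keys q \<subseteq> cone \<sigma>"
    for p q :: "('k, 'm) laurent"
    using that keys_add[of p q] by blast
  have one: "Poly_Mapping.keys (1 :: ('k, 'm) laurent) \<subseteq> cone \<sigma>"
    by (simp add: cone_def)
  show ?thesis
  proof (rule cringI)
    show "abelian_group (Rloc \<sigma> :: ('k, 'm) laurent ring)"
    proof (rule abelian_groupI)
      fix p :: "('k, 'm) laurent"
      assume "p \<in> carrier (Rloc \<sigma>)"
      then show "\<exists>q\<in>carrier (Rloc \<sigma>). q \<oplus>\<^bsub>Rloc \<sigma>\<^esub> p = \<zero>\<^bsub>Rloc \<sigma>\<^esub>"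
        by (intro bexI[of _ "- p"]) (auto simp: Rloc_def)
    qed (auto simp: Rloc_def algebra_simps dest: plus[THEN subsetD, rotated 2])
    show "Group.comm_monoid (Rloc \<sigma> :: ('k, 'm) laurent ring)"
      by (rule comm_monoidI)
        (use one in \<open>auto simp: Rloc_def algebra_simps dest: times[THEN subsetD, rotated 2]\<close>)
  qed (auto simp: Rloc_def algebra_simps)
qed

lemma Rloc_iff_monomial_multiple:
  fixes p :: "('k::field, 'm::finite) laurent"
  shows "p \<in> carrier (Rloc \<sigma>) \<longleftrightarrow>
    (\<exists>n. (\<Prod>i\<in>\<sigma>. tvar i) ^ n * p \<in> carrier (Rloc {}))"
proof -
  define e :: "int ^ 'm" where "e = (\<chi> i. if i \<in> \<sigma> then 1 else 0)"
  have "(\<Prod>i\<in>S. tvar i) = (Poly_Mapping.single (\<chi> i. if i \<in> S then 1 else 0) 1 :: ('k, 'm) laurent)"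
    if "finite S" for S
    using that
  proof (induction S)
    case empty
    have "(\<chi> i. 0) = (0 :: int ^ 'm)" by (simp add: vec_eq_iff)
    then show ?case by simp
  next
    case (insert x S)
    have "axis x 1 + (\<chi> i. if i \<in> S then 1 else 0) = (\<chi> i. if i \<in> insert x S then (1::int) else 0)"
      using insert.hyps by (auto simp: vec_eq_iff axis_def)
    with insert show ?case by (simp add: tvar_def mult_single)
  qed
  then have prod: "(\<Prod>i\<in>\<sigma>. tvar i) = (Poly_Mapping.single e 1 :: ('k, 'm) laurent)"
    by (simp add: e_def)
  have pow: "(\<Prod>i\<in>\<sigma>. tvar i) ^ n = (Poly_Mapping.single (of_nat n *s e) 1 :: ('k, 'm) laurent)" for n
    unfolding prod
  proof (induction n)
    case 0
    have "(of_nat 0 *s e) = 0" by (simp add: vec_eq_iff)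
    then show ?case by simp
  next
    case (Suc n)
    have "e + of_nat n *s e = of_nat (Suc n) *s e" by (simp add: vec_eq_iff algebra_simps)
    with Suc show ?case by (simp add: mult_single)
  qed
  have keys: "Poly_Mapping.keys (Poly_Mapping.single a 1 * q) = (+) a ` Poly_Mapping.keys q"
    for a and q :: "('k, 'm) laurent"
  proof
    show sub: "Poly_Mapping.keys (Poly_Mapping.single a 1 * q) \<subseteq> (+) a ` Poly_Mapping.keys q"
      for a and q :: "('k, 'm) laurent"
      using keys_mult[of "Poly_Mapping.single a 1" q] by auto
    have "q = Poly_Mapping.single (- a) 1 * (Poly_Mapping.single a 1 * q)"
      by (simp add: mult_single mult.assoc[symmetric])
    then have "Poly_Mapping.keys q
        \<subseteq> (+) (- a) ` Poly_Mapping.keys (Poly_Mapping.single a 1 * q)"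
      using sub[of "- a" "Poly_Mapping.single a 1 * q"] by simp
    then show "(+) a ` Poly_Mapping.keys q \<subseteq> Poly_Mapping.keys (Poly_Mapping.single a 1 * q)"
      by force
  qed
  show ?thesis
  proof
    assume p: "p \<in> carrier (Rloc \<sigma>)"
    define B where "B = (\<Sum>d\<in>Poly_Mapping.keys p. \<Sum>i\<in>UNIV. \<bar>d $ i\<bar>)"
    have bound: "\<bar>d $ i\<bar> \<le> B" if "d \<in> Poly_Mapping.keys p" for d i
    proof -
      have "\<bar>d $ i\<bar> \<le> (\<Sum>i\<in>UNIV. \<bar>d $ i\<bar>)" by (rule member_le_sum) auto
      also have "\<dots> \<le> B" unfolding B_def
        by (rule member_le_sum[OF that]) (auto intro: sum_nonneg)
      finally show ?thesis .
    qed
    have "B \<ge> 0" unfolding B_def by (intro sum_nonneg) auto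
    have "0 \<le> (of_nat (nat B) *s e + d) $ i" if d: "d \<in> Poly_Mapping.keys p" for d i
    proof (cases "i \<in> \<sigma>")
      case True
      then show ?thesis using bound[OF d, of i] \<open>B \<ge> 0\<close> by (simp add: e_def)
    next
      case False
      then show ?thesis using p d by (auto simp: Rloc_def cone_def e_def)
    qed
    then have "Poly_Mapping.single (of_nat (nat B) *s e) 1 * p \<in> carrier (Rloc {})"
      by (auto simp: Rloc_def keys cone_def)
    then show "\<exists>n. (\<Prod>i\<in>\<sigma>. tvar i) ^ n * p \<in> carrier (Rloc {})"
      unfolding pow by blast
  next
    assume "\<exists>n. (\<Prod>i\<in>\<sigma>. tvar i) ^ n * p \<in> carrier (Rloc {})"
    then obtain n where "Poly_Mapping.single (of_nat n *s e) 1 * p \<in> carrier (Rloc {})"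
      unfolding pow by blast
    then have *: "0 \<le> (of_nat n *s e + d) $ i" if "d \<in> Poly_Mapping.keys p" for d i
      using that by (auto simp: Rloc_def keys cone_def)
    then have "0 \<le> d $ i" if "d \<in> Poly_Mapping.keys p" "i \<notin> \<sigma>" for d i
      using that(2) *[OF that(1), of i] by (simp add: e_def)
    then show "p \<in> carrier (Rloc \<sigma>)"
      by (auto simp: Rloc_def cone_def)
  qed
qed


section \<open>Multigraded modules\<close>

record ('k::field, 'm::finite, 'a) gmodule = "(('k, 'm) laurent, 'a) module" +
  grade :: "int ^ 'm \<Rightarrow> 'a set"

definition graded_module :: "'m::finite set \<Rightarrow> ('k::field, 'm, 'a) gmodule \<Rightarrow> bool" where
  "graded_module \<sigma> M \<longleftrightarrow>
     Module.module (Rloc \<sigma>) M \<and>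
     (\<forall>d. subgroup (grade M d) (add_monoid M)) \<and>
     (\<forall>x\<in>carrier M. \<exists>!c. (\<forall>d. c d \<in> grade M d) \<and> finite {d. c d \<noteq> \<zero>\<^bsub>M\<^esub>} \<and>
        x = (\<Oplus>\<^bsub>M\<^esub>d\<in>{d. c d \<noteq> \<zero>\<^bsub>M\<^esub>}. c d)) \<and>
     (\<forall>e d. \<forall>p\<in>Rgrade \<sigma> e. \<forall>x\<in>grade M d. p \<odot>\<^bsub>M\<^esub> x \<in> grade M (e + d)) \<and>
     (\<forall>d. d \<notin> cone \<sigma> \<longrightarrow> grade M d = {\<zero>\<^bsub>M\<^esub>})"

definition fin_gen :: "'m::finite set \<Rightarrow> ('k::field, 'm, 'a) gmodule \<Rightarrow> bool" where
  "fin_gen \<sigma> M \<longleftrightarrow>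
     (\<exists>A. finite A \<and> A \<subseteq> carrier M \<and>
        (\<forall>x\<in>carrier M. \<exists>c\<in>A \<rightarrow> carrier (Rloc \<sigma>). x = (\<Oplus>\<^bsub>M\<^esub>a\<in>A. c a \<odot>\<^bsub>M\<^esub> a)))"

text \<open>Since \<open>Rloc \<sigma>\<close> is a subring of \<open>Rloc UNIV\<close>, an \<open>R\<^bsub>[m]\<^esub>\<close>-module is an \<open>R\<^sub>\<sigma>\<close>-module without
  any change of the record, so \<open>N\<close> below may be a module over a larger localization.\<close>

definition ghom ::
  "'m::finite set \<Rightarrow> ('k::field, 'm, 'a) gmodule \<Rightarrow> ('k, 'm, 'b) gmodule \<Rightarrow> ('a \<Rightarrow> 'b) \<Rightarrow> bool" where
  "ghom \<sigma> M N f \<longleftrightarrow>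
     f \<in> carrier M \<rightarrow> carrier N \<and>
     (\<forall>x\<in>carrier M. \<forall>y\<in>carrier M. f (x \<oplus>\<^bsub>M\<^esub> y) = f x \<oplus>\<^bsub>N\<^esub> f y) \<and>
     (\<forall>p\<in>carrier (Rloc \<sigma>). \<forall>x\<in>carrier M. f (p \<odot>\<^bsub>M\<^esub> x) = p \<odot>\<^bsub>N\<^esub> f x) \<and>
     (\<forall>d. f ` grade M d \<subseteq> grade N d)"

definition giso ::
  "'m::finite set \<Rightarrow> ('k::field, 'm, 'a) gmodule \<Rightarrow> ('k, 'm, 'b) gmodule \<Rightarrow> ('a \<Rightarrow> 'b) \<Rightarrow> bool" where
  "giso \<sigma> M N f \<longleftrightarrow> ghom \<sigma> M N f \<and>
     (\<exists>g. ghom \<sigma> N M g \<and> (\<forall>x\<in>carrier M. g (f x) = x) \<and> (\<forall>y\<in>carrier N. f (g y) = y))"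

definition gsub :: "('k::field, 'm::finite, 'a) gmodule \<Rightarrow> 'a set \<Rightarrow> ('k, 'm, 'a) gmodule" where
  "gsub M N = M\<lparr>carrier := N, grade := (\<lambda>d. grade M d \<inter> N)\<rparr>"

text \<open>In the records below the fields \<open>mult\<close> and \<open>one\<close>, inherited from \<open>ring\<close>, play no role.\<close>

definition gquot :: "('k::field, 'm::finite, 'a) gmodule \<Rightarrow> 'a set \<Rightarrow> ('k, 'm, 'a set) gmodule" where
  "gquot M N =
     \<lparr>carrier = a_rcosets\<^bsub>M\<^esub> N, monoid.mult = undefined, monoid.one = undefined,
      ring.zero = N, add = (\<lambda>X Y. X <+>\<^bsub>M\<^esub> Y),
      smult = (\<lambda>p X. \<Union>x\<in>X. N +>\<^bsub>M\<^esub> (p \<odot>\<^bsub>M\<^esub> x)),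
      grade = (\<lambda>d. (\<lambda>x. N +>\<^bsub>M\<^esub> x) ` grade M d)\<rparr>"

definition gdsum ::
  "('k::field, 'm::finite, 'a) gmodule \<Rightarrow> ('k, 'm, 'b) gmodule \<Rightarrow> ('k, 'm, 'a \<times> 'b) gmodule" where
  "gdsum M N =
     \<lparr>carrier = carrier M \<times> carrier N, monoid.mult = undefined, monoid.one = undefined,
      ring.zero = (\<zero>\<^bsub>M\<^esub>, \<zero>\<^bsub>N\<^esub>),
      add = (\<lambda>(x, y) (x', y'). (x \<oplus>\<^bsub>M\<^esub> x', y \<oplus>\<^bsub>N\<^esub> y')),
      smult = (\<lambda>p (x, y). (p \<odot>\<^bsub>M\<^esub> x, p \<odot>\<^bsub>N\<^esub> y)),
      grade = (\<lambda>d. grade M d \<times> grade N d)\<rparr>"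


section \<open>Extension of scalars to \<open>R\<^bsub>[m]\<^esub>\<close>\<close>

text \<open>The tensor product \<open>R\<^bsub>[m]\<^esub> \<otimes> M\<close> over \<open>R\<^sub>\<sigma>\<close> is the free abelian group on
  \<open>R\<^bsub>[m]\<^esub> \<times> M\<close> modulo the subgroup generated by the biadditivity and balancing relations.\<close>

type_synonym ('k, 'm, 'a) tens = "((('k, 'm) laurent \<times> 'a) \<Rightarrow>\<^sub>0 int) set"

definition tensor_free ::
  "('k::field, 'm::finite, 'a) gmodule \<Rightarrow> ((('k, 'm) laurent \<times> 'a) \<Rightarrow>\<^sub>0 int) monoid" where
  "tensor_free M = free_Abelian_group (carrier (Rloc UNIV) \<times> carrier M)"

definition tensor_rels :: "'m::finite set \<Rightarrow> ('k::field, 'm, 'a) gmodule \<Rightarrow> ('k, 'm, 'a) tens" where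
  "tensor_rels \<sigma> M =
     {frag_of (r + s, x) - frag_of (r, x) - frag_of (s, x) | r s x.
        r \<in> carrier (Rloc UNIV) \<and> s \<in> carrier (Rloc UNIV) \<and> x \<in> carrier M} \<union>
     {frag_of (r, x \<oplus>\<^bsub>M\<^esub> y) - frag_of (r, x) - frag_of (r, y) | r x y.
        r \<in> carrier (Rloc UNIV) \<and> x \<in> carrier M \<and> y \<in> carrier M} \<union>
     {frag_of (r * a, x) - frag_of (r, a \<odot>\<^bsub>M\<^esub> x) | r a x.
        r \<in> carrier (Rloc UNIV) \<and> a \<in> carrier (Rloc \<sigma>) \<and> x \<in> carrier M}"

definition tensor_null :: "'m::finite set \<Rightarrow> ('k::field, 'm, 'a) gmodule \<Rightarrow> ('k, 'm, 'a) tens" where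
  "tensor_null \<sigma> M = generate (tensor_free M) (tensor_rels \<sigma> M)"

definition pure_tensor ::
  "'m::finite set \<Rightarrow> ('k::field, 'm, 'a) gmodule \<Rightarrow> ('k, 'm) laurent \<Rightarrow> 'a \<Rightarrow> ('k, 'm, 'a) tens" where
  "pure_tensor \<sigma> M r x = tensor_null \<sigma> M #>\<^bsub>tensor_free M\<^esub> frag_of (r, x)"

definition ext_scalars ::
  "'m::finite set \<Rightarrow> ('k::field, 'm, 'a) gmodule \<Rightarrow> ('k, 'm, ('k, 'm, 'a) tens) gmodule" where
  "ext_scalars \<sigma> M =
     \<lparr>carrier = carrier (tensor_free M Mod tensor_null \<sigma> M),
      monoid.mult = undefined, monoid.one = undefined,
      ring.zero = \<one>\<^bsub>tensor_free M Mod tensor_null \<sigma> M\<^esub>,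
      add = (\<lambda>X Y. X \<otimes>\<^bsub>tensor_free M Mod tensor_null \<sigma> M\<^esub> Y),
      smult = (\<lambda>p X. \<Union>c\<in>X. tensor_null \<sigma> M #>\<^bsub>tensor_free M\<^esub>
                          frag_extend (\<lambda>(r, x). frag_of (p * r, x)) c),
      grade = (\<lambda>d. generate (tensor_free M Mod tensor_null \<sigma> M)
                     {pure_tensor \<sigma> M r x | r x e f. r \<in> Rgrade UNIV e \<and> x \<in> grade M f \<and> e + f = d})\<rparr>"

text \<open>The map \<open>R\<^bsub>[m]\<^esub> \<otimes> M \<rightarrow> N\<close> induced by an \<open>R\<^sub>\<sigma>\<close>-linear \<open>\<phi> : M \<rightarrow> N\<close> is the one sending \<open>r \<otimes> x\<close>
  to \<open>r \<phi>(x)\<close>; pure tensors generate, so this formula determines it.\<close>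

definition induced_iso ::
  "'m::finite set \<Rightarrow> ('k::field, 'm, 'a) gmodule \<Rightarrow> ('k, 'm, 'b) gmodule \<Rightarrow> ('a \<Rightarrow> 'b) \<Rightarrow> bool" where
  "induced_iso \<sigma> M N \<phi> \<longleftrightarrow>
     (\<exists>h. giso UNIV (ext_scalars \<sigma> M) N h \<and>
        (\<forall>r\<in>carrier (Rloc UNIV). \<forall>x\<in>carrier M. h (pure_tensor \<sigma> M r x) = r \<odot>\<^bsub>N\<^esub> \<phi> x))"


section \<open>The category of \<open>K\<^sub>m\<close>-localized persistence modules\<close>

definition Km :: "'m::finite set set" where
  "Km = {\<sigma>. int (card \<sigma>) \<le> int CARD('m) - 2}"

lemma notin_Km_iff: "\<sigma> \<notin> Km \<longleftrightarrow> \<sigma> = UNIV \<or> (\<exists>i. \<sigma> = - {i})" for \<sigma> :: "'m::finite set"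
proof -
  have "card \<sigma> + card (- \<sigma>) = CARD('m)"
    using card_Un_disjoint[of \<sigma> "- \<sigma>"] by simp
  then have "\<sigma> \<notin> Km \<longleftrightarrow> card (- \<sigma>) = 0 \<or> card (- \<sigma>) = 1"
    unfolding Km_def mem_Collect_eq by arith
  also have "\<dots> \<longleftrightarrow> - \<sigma> = {} \<or> (\<exists>i. - \<sigma> = {i})"
    by (auto simp: card_1_singleton_iff)
  also have "\<dots> \<longleftrightarrow> \<sigma> = UNIV \<or> (\<exists>i. \<sigma> = - {i})"
    by (metis Compl_UNIV_eq double_complement)
  finally show ?thesis .
qed

text \<open>Only \<open>lmod M \<sigma>\<close> for \<open>\<sigma> \<notin> Km\<close> is meaningful; the values at \<open>\<sigma> \<in> Km\<close> are ignored everywhere.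
  The set \<open>\<sigma>\<^sub>i\<close> is \<open>- {i}\<close>.\<close>

record (overloaded) ('k::field, 'm::finite, 'a) lpm =
  lmod :: "'m set \<Rightarrow> ('k, 'm, 'a) gmodule"
  lmap :: "'m \<Rightarrow> 'a \<Rightarrow> 'a"

definition LKm :: "('k::field, 'm::finite, 'a) lpm set" where
  "LKm = {M.
     (\<forall>\<sigma>. \<sigma> \<notin> Km \<longrightarrow> graded_module \<sigma> (lmod M \<sigma>) \<and> fin_gen \<sigma> (lmod M \<sigma>)) \<and>
     (\<forall>i. ghom (- {i}) (lmod M (- {i})) (lmod M UNIV) (lmap M i) \<and>
          induced_iso (- {i}) (lmod M (- {i})) (lmod M UNIV) (lmap M i))}"

definition lhom ::
  "('k::field, 'm::finite, 'a) lpm \<Rightarrow> ('k, 'm, 'b) lpm \<Rightarrow> ('m set \<Rightarrow> 'a \<Rightarrow> 'b) \<Rightarrow> bool" where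
  "lhom M N f \<longleftrightarrow> M \<in> LKm \<and> N \<in> LKm \<and>
     (\<forall>\<sigma>. \<sigma> \<notin> Km \<longrightarrow> ghom \<sigma> (lmod M \<sigma>) (lmod N \<sigma>) (f \<sigma>)) \<and>
     (\<forall>i. \<forall>x\<in>carrier (lmod M (- {i})). f UNIV (lmap M i x) = lmap N i (f (- {i}) x))"

definition lhom_eq ::
  "('k::field, 'm::finite, 'a) lpm \<Rightarrow> ('m set \<Rightarrow> 'a \<Rightarrow> 'b) \<Rightarrow> ('m set \<Rightarrow> 'a \<Rightarrow> 'b) \<Rightarrow> bool" where
  "lhom_eq M f g \<longleftrightarrow> (\<forall>\<sigma>. \<sigma> \<notin> Km \<longrightarrow> (\<forall>x\<in>carrier (lmod M \<sigma>). f \<sigma> x = g \<sigma> x))"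

definition lzero :: "('k::field, 'm::finite, 'b) lpm \<Rightarrow> 'm set \<Rightarrow> 'a \<Rightarrow> 'b" where
  "lzero N = (\<lambda>\<sigma> x. \<zero>\<^bsub>lmod N \<sigma>\<^esub>)"

definition Hom_zero :: "('k::field, 'm::finite, 'a) lpm \<Rightarrow> ('k, 'm, 'b) lpm \<Rightarrow> bool" where
  "Hom_zero A B \<longleftrightarrow> (\<forall>f. lhom A B f \<longrightarrow> lhom_eq A f (lzero B))"

definition lisomorphic :: "('k::field, 'm::finite, 'a) lpm \<Rightarrow> ('k, 'm, 'b) lpm \<Rightarrow> bool" where
  "lisomorphic M N \<longleftrightarrow>
     (\<exists>f g. lhom M N f \<and> lhom N M g \<and>
        lhom_eq M (\<lambda>\<sigma>. g \<sigma> \<circ> f \<sigma>) (\<lambda>\<sigma>. id) \<and> lhom_eq N (\<lambda>\<sigma>. f \<sigma> \<circ> g \<sigma>) (\<lambda>\<sigma>. id))"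

definition ldsum ::
  "('k::field, 'm::finite, 'a) lpm \<Rightarrow> ('k, 'm, 'b) lpm \<Rightarrow> ('k, 'm, 'a \<times> 'b) lpm" where
  "ldsum M N =
     \<lparr>lmod = (\<lambda>\<sigma>. gdsum (lmod M \<sigma>) (lmod N \<sigma>)),
      lmap = (\<lambda>i (x, y). (lmap M i x, lmap N i y))\<rparr>"

text \<open>Kernels and cokernels in \<open>LKm\<close> are computed pointwise, hence so is exactness.\<close>

definition short_exact ::
  "('k::field, 'm::finite, 'a) lpm \<Rightarrow> ('m set \<Rightarrow> 'a \<Rightarrow> 'b) \<Rightarrow> ('k, 'm, 'b) lpm
     \<Rightarrow> ('m set \<Rightarrow> 'b \<Rightarrow> 'c) \<Rightarrow> ('k, 'm, 'c) lpm \<Rightarrow> bool" where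
  "short_exact A f M g B \<longleftrightarrow> lhom A M f \<and> lhom M B g \<and>
     (\<forall>\<sigma>. \<sigma> \<notin> Km \<longrightarrow>
        inj_on (f \<sigma>) (carrier (lmod A \<sigma>)) \<and>
        f \<sigma> ` carrier (lmod A \<sigma>) = {x \<in> carrier (lmod M \<sigma>). g \<sigma> x = \<zero>\<^bsub>lmod B \<sigma>\<^esub>} \<and>
        g \<sigma> ` carrier (lmod M \<sigma>) = carrier (lmod B \<sigma>))"

definition split_exact ::
  "('k::field, 'm::finite, 'a) lpm \<Rightarrow> ('m set \<Rightarrow> 'a \<Rightarrow> 'b) \<Rightarrow> ('k, 'm, 'b) lpm
     \<Rightarrow> ('m set \<Rightarrow> 'b \<Rightarrow> 'c) \<Rightarrow> ('k, 'm, 'c) lpm \<Rightarrow> bool" where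
  "split_exact A f M g B \<longleftrightarrow> short_exact A f M g B \<and>
     (\<exists>s. lhom B M s \<and> lhom_eq B (\<lambda>\<sigma>. g \<sigma> \<circ> s \<sigma>) (\<lambda>\<sigma>. id))"

text \<open>Torsion pairs in \<open>LKm\<close>, a full subcategory being given by its set of objects.  All objects here
  have carriers in one type \<open>'a\<close>.  The quotient \<open>Fpart M\<close> below has carriers in \<open>'a set\<close>, so the
  torsion-free term of the sequence for \<open>M\<close> can only be an isomorphic copy of it.\<close>

definition torsion_pair ::
  "('k::field, 'm::finite, 'a) lpm set \<Rightarrow> ('k, 'm, 'a) lpm set \<Rightarrow> bool" where
  "torsion_pair \<T> \<F> \<longleftrightarrow> \<T> \<subseteq> LKm \<and> \<F> \<subseteq> LKm \<and>
     (\<forall>A\<in>\<T>. \<forall>B. lisomorphic A B \<longrightarrow> B \<in> \<T>) \<and>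
     (\<forall>A\<in>\<F>. \<forall>B. lisomorphic A B \<longrightarrow> B \<in> \<F>) \<and>
     (\<forall>M\<in>(LKm :: ('k, 'm, 'a) lpm set). \<exists>A\<in>\<T>. \<exists>B\<in>\<F>. \<exists>f g. short_exact A f M g B) \<and>
     (\<forall>A\<in>\<T>. \<forall>B\<in>\<F>. Hom_zero A B)"


section \<open>The torsion and torsion-free parts\<close>

definition tors :: "'m::finite \<Rightarrow> ('k::field, 'm, 'a) gmodule \<Rightarrow> 'a set" where
  "tors i N = {x \<in> carrier N. \<exists>n::nat. tvar i ^ n \<odot>\<^bsub>N\<^esub> x = \<zero>\<^bsub>N\<^esub>}"

definition TT :: "('k::field, 'm::finite, 'a) lpm set" where
  "TT = {M \<in> LKm. \<forall>i. tors i (lmod M (- {i})) = carrier (lmod M (- {i}))}"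

definition FF :: "('k::field, 'm::finite, 'a) lpm set" where
  "FF = {M \<in> LKm. \<forall>i. tors i (lmod M (- {i})) = {\<zero>\<^bsub>lmod M (- {i})\<^esub>}}"

text \<open>For \<open>\<sigma> = - {i}\<close> the union has the single term \<open>tors i\<close>.\<close>

definition Tcarrier :: "('k::field, 'm::finite, 'a) lpm \<Rightarrow> 'm set \<Rightarrow> 'a set" where
  "Tcarrier M \<sigma> =
     (if \<sigma> = UNIV then {\<zero>\<^bsub>lmod M \<sigma>\<^esub>} else (\<Union>i\<in>- \<sigma>. tors i (lmod M \<sigma>)))"

definition Tpart :: "('k::field, 'm::finite, 'a) lpm \<Rightarrow> ('k, 'm, 'a) lpm" where
  "Tpart M = \<lparr>lmod = (\<lambda>\<sigma>. gsub (lmod M \<sigma>) (Tcarrier M \<sigma>)), lmap = lmap M\<rparr>"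

definition Fpart :: "('k::field, 'm::finite, 'a) lpm \<Rightarrow> ('k, 'm, 'a set) lpm" where
  "Fpart M =
     \<lparr>lmod = (\<lambda>\<sigma>. gquot (lmod M \<sigma>) (Tcarrier M \<sigma>)),
      lmap = (\<lambda>i X. \<Union>x\<in>X. Tcarrier M UNIV +>\<^bsub>lmod M UNIV\<^esub> lmap M i x)\<rparr>"

definition Tincl :: "('k::field, 'm::finite, 'a) lpm \<Rightarrow> 'm set \<Rightarrow> 'a \<Rightarrow> 'a" where
  "Tincl M = (\<lambda>\<sigma>. id)"

definition Fproj :: "('k::field, 'm::finite, 'a) lpm \<Rightarrow> 'm set \<Rightarrow> 'a \<Rightarrow> 'a set" where
  "Fproj M = (\<lambda>\<sigma> x. Tcarrier M \<sigma> +>\<^bsub>lmod M \<sigma>\<^esub> x)"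

end

theory Submission
  imports Defs
begin

text \<open>
  At \<open>\<sigma>\<^sub>i = [m] - {i}\<close> all variables except \<open>t\<^sub>i\<close> are invertible, so a graded \<open>R\<^sub>\<sigma>\<close>-module
  behaves like a graded module over \<open>k[t\<^sub>i]\<close> whose degrees are bounded below.  Over \<open>k[t]\<close> such a
  module is free as soon as it is torsion-free, because generators can be chosen degree by degree.
  Hence the torsion submodule of \<open>M\<close> at \<open>\<sigma>\<^sub>i\<close> has a graded complement.  The same choice, degree by degree, is
  made here inside the module: Zorn's lemma yields a maximal graded submodule \<open>C\<close> that meets the
  torsion \<open>T\<close> trivially and for which \<open>C + T\<close> is closed under division by \<open>t\<^sub>i\<close>, and a homogeneous
  element of least \<open>i\<close>-th degree outside \<open>C + T\<close> could be adjoined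
  (\<open>partial_complement_extend\<close>, \<open>torsion_complement_projection\<close>).

  This gives at every \<open>\<sigma>\<^sub>i\<close> an idempotent graded endomorphism \<open>P\<close> whose kernel is the torsion; at
  \<open>[m]\<close>, where the torsion part is zero, \<open>P\<close> is the identity.  The structure maps kill torsion, since
  \<open>t\<^sub>i\<close> is invertible on \<open>M\<close> at \<open>[m]\<close>, so these projections form an endomorphism of \<open>M\<close>.  Everything
  is read off from it: \<open>T(M)\<close> is the image of \<open>1 - P\<close>, the section of \<open>M \<rightarrow> F(M)\<close> is
  induced by \<open>P\<close>, and \<open>x \<mapsto> (x - P x, x + T)\<close> is the isomorphism onto the direct sum.

  That all these objects lie in \<open>\<L>(K\<^sub>m)\<close> is proved by one argument.  Each of them is the image of \<open>M\<close>
  under a surjective map that transports operations and gradings and has a homogeneous kernel, and the module axioms, the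
  grading and finite generation pass to such images (\<open>gepi_graded_module\<close>, \<open>gepi_fin_gen\<close>).  The
  tensor product condition is replaced by an equivalent one on elements: every element of \<open>M\<close>
  at \<open>[m]\<close> is \<open>t\<^sub>i\<^sup>-\<^sup>n \<phi>\<^sub>i(x)\<close> for some \<open>x\<close>, and \<open>\<phi>\<^sub>i(x) = 0\<close> only if \<open>x\<close> is torsion
  (\<open>induced_iso_imp_localizes\<close>, \<open>localizes_imp_induced_iso\<close>).  In this form it is inherited by the
  images in question (\<open>lepi_codomain\<close>).
\<close>

section \<open>Homogeneous components\<close>

definition is_decomp :: "('k::field, 'm::finite, 'a) gmodule \<Rightarrow> 'a \<Rightarrow> (int ^ 'm \<Rightarrow> 'a) \<Rightarrow> bool" where
  "is_decomp M x c \<longleftrightarrow> (\<forall>d. c d \<in> grade M d) \<and> finite {d. c d \<noteq> \<zero>\<^bsub>M\<^esub>} \<and>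
     x = (\<Oplus>\<^bsub>M\<^esub>d\<in>{d. c d \<noteq> \<zero>\<^bsub>M\<^esub>}. c d)"

definition gcomp :: "('k::field, 'm::finite, 'a) gmodule \<Rightarrow> 'a \<Rightarrow> int ^ 'm \<Rightarrow> 'a" where
  "gcomp M x = (THE c. is_decomp M x c)"

locale gmod =
  fixes \<sigma> :: "'m::finite set" and M :: "('k::field, 'm, 'a) gmodule" (structure)
  assumes graded: "graded_module \<sigma> M"

sublocale gmod \<subseteq> Module.module "Rloc \<sigma>" M
  using graded by (simp add: graded_module_def)

lemma carrier_Rloc: "p \<in> carrier (Rloc \<sigma>) \<longleftrightarrow> Poly_Mapping.keys p \<subseteq> cone \<sigma>"
  by (simp add: Rloc_def)

lemma Rloc_simps [simp]:
  "\<zero>\<^bsub>Rloc \<sigma>\<^esub> = 0" "\<one>\<^bsub>Rloc \<sigma>\<^esub> = 1" "p \<oplus>\<^bsub>Rloc \<sigma>\<^esub> q = p + q" "p \<otimes>\<^bsub>Rloc \<sigma>\<^esub> q = p * q"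
  by (simp_all add: Rloc_def)

lemma zero_in_cone [simp]: "0 \<in> cone \<sigma>"
  by (simp add: cone_def)

lemma single_in_Rgrade: "e \<in> cone \<sigma> \<Longrightarrow> Poly_Mapping.single e a \<in> Rgrade \<sigma> e"
  by (simp add: Rgrade_def carrier_Rloc)

lemma single_in_Rloc: "e \<in> cone \<sigma> \<Longrightarrow> Poly_Mapping.single e a \<in> carrier (Rloc \<sigma>)"
  by (simp add: carrier_Rloc)

context gmod
begin

lemma single_closed [simp]: "e \<in> cone \<sigma> \<Longrightarrow> Poly_Mapping.single e (a :: 'k) \<in> carrier (Rloc \<sigma>)"
  by (rule single_in_Rloc)

lemma subgroup_grade: "subgroup (grade M d) (add_monoid M)"
  using graded by (simp add: graded_module_def)

lemma grade_closed: "x \<in> grade M d \<Longrightarrow> x \<in> carrier M"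
  using subgroup.subset[OF subgroup_grade] by auto

lemma grade_zero [simp]: "\<zero> \<in> grade M d"
  using subgroup.one_closed[OF subgroup_grade] by simp

lemma grade_add: "x \<in> grade M d \<Longrightarrow> y \<in> grade M d \<Longrightarrow> x \<oplus> y \<in> grade M d"
  using subgroup.m_closed[OF subgroup_grade] by simp

lemma grade_uminus: "x \<in> grade M d \<Longrightarrow> \<ominus> x \<in> grade M d"
  using subgroup.m_inv_closed[OF subgroup_grade] by (simp add: a_inv_def)

lemma grade_minus: "x \<in> grade M d \<Longrightarrow> y \<in> grade M d \<Longrightarrow> x \<ominus> y \<in> grade M d"
  by (simp add: a_minus_def grade_add grade_uminus)

lemma grade_smult:
  "e \<in> cone \<sigma> \<Longrightarrow> x \<in> grade M d \<Longrightarrow> Poly_Mapping.single e a \<odot> x \<in> grade M (e + d)"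
  using graded single_in_Rgrade unfolding graded_module_def by metis

lemma grade_outside_cone: "d \<notin> cone \<sigma> \<Longrightarrow> x \<in> grade M d \<Longrightarrow> x = \<zero>"
  using graded unfolding graded_module_def by blast

lemma ex1_decomp: "x \<in> carrier M \<Longrightarrow> \<exists>!c. is_decomp M x c"
  using graded unfolding graded_module_def is_decomp_def by blast

lemma gcomp_decomp: "x \<in> carrier M \<Longrightarrow> is_decomp M x (gcomp M x)"
  unfolding gcomp_def by (rule theI'[OF ex1_decomp])

lemma gcomp_grade: "x \<in> carrier M \<Longrightarrow> gcomp M x d \<in> grade M d"
  using gcomp_decomp by (auto simp: is_decomp_def)

lemma gcomp_closed: "x \<in> carrier M \<Longrightarrow> gcomp M x d \<in> carrier M"
  using gcomp_grade grade_closed by blast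

lemma finite_gcomp: "x \<in> carrier M \<Longrightarrow> finite {d. gcomp M x d \<noteq> \<zero>}"
  using gcomp_decomp by (auto simp: is_decomp_def)

lemma finsum_gcomp:
  assumes "x \<in> carrier M" "finite D" "{d. gcomp M x d \<noteq> \<zero>} \<subseteq> D"
  shows "x = (\<Oplus>d\<in>D. gcomp M x d)"
proof -
  have "x = (\<Oplus>d\<in>{d. gcomp M x d \<noteq> \<zero>}. gcomp M x d)"
    using gcomp_decomp[OF assms(1)] by (auto simp: is_decomp_def)
  also have "\<dots> = (\<Oplus>d\<in>D. gcomp M x d)"
    using assms by (intro add.finprod_mono_neutral_cong) (auto simp: gcomp_closed finite_gcomp)
  finally show ?thesis .
qed

lemma gcomp_eqI:
  assumes "finite D" "\<And>d. c d \<in> grade M d" "\<And>d. d \<notin> D \<Longrightarrow> c d = \<zero>" "x = (\<Oplus>d\<in>D. c d)"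
  shows "gcomp M x = c"
proof -
  have c: "c d \<in> carrier M" for d using assms(2) grade_closed by blast
  have fin: "finite {d. c d \<noteq> \<zero>}"
    using assms(1,3) by (auto intro: finite_subset[of _ D])
  moreover have "(\<Oplus>d\<in>{d. c d \<noteq> \<zero>}. c d) = (\<Oplus>d\<in>D. c d)"
    using assms(1,3) c fin by (intro add.finprod_mono_neutral_cong) auto
  ultimately have "is_decomp M x c"
    using assms by (auto simp: is_decomp_def)
  moreover have "x \<in> carrier M" using assms(4) c by auto
  ultimately show ?thesis
    unfolding gcomp_def using the1_equality[OF ex1_decomp] by blast
qed

lemma gcomp_add:
  assumes x: "x \<in> carrier M" and y: "y \<in> carrier M"
  shows "gcomp M (x \<oplus> y) d = gcomp M x d \<oplus> gcomp M y d"
proof -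
  let ?D = "{d. gcomp M x d \<noteq> \<zero>} \<union> {d. gcomp M y d \<noteq> \<zero>}"
  have fin: "finite ?D" using x y by (simp add: finite_gcomp)
  have "x \<oplus> y = (\<Oplus>d\<in>?D. gcomp M x d) \<oplus> (\<Oplus>d\<in>?D. gcomp M y d)"
    using finsum_gcomp[OF x fin] finsum_gcomp[OF y fin] by auto
  also have "\<dots> = (\<Oplus>d\<in>?D. gcomp M x d \<oplus> gcomp M y d)"
    using x y by (intro finsum_addf[symmetric]) (auto simp: gcomp_closed)
  finally have "gcomp M (x \<oplus> y) = (\<lambda>d. gcomp M x d \<oplus> gcomp M y d)"
    using x y fin by (intro gcomp_eqI[of ?D]) (auto simp: gcomp_grade grade_add)
  then show ?thesis by simp
qed

lemma gcomp_homogeneous: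
  assumes "x \<in> grade M d"
  shows "gcomp M x = (\<lambda>e. if e = d then x else \<zero>)"
  using assms grade_closed[OF assms] by (intro gcomp_eqI[of "{d}"]) auto

lemma gcomp_zero: "gcomp M \<zero> d = \<zero>"
  using gcomp_homogeneous[OF grade_zero] by auto

lemma finsum_induct:
  assumes "\<And>d. c d \<in> carrier M" "P \<zero>" "\<And>d. P (c d)"
    "\<And>x y. x \<in> carrier M \<Longrightarrow> y \<in> carrier M \<Longrightarrow> P x \<Longrightarrow> P y \<Longrightarrow> P (x \<oplus> y)"
  shows "P (\<Oplus>d\<in>D. c d)"
proof (induction D rule: infinite_finite_induct)
  case (infinite A)
  then show ?case by (simp add: assms(2) finsum_infinite)
next
  case (insert d D)
  have "P (c d \<oplus> (\<Oplus>d\<in>D. c d))"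
    by (rule assms(4)) (use assms(1,3) insert.IH in auto)
  then show ?case using insert.hyps assms(1) by simp
qed (simp add: assms(2))

lemma homogeneous_induct [consumes 1, case_names zero homogeneous add]:
  assumes "x \<in> carrier M" "P \<zero>" "\<And>d x. x \<in> grade M d \<Longrightarrow> P x"
    "\<And>x y. x \<in> carrier M \<Longrightarrow> y \<in> carrier M \<Longrightarrow> P x \<Longrightarrow> P y \<Longrightarrow> P (x \<oplus> y)"
  shows "P x"
proof -
  have "P (\<Oplus>d\<in>{d. gcomp M x d \<noteq> \<zero>}. gcomp M x d)"
    by (rule finsum_induct[OF gcomp_closed[OF assms(1)] assms(2) assms(3)[OF gcomp_grade[OF assms(1)]] assms(4)])
  then show ?thesis
    using finsum_gcomp[OF assms(1) finite_gcomp[OF assms(1)] order_refl] by simp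
qed

lemma gcomp_monomial:
  assumes e: "e \<in> cone \<sigma>" and x: "x \<in> carrier M"
  shows "gcomp M (Poly_Mapping.single e a \<odot> x) (e + d) = Poly_Mapping.single e a \<odot> gcomp M x d"
  using x
proof (induction x rule: homogeneous_induct)
  case zero
  then show ?case using e by (simp add: gcomp_zero)
next
  case (homogeneous d' x)
  then show ?case
    using e by (simp add: gcomp_homogeneous gcomp_homogeneous[OF grade_smult[OF e]])
next
  case (add x y)
  then show ?case using e
    by (simp add: smult_r_distr gcomp_add gcomp_closed)
qed

end

lemma additive_zero:
  assumes "abelian_group M" "abelian_group N" and closed: "f \<in> carrier M \<rightarrow> carrier N"
    and add: "\<And>x y. x \<in> carrier M \<Longrightarrow> y \<in> carrier M \<Longrightarrow> f (x \<oplus>\<^bsub>M\<^esub> y) = f x \<oplus>\<^bsub>N\<^esub> f y"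
  shows "f \<zero>\<^bsub>M\<^esub> = \<zero>\<^bsub>N\<^esub>"
proof -
  interpret M: abelian_group M by fact
  interpret N: abelian_group N by fact
  have "f \<zero>\<^bsub>M\<^esub> \<oplus>\<^bsub>N\<^esub> f \<zero>\<^bsub>M\<^esub> = f \<zero>\<^bsub>M\<^esub>"
    using add[of "\<zero>\<^bsub>M\<^esub>" "\<zero>\<^bsub>M\<^esub>"] by simp
  moreover have "f \<zero>\<^bsub>M\<^esub> \<in> carrier N" using closed by auto
  ultimately show ?thesis by (simp only: N.add.r_cancel_one)
qed

lemma additive_gcomp:
  assumes "gmod \<sigma> M" "gmod \<tau> N"
    and closed: "f \<in> carrier M \<rightarrow> carrier N"
    and add: "\<And>x y. x \<in> carrier M \<Longrightarrow> y \<in> carrier M \<Longrightarrow> f (x \<oplus>\<^bsub>M\<^esub> y) = f x \<oplus>\<^bsub>N\<^esub> f y"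
    and gr: "\<And>d x. x \<in> grade M d \<Longrightarrow> f x \<in> grade N d"
    and x: "x \<in> carrier M"
  shows "f (gcomp M x d) = gcomp N (f x) d"
proof -
  interpret M: gmod \<sigma> M by fact
  interpret N: gmod \<tau> N by fact
  have f0: "f \<zero>\<^bsub>M\<^esub> = \<zero>\<^bsub>N\<^esub>"
    by (rule additive_zero[OF M.abelian_group_axioms N.abelian_group_axioms closed add])
  from x show ?thesis
  proof (induction x rule: M.homogeneous_induct)
    case zero
    then show ?case by (simp add: f0 M.gcomp_zero N.gcomp_zero)
  next
    case (homogeneous d' x)
    then show ?case
      by (simp add: M.gcomp_homogeneous N.gcomp_homogeneous[OF gr] f0)
  next
    case (add x y)
    moreover have "f (x \<oplus>\<^bsub>M\<^esub> y) = f x \<oplus>\<^bsub>N\<^esub> f y" using assms(4) add by blast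
    moreover have "f x \<in> carrier N" "f y \<in> carrier N" using closed add by auto
    moreover have "f (gcomp M x d \<oplus>\<^bsub>M\<^esub> gcomp M y d) = f (gcomp M x d) \<oplus>\<^bsub>N\<^esub> f (gcomp M y d)"
      using assms(4) add by (simp add: M.gcomp_closed)
    ultimately show ?case by (simp add: M.gcomp_add N.gcomp_add)
  qed
qed

section \<open>Images of graded modules\<close>

lemma additive_finsum:
  assumes "abelian_group M" "abelian_group N" and closed: "f \<in> carrier M \<rightarrow> carrier N"
    and add: "\<And>x y. x \<in> carrier M \<Longrightarrow> y \<in> carrier M \<Longrightarrow> f (x \<oplus>\<^bsub>M\<^esub> y) = f x \<oplus>\<^bsub>N\<^esub> f y"
    and c: "\<And>d. d \<in> D \<Longrightarrow> c d \<in> carrier M"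
  shows "f (\<Oplus>\<^bsub>M\<^esub>d\<in>D. c d) = (\<Oplus>\<^bsub>N\<^esub>d\<in>D. f (c d))"
proof -
  interpret M: abelian_group M by fact
  interpret N: abelian_group N by fact
  have f0: "f \<zero>\<^bsub>M\<^esub> = \<zero>\<^bsub>N\<^esub>"
    by (rule additive_zero[OF assms(1-4)])
  show ?thesis using c
  proof (induction D rule: infinite_finite_induct)
    case (infinite A)
    then show ?case by (simp add: f0 M.finsum_infinite N.finsum_infinite)
  next
    case empty
    show ?case by (simp add: f0)
  next
    case (insert d D)
    have "(\<Oplus>\<^bsub>M\<^esub>d\<in>D. c d) \<in> carrier M" using insert by (intro M.finsum_closed) auto
    moreover have "(\<lambda>d. f (c d)) \<in> D \<rightarrow> carrier N" using closed insert by auto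
    moreover have "f (c d) \<in> carrier N" using closed insert by auto
    moreover have "c \<in> D \<rightarrow> carrier M" using insert by auto
    ultimately show ?case using insert by (simp add: add)
  qed
qed

text \<open>A graded epimorphism onto a bare record: nothing is assumed about \<open>N\<close>, and the conditions say that
its operations and grading are transported from \<open>M\<close> along \<open>f\<close>.  The last clause makes the kernel
homogeneous; this is what forces decompositions in \<open>N\<close> to be unique.  Submodules that are direct
summands, quotients and direct sums all arise in this way below, so that the module axioms, the
grading and finite generation are checked only once.\<close>

definition gepi ::
  "'m::finite set \<Rightarrow> ('k::field, 'm, 'a) gmodule \<Rightarrow> ('k, 'm, 'b) gmodule \<Rightarrow> ('a \<Rightarrow> 'b) \<Rightarrow> bool" where
  "gepi \<sigma> M N f \<longleftrightarrow>
     carrier N = f ` carrier M \<and> \<zero>\<^bsub>N\<^esub> = f \<zero>\<^bsub>M\<^esub> \<and>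
     (\<forall>x\<in>carrier M. \<forall>y\<in>carrier M. f (x \<oplus>\<^bsub>M\<^esub> y) = f x \<oplus>\<^bsub>N\<^esub> f y) \<and>
     (\<forall>p\<in>carrier (Rloc \<sigma>). \<forall>x\<in>carrier M. f (p \<odot>\<^bsub>M\<^esub> x) = p \<odot>\<^bsub>N\<^esub> f x) \<and>
     (\<forall>d. grade N d = f ` grade M d) \<and>
     (\<forall>x\<in>carrier M. f x = \<zero>\<^bsub>N\<^esub> \<longrightarrow> (\<forall>d. f (gcomp M x d) = \<zero>\<^bsub>N\<^esub>))"

lemma gepiD:
  assumes "gepi \<sigma> M N f"
  shows "carrier N = f ` carrier M" "\<zero>\<^bsub>N\<^esub> = f \<zero>\<^bsub>M\<^esub>"
    "\<And>x y. x \<in> carrier M \<Longrightarrow> y \<in> carrier M \<Longrightarrow> f (x \<oplus>\<^bsub>M\<^esub> y) = f x \<oplus>\<^bsub>N\<^esub> f y"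
    "\<And>p x. p \<in> carrier (Rloc \<sigma>) \<Longrightarrow> x \<in> carrier M \<Longrightarrow> f (p \<odot>\<^bsub>M\<^esub> x) = p \<odot>\<^bsub>N\<^esub> f x"
    "\<And>d. grade N d = f ` grade M d"
    "\<And>x d. x \<in> carrier M \<Longrightarrow> f x = \<zero>\<^bsub>N\<^esub> \<Longrightarrow> f (gcomp M x d) = \<zero>\<^bsub>N\<^esub>"
  using assms by (simp_all add: gepi_def)

lemma gepi_ghom: "gepi \<sigma> M N f \<Longrightarrow> ghom \<sigma> M N f"
  by (auto simp: gepi_def ghom_def)

lemma ghomD:
  assumes "ghom \<sigma> M N f"
  shows "f \<in> carrier M \<rightarrow> carrier N" "\<And>x. x \<in> carrier M \<Longrightarrow> f x \<in> carrier N"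
    "\<And>x y. x \<in> carrier M \<Longrightarrow> y \<in> carrier M \<Longrightarrow> f (x \<oplus>\<^bsub>M\<^esub> y) = f x \<oplus>\<^bsub>N\<^esub> f y"
    "\<And>p x. p \<in> carrier (Rloc \<sigma>) \<Longrightarrow> x \<in> carrier M \<Longrightarrow> f (p \<odot>\<^bsub>M\<^esub> x) = p \<odot>\<^bsub>N\<^esub> f x"
    "\<And>d x. x \<in> grade M d \<Longrightarrow> f x \<in> grade N d"
  using assms by (auto simp: ghom_def image_subset_iff)

lemma gepi_module:
  assumes "Module.module (Rloc \<sigma>) M" and f: "gepi \<sigma> M N f"
  shows "Module.module (Rloc \<sigma>) N"
proof -
  interpret M: Module.module "Rloc \<sigma>" M by fact
  note [simp] = gepiD(1-2)[OF f]
  note add = gepiD(3)[OF f, symmetric] and smult = gepiD(4)[OF f, symmetric]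
  show ?thesis
  proof (rule moduleI)
    show "abelian_group N"
    proof (rule abelian_groupI)
      fix y assume "y \<in> carrier N"
      then obtain x where "x \<in> carrier M" "y = f x" by auto
      then show "\<exists>z\<in>carrier N. z \<oplus>\<^bsub>N\<^esub> y = \<zero>\<^bsub>N\<^esub>"
        by (intro bexI[of _ "f (\<ominus>\<^bsub>M\<^esub> x)"]) (auto simp: add M.M.l_neg)
    qed (auto simp: add M.M.add.m_ac)
    show "p \<odot>\<^bsub>N\<^esub> y \<in> carrier N" if "p \<in> carrier (Rloc \<sigma>)" "y \<in> carrier N" for p y
      using that by (auto simp: smult)
    show "(p \<oplus>\<^bsub>Rloc \<sigma>\<^esub> q) \<odot>\<^bsub>N\<^esub> y = p \<odot>\<^bsub>N\<^esub> y \<oplus>\<^bsub>N\<^esub> q \<odot>\<^bsub>N\<^esub> y"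
      if "p \<in> carrier (Rloc \<sigma>)" "q \<in> carrier (Rloc \<sigma>)" "y \<in> carrier N" for p q y
      using that M.R.add.m_closed[of p q] M.smult_l_distr[of p q] by (auto simp: smult add)
    show "p \<odot>\<^bsub>N\<^esub> (y \<oplus>\<^bsub>N\<^esub> z) = p \<odot>\<^bsub>N\<^esub> y \<oplus>\<^bsub>N\<^esub> p \<odot>\<^bsub>N\<^esub> z"
      if "p \<in> carrier (Rloc \<sigma>)" "y \<in> carrier N" "z \<in> carrier N" for p y z
      using that by (auto simp: smult add M.smult_r_distr)
    show "(p \<otimes>\<^bsub>Rloc \<sigma>\<^esub> q) \<odot>\<^bsub>N\<^esub> y = p \<odot>\<^bsub>N\<^esub> (q \<odot>\<^bsub>N\<^esub> y)"
      if "p \<in> carrier (Rloc \<sigma>)" "q \<in> carrier (Rloc \<sigma>)" "y \<in> carrier N" for p q y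
      using that M.R.m_closed[of p q] M.smult_assoc1[of p q] by (auto simp: smult)
    show "\<one>\<^bsub>Rloc \<sigma>\<^esub> \<odot>\<^bsub>N\<^esub> y = y" if "y \<in> carrier N" for y
      using that M.R.one_closed M.smult_one by (auto simp: smult)
  qed (rule cring_Rloc)
qed

text \<open>A decomposition of \<open>f x\<close> is the image of the one of \<open>x\<close>.  Any other decomposition lifts to some
\<open>x'\<close> with \<open>f x' = f x\<close>; the homogeneous components of \<open>x' - x\<close> are then in the kernel, so both
decompositions agree.\<close>

lemma gepi_graded_module:
  fixes M :: "('k::field, 'm::finite, 'a) gmodule"
  assumes M: "graded_module \<sigma> M" and f: "gepi \<sigma> M N f"
  shows "graded_module \<sigma> N"
proof -
  interpret M: gmod \<sigma> M by (rule gmod.intro[OF M])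
  have N: "Module.module (Rloc \<sigma>) N"
    by (rule gepi_module[OF M.module_axioms f])
  interpret N: Module.module "Rloc \<sigma>" N by (rule N)
  note fc = gepiD(1)[OF f] and f0 = gepiD(2)[OF f] and fadd = gepiD(3)[OF f]
    and fsm = gepiD(4)[OF f] and fg = gepiD(5)[OF f] and ker = gepiD(6)[OF f]
  have closed: "f \<in> carrier M \<rightarrow> carrier N" using fc by auto
  have fm: "f (\<ominus>\<^bsub>M\<^esub> x) = \<ominus>\<^bsub>N\<^esub> f x" if "x \<in> carrier M" for x
    using fadd[of "\<ominus>\<^bsub>M\<^esub> x" x] that closed f0
    by (intro N.minus_equality[symmetric]) (auto simp: M.M.l_neg)
  have fsum: "f (\<Oplus>\<^bsub>M\<^esub>d\<in>D. c d) = (\<Oplus>\<^bsub>N\<^esub>d\<in>D. f (c d))" if "\<And>d. c d \<in> carrier M" for c :: "int ^ 'm \<Rightarrow> 'a" and D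
    by (rule additive_finsum[OF M.abelian_group_axioms N.abelian_group_axioms closed fadd that])
  have "subgroup (grade N d) (add_monoid N)" for d
  proof (rule subgroup.intro)
    show "inv\<^bsub>add_monoid N\<^esub> y \<in> grade N d" if y: "y \<in> grade N d" for y
    proof -
      obtain x where x: "x \<in> grade M d" "y = f x" using y[unfolded fg] by blast
      then have "inv\<^bsub>add_monoid N\<^esub> y = f (\<ominus>\<^bsub>M\<^esub> x)"
        using fm M.grade_closed by (simp add: a_inv_def)
      then show ?thesis using x fg M.grade_uminus by auto
    qed
    show "grade N d \<subseteq> carrier (add_monoid N)"
      unfolding fg using fc M.grade_closed by auto
    show "\<one>\<^bsub>add_monoid N\<^esub> \<in> grade N d"
      unfolding fg using f0 by simp
    show "y \<otimes>\<^bsub>add_monoid N\<^esub> z \<in> grade N d" if yz: "y \<in> grade N d" "z \<in> grade N d" for y z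
    proof -
      obtain u v where "u \<in> grade M d" "y = f u" "v \<in> grade M d" "z = f v"
        using yz[unfolded fg] by blast
      then show ?thesis
        unfolding fg using fadd[of u v] M.grade_closed M.grade_add[of u d v]
        by (metis image_eqI monoid.simps(1) partial_object.select_convs(1))
    qed
  qed
  moreover have "\<exists>!c. (\<forall>d. c d \<in> grade N d) \<and> finite {d. c d \<noteq> \<zero>\<^bsub>N\<^esub>} \<and>
        y = (\<Oplus>\<^bsub>N\<^esub>d\<in>{d. c d \<noteq> \<zero>\<^bsub>N\<^esub>}. c d)" if y: "y \<in> carrier N" for y
  proof -
    obtain x where x: "x \<in> carrier M" "y = f x" using y fc by auto
    let ?c = "\<lambda>d. f (gcomp M x d)" and ?D = "{d. gcomp M x d \<noteq> \<zero>\<^bsub>M\<^esub>}"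
    have fin: "finite ?D" by (rule M.finite_gcomp[OF x(1)])
    have sub: "{d. ?c d \<noteq> \<zero>\<^bsub>N\<^esub>} \<subseteq> ?D" using f0 by auto
    then have fin': "finite {d. ?c d \<noteq> \<zero>\<^bsub>N\<^esub>}" using fin finite_subset by blast
    have "y = (\<Oplus>\<^bsub>N\<^esub>d\<in>?D. ?c d)"
      using fsum[of "gcomp M x" ?D] M.finsum_gcomp[OF x(1) fin order_refl] M.gcomp_closed[OF x(1)] x(2) by simp
    also have "\<dots> = (\<Oplus>\<^bsub>N\<^esub>d\<in>{d. ?c d \<noteq> \<zero>\<^bsub>N\<^esub>}. ?c d)"
      using fin fin' sub M.gcomp_closed[OF x(1)] fc
      by (intro N.M.add.finprod_mono_neutral_cong) (auto simp: Pi_def)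
    finally have ex: "y = (\<Oplus>\<^bsub>N\<^esub>d\<in>{d. ?c d \<noteq> \<zero>\<^bsub>N\<^esub>}. ?c d)" .
    show ?thesis
    proof (rule ex1I[of _ ?c])
      show "(\<forall>d. ?c d \<in> grade N d) \<and> finite {d. ?c d \<noteq> \<zero>\<^bsub>N\<^esub>} \<and>
          y = (\<Oplus>\<^bsub>N\<^esub>d\<in>{d. ?c d \<noteq> \<zero>\<^bsub>N\<^esub>}. ?c d)"
        using ex fin' fg M.gcomp_grade[OF x(1)] by auto
    next
      fix c
      assume c: "(\<forall>d. c d \<in> grade N d) \<and> finite {d. c d \<noteq> \<zero>\<^bsub>N\<^esub>} \<and>
          y = (\<Oplus>\<^bsub>N\<^esub>d\<in>{d. c d \<noteq> \<zero>\<^bsub>N\<^esub>}. c d)"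
      let ?E = "{d. c d \<noteq> \<zero>\<^bsub>N\<^esub>}"
      have "\<forall>d. \<exists>b. b \<in> grade M d \<and> f b = c d \<and> (c d = \<zero>\<^bsub>N\<^esub> \<longrightarrow> b = \<zero>\<^bsub>M\<^esub>)"
      proof
        fix d
        obtain b where "b \<in> grade M d" "c d = f b" using c fg by fastforce
        then show "\<exists>b. b \<in> grade M d \<and> f b = c d \<and> (c d = \<zero>\<^bsub>N\<^esub> \<longrightarrow> b = \<zero>\<^bsub>M\<^esub>)"
          using f0 by (cases "c d = \<zero>\<^bsub>N\<^esub>") auto
      qed
      then obtain b where b: "\<And>d. b d \<in> grade M d" "\<And>d. f (b d) = c d"
        "\<And>d. c d = \<zero>\<^bsub>N\<^esub> \<Longrightarrow> b d = \<zero>\<^bsub>M\<^esub>" by metis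
      have bc: "b d \<in> carrier M" for d using b(1) M.grade_closed by blast
      define x' where "x' = (\<Oplus>\<^bsub>M\<^esub>d\<in>?E. b d)"
      have x': "x' \<in> carrier M" unfolding x'_def using bc by (intro M.M.finsum_closed) auto
      have gx': "gcomp M x' = b"
        by (rule M.gcomp_eqI[of ?E]) (use c b x'_def in auto)
      have "f x' = y" using fsum[of b ?E] bc b(2) c by (simp add: x'_def)
      then have "f (x' \<ominus>\<^bsub>M\<^esub> x) = \<zero>\<^bsub>N\<^esub>"
        using x x' fm fc by (simp add: a_minus_def fadd N.M.r_neg)
      then have z: "f (gcomp M (x' \<ominus>\<^bsub>M\<^esub> x) d) = \<zero>\<^bsub>N\<^esub>" for d using ker x x' by simp
      have "x' = (x' \<ominus>\<^bsub>M\<^esub> x) \<oplus>\<^bsub>M\<^esub> x"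
        using x x' by (simp add: a_minus_def M.M.add.m_assoc M.M.l_neg)
      then have "gcomp M x' d = gcomp M (x' \<ominus>\<^bsub>M\<^esub> x) d \<oplus>\<^bsub>M\<^esub> gcomp M x d" for d
        using x x' by (metis M.gcomp_add M.M.minus_closed)
      then have "c d = ?c d" for d
        using b(2)[of d] gx' z[of d] x x' closed
        by (simp add: fadd M.gcomp_closed Pi_def)
      then show "c = ?c" by auto
    qed
  qed
  moreover have "p \<odot>\<^bsub>N\<^esub> y \<in> grade N (e + d)"
    if p: "p \<in> Rgrade \<sigma> e" and y: "y \<in> grade N d" for p y e d
  proof -
    obtain x where x: "x \<in> grade M d" "y = f x" using y[unfolded fg] by blast
    have "p \<odot>\<^bsub>M\<^esub> x \<in> grade M (e + d)" using M x p unfolding graded_module_def by blast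
    moreover have "p \<in> carrier (Rloc \<sigma>)" using p by (simp add: Rgrade_def)
    ultimately show ?thesis
      unfolding fg using x M.grade_closed fsm[of p x] by (metis imageI)
  qed
  moreover have "grade N d = {\<zero>\<^bsub>N\<^esub>}" if "d \<notin> cone \<sigma>" for d
  proof -
    have "grade M d = {\<zero>\<^bsub>M\<^esub>}" using M that unfolding graded_module_def by blast
    then show ?thesis using fg f0 by simp
  qed
  ultimately show ?thesis using N unfolding graded_module_def by blast
qed

lemma gepi_fin_gen:
  assumes M: "Module.module (Rloc \<sigma>) M" and f: "gepi \<sigma> M N f" and fg: "fin_gen \<sigma> M"
  shows "fin_gen \<sigma> N"
proof -
  interpret M: Module.module "Rloc \<sigma>" M by fact
  interpret N: Module.module "Rloc \<sigma>" N by (rule gepi_module[OF M f])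
  note fc = gepiD(1)[OF f] and f0 = gepiD(2)[OF f] and fadd = gepiD(3)[OF f]
    and fsm = gepiD(4)[OF f]
  have closed: "f \<in> carrier M \<rightarrow> carrier N" using fc by auto
  obtain A where A: "finite A" "A \<subseteq> carrier M"
    and gen: "\<And>x. x \<in> carrier M \<Longrightarrow> \<exists>c\<in>A \<rightarrow> carrier (Rloc \<sigma>). x = (\<Oplus>\<^bsub>M\<^esub>a\<in>A. c a \<odot>\<^bsub>M\<^esub> a)"
    using fg unfolding fin_gen_def by blast
  let ?B = "f ` A"
  have B: "finite ?B" "?B \<subseteq> carrier N" using A closed by auto
  \<comment> \<open>\<open>f\<close> may identify generators, so the coefficients over \<open>?B\<close> are collected one at a time.\<close>
  have "\<exists>c\<in>?B \<rightarrow> carrier (Rloc \<sigma>). f (\<Oplus>\<^bsub>M\<^esub>a\<in>S. r a \<odot>\<^bsub>M\<^esub> a) = (\<Oplus>\<^bsub>N\<^esub>b\<in>?B. c b \<odot>\<^bsub>N\<^esub> b)"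
    if "S \<subseteq> A" and r: "r \<in> A \<rightarrow> carrier (Rloc \<sigma>)" for S r
    using finite_subset[OF that(1) A(1)] that(1)
  proof (induction S rule: finite_induct)
    case empty
    have "(\<Oplus>\<^bsub>N\<^esub>b\<in>?B. 0 \<odot>\<^bsub>N\<^esub> b) = \<zero>\<^bsub>N\<^esub>"
      using B N.smult_l_null by (intro N.M.add.finprod_one_eqI) auto
    then show ?case using M.R.zero_closed f0
      by (intro bexI[of _ "\<lambda>_. 0"]) auto
  next
    case (insert a S)
    then obtain c where c: "c \<in> ?B \<rightarrow> carrier (Rloc \<sigma>)"
      "f (\<Oplus>\<^bsub>M\<^esub>a\<in>S. r a \<odot>\<^bsub>M\<^esub> a) = (\<Oplus>\<^bsub>N\<^esub>b\<in>?B. c b \<odot>\<^bsub>N\<^esub> b)" by auto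
    have a: "a \<in> A" "a \<in> carrier M" "r a \<in> carrier (Rloc \<sigma>)" using insert A r by auto
    have rS: "(\<lambda>a. r a \<odot>\<^bsub>M\<^esub> a) \<in> S \<rightarrow> carrier M" using r insert A by (auto simp: Pi_def subset_iff)
    let ?c = "c(f a := r a + c (f a))" and ?B' = "?B - {f a}"
    have c': "?c \<in> ?B \<rightarrow> carrier (Rloc \<sigma>)" using c(1) a M.R.add.m_closed[of "r a" "c (f a)"]
      by (auto simp: Pi_def)
    have cB: "(\<lambda>b. c b \<odot>\<^bsub>N\<^esub> b) \<in> ?B' \<rightarrow> carrier N" using c(1) B by (auto simp: Pi_def)
    have ca: "c (f a) \<in> carrier (Rloc \<sigma>)" using c(1) a by auto
    have fa: "f a \<in> carrier N" using closed a by auto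
    have BB: "?B = insert (f a) ?B'" using a by auto
    have split: "(\<Oplus>\<^bsub>N\<^esub>b\<in>?B. c b \<odot>\<^bsub>N\<^esub> b) = c (f a) \<odot>\<^bsub>N\<^esub> f a \<oplus>\<^bsub>N\<^esub> (\<Oplus>\<^bsub>N\<^esub>b\<in>?B'. c b \<odot>\<^bsub>N\<^esub> b)"
      by (subst BB, subst N.M.finsum_insert) (use B cB ca fa in auto)
    have "(\<Oplus>\<^bsub>N\<^esub>b\<in>?B. ?c b \<odot>\<^bsub>N\<^esub> b) = ?c (f a) \<odot>\<^bsub>N\<^esub> f a \<oplus>\<^bsub>N\<^esub> (\<Oplus>\<^bsub>N\<^esub>b\<in>?B'. ?c b \<odot>\<^bsub>N\<^esub> b)"
      using c' B fa a cB by (subst BB, subst N.M.finsum_insert) (auto simp: Pi_def)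
    also have "(\<Oplus>\<^bsub>N\<^esub>b\<in>?B'. ?c b \<odot>\<^bsub>N\<^esub> b) = (\<Oplus>\<^bsub>N\<^esub>b\<in>?B'. c b \<odot>\<^bsub>N\<^esub> b)"
      using cB by (intro N.M.finsum_cong') (auto simp: Pi_def)
    also have "?c (f a) \<odot>\<^bsub>N\<^esub> f a = r a \<odot>\<^bsub>N\<^esub> f a \<oplus>\<^bsub>N\<^esub> c (f a) \<odot>\<^bsub>N\<^esub> f a"
      using N.smult_l_distr[of "r a" "c (f a)" "f a"] a ca fa by simp
    finally have "(\<Oplus>\<^bsub>N\<^esub>b\<in>?B. ?c b \<odot>\<^bsub>N\<^esub> b) = r a \<odot>\<^bsub>N\<^esub> f a \<oplus>\<^bsub>N\<^esub> (\<Oplus>\<^bsub>N\<^esub>b\<in>?B. c b \<odot>\<^bsub>N\<^esub> b)"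
      unfolding split using a ca fa cB by (simp add: N.M.add.m_assoc)
    moreover have "f (\<Oplus>\<^bsub>M\<^esub>a\<in>insert a S. r a \<odot>\<^bsub>M\<^esub> a) = r a \<odot>\<^bsub>N\<^esub> f a \<oplus>\<^bsub>N\<^esub> (\<Oplus>\<^bsub>N\<^esub>b\<in>?B. c b \<odot>\<^bsub>N\<^esub> b)"
      using insert.hyps rS a by (simp add: fadd fsm c(2))
    ultimately show ?case using c' by (intro bexI[of _ ?c]) auto
  qed
  then have *: "\<exists>c\<in>?B \<rightarrow> carrier (Rloc \<sigma>). f (\<Oplus>\<^bsub>M\<^esub>a\<in>A. r a \<odot>\<^bsub>M\<^esub> a) = (\<Oplus>\<^bsub>N\<^esub>b\<in>?B. c b \<odot>\<^bsub>N\<^esub> b)"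
    if "r \<in> A \<rightarrow> carrier (Rloc \<sigma>)" for r using that by blast
  have "\<forall>y\<in>carrier N. \<exists>c\<in>?B \<rightarrow> carrier (Rloc \<sigma>). y = (\<Oplus>\<^bsub>N\<^esub>b\<in>?B. c b \<odot>\<^bsub>N\<^esub> b)"
  proof
    fix y assume "y \<in> carrier N"
    then obtain x where x: "x \<in> carrier M" "y = f x" using fc by auto
    obtain r where "r \<in> A \<rightarrow> carrier (Rloc \<sigma>)" "x = (\<Oplus>\<^bsub>M\<^esub>a\<in>A. r a \<odot>\<^bsub>M\<^esub> a)" using gen[OF x(1)] by blast
    then show "\<exists>c\<in>?B \<rightarrow> carrier (Rloc \<sigma>). y = (\<Oplus>\<^bsub>N\<^esub>b\<in>?B. c b \<odot>\<^bsub>N\<^esub> b)" using *[of r] x(2) by simp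
  qed
  then show ?thesis using B unfolding fin_gen_def by blast
qed

section \<open>Monomials and torsion\<close>

abbreviation mon :: "int ^ 'm \<Rightarrow> 'k \<Rightarrow> ('k::field, 'm::finite) laurent" where
  "mon e a \<equiv> Poly_Mapping.single e a"

lemma axis_in_cone [simp]: "axis i (int n) \<in> cone \<sigma>"
  by (simp add: cone_def axis_def)

lemma axis_one_in_cone [simp]: "axis i 1 \<in> cone \<sigma>"
  by (simp add: cone_def axis_def)

lemma cone_add: "d \<in> cone \<sigma> \<Longrightarrow> e \<in> cone \<sigma> \<Longrightarrow> d + e \<in> cone \<sigma>"
  by (simp add: cone_def)

lemma axis_add: "axis i a + axis i b = axis i (a + b :: int)"
  by (simp add: vec_eq_iff axis_def)

lemma axis_zero: "axis i 0 = (0 :: int ^ 'm::finite)"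
  by (simp add: vec_eq_iff axis_def)

lemma tvar_power: "tvar i ^ n = mon (axis i (int n)) 1"
proof (induction n)
  case 0
  show ?case by (simp add: axis_zero)
next
  case (Suc n)
  then show ?case by (simp add: tvar_def mult_single axis_add)
qed

lemma Rloc_induct [consumes 1, case_names zero mon add]:
  fixes p :: "('k::field, 'm::finite) laurent"
  assumes "p \<in> carrier (Rloc \<sigma>)" and zero: "P 0" and mon: "\<And>e a. e \<in> cone \<sigma> \<Longrightarrow> P (mon e a)"
    and add: "\<And>p q. p \<in> carrier (Rloc \<sigma>) \<Longrightarrow> q \<in> carrier (Rloc \<sigma>) \<Longrightarrow> P p \<Longrightarrow> P q \<Longrightarrow> P (p + q)"
  shows "P p"
proof -
  have "finite E \<Longrightarrow> E \<subseteq> cone \<sigma> \<Longrightarrow> Poly_Mapping.keys q = E \<Longrightarrow> P q" for q E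
  proof (induction E arbitrary: q rule: finite_induct)
    case empty
    then show ?case using zero by simp
  next
    case (insert e E)
    define r where "r = q - mon e (Poly_Mapping.lookup q e)"
    have r: "Poly_Mapping.keys r = E"
      using insert.hyps insert.prems(2)
      by (auto simp: r_def in_keys_iff lookup_minus lookup_single when_def set_eq_iff)
    then have "P (mon e (Poly_Mapping.lookup q e) + r)"
      using insert by (intro add mon) (auto simp: carrier_Rloc)
    then show ?case by (simp add: r_def)
  qed
  then show ?thesis using assms(1) by (metis carrier_Rloc finite_keys)
qed

context abelian_group
begin

lemma add_diff_add:
  assumes "a \<in> carrier G" "b \<in> carrier G" "c \<in> carrier G" "d \<in> carrier G"
  shows "(a \<oplus> b) \<ominus> (c \<oplus> d) = (a \<ominus> c) \<oplus> (b \<ominus> d)"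
  using assms by (simp add: a_minus_def minus_add a_ac)

lemma diff_eq_zero_iff:
  assumes "a \<in> carrier G" "b \<in> carrier G"
  shows "a \<ominus> b = \<zero> \<longleftrightarrow> a = b"
  using assms by (metis a_minus_def add.inv_closed minus_equality minus_minus r_neg)

lemma diff_zero: "a \<in> carrier G \<Longrightarrow> a \<ominus> \<zero> = a"
  by (simp add: a_minus_def)

lemma diff_add_right:
  assumes "a \<in> carrier G" "b \<in> carrier G" "c \<in> carrier G"
  shows "a \<ominus> (b \<oplus> c) = (a \<ominus> c) \<ominus> b"
  using assms by (simp add: a_minus_def minus_add a_ac)

lemma add_diff_diff:
  assumes "a \<in> carrier G" "b \<in> carrier G"
  shows "(a \<oplus> b) \<ominus> a \<ominus> b = \<zero>"
proof -
  have "(a \<oplus> b) \<ominus> a \<ominus> b = (a \<oplus> b) \<ominus> (b \<oplus> a)"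
    using assms by (simp only: diff_add_right a_closed)
  then show ?thesis using assms by (simp add: diff_eq_zero_iff a_comm)
qed

lemma diff_diff_diff:
  assumes "a \<in> carrier G" "b \<in> carrier G" "c \<in> carrier G"
  shows "(a \<ominus> b) \<ominus> (a \<ominus> c) = c \<ominus> b"
proof -
  have "(a \<ominus> b) \<ominus> (a \<ominus> c) = (a \<oplus> \<ominus> a) \<oplus> (c \<ominus> b)"
    using assms by (simp add: a_minus_def minus_add a_ac del: r_neg l_neg)
  then show ?thesis using assms by (simp add: r_neg)
qed

end

context gmod
begin

lemma one_smult [simp]: "x \<in> carrier M \<Longrightarrow> 1 \<odot> x = x"
  using smult_one[of x] by simp

lemma smult_diff:
  "p \<in> carrier (Rloc \<sigma>) \<Longrightarrow> x \<in> carrier M \<Longrightarrow> y \<in> carrier M \<Longrightarrow> p \<odot> (x \<ominus> y) = p \<odot> x \<ominus> p \<odot> y"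
  by (simp add: a_minus_def smult_r_distr smult_r_minus)

lemma mon_mon:
  "e \<in> cone \<sigma> \<Longrightarrow> f \<in> cone \<sigma> \<Longrightarrow> x \<in> carrier M \<Longrightarrow> mon e a \<odot> (mon f b \<odot> x) = mon (e + f) (a * b) \<odot> x"
  using smult_assoc1[of "mon e a" "mon f b" x] by (simp add: mult_single)

lemma mon_add:
  "e \<in> cone \<sigma> \<Longrightarrow> x \<in> carrier M \<Longrightarrow> mon e a \<odot> x \<oplus> mon e b \<odot> x = mon e (a + b) \<odot> x"
  using smult_l_distr[of "mon e a" "mon e b" x] by (simp add: single_add)

lemma mon_one: "x \<in> carrier M \<Longrightarrow> mon 0 1 \<odot> x = x"
  using smult_one[of x] by simp

lemma mon_zero: "x \<in> carrier M \<Longrightarrow> mon e 0 \<odot> x = \<zero>"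
  using smult_l_null[of x] by simp

lemma tors_iff: "x \<in> tors i M \<longleftrightarrow> x \<in> carrier M \<and> (\<exists>n. mon (axis i (int n)) 1 \<odot> x = \<zero>)"
  by (simp add: tors_def tvar_power)

lemma tors_mono:
  assumes "x \<in> carrier M" "mon (axis i (int n)) 1 \<odot> x = \<zero>" "n \<le> k"
  shows "mon (axis i (int k)) 1 \<odot> x = \<zero>"
proof -
  have "mon (axis i (int k)) 1 \<odot> x = mon (axis i (int (k - n))) 1 \<odot> (mon (axis i (int n)) 1 \<odot> x)"
    using assms(1,3) by (subst mon_mon[OF axis_in_cone axis_in_cone]) (simp_all add: axis_add)
  then show ?thesis using assms by (simp del: of_nat_diff)
qed

lemma tors_carrier: "x \<in> tors i M \<Longrightarrow> x \<in> carrier M"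
  by (simp add: tors_iff)

lemma tors_zero: "\<zero> \<in> tors i M"
  by (simp add: tors_iff)

lemma tors_add:
  assumes "x \<in> tors i M" "y \<in> tors i M"
  shows "x \<oplus> y \<in> tors i M"
proof -
  obtain n k where "mon (axis i (int n)) 1 \<odot> x = \<zero>" "mon (axis i (int k)) 1 \<odot> y = \<zero>"
    using assms by (auto simp: tors_iff)
  moreover have c: "x \<in> carrier M" "y \<in> carrier M" using assms tors_carrier by auto
  ultimately have "mon (axis i (int (n + k))) 1 \<odot> x = \<zero>" "mon (axis i (int (n + k))) 1 \<odot> y = \<zero>"
    by (auto intro: tors_mono[OF _ _ le_add1] tors_mono[OF _ _ le_add2] simp del: of_nat_add)
  then have "mon (axis i (int (n + k))) 1 \<odot> (x \<oplus> y) = \<zero>"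
    using c by (simp add: smult_r_distr del: of_nat_add)
  then show ?thesis using c unfolding tors_iff by blast
qed

lemma tors_smult:
  assumes p: "p \<in> carrier (Rloc \<sigma>)" and "x \<in> tors i M"
  shows "p \<odot> x \<in> tors i M"
proof -
  obtain n where n: "mon (axis i (int n)) 1 \<odot> x = \<zero>" and x: "x \<in> carrier M"
    using assms by (auto simp: tors_iff)
  have "mon (axis i (int n)) 1 \<odot> (p \<odot> x) = p \<odot> (mon (axis i (int n)) 1 \<odot> x)"
    using p x smult_assoc1[of "mon (axis i (int n)) 1" p x] smult_assoc1[of p "mon (axis i (int n)) 1" x]
    by (simp add: mult.commute)
  then show ?thesis using n p x by (auto simp: tors_iff)
qed

lemma tors_uminus: "x \<in> tors i M \<Longrightarrow> \<ominus> x \<in> tors i M"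
  using smult_l_minus[of "\<one>\<^bsub>Rloc \<sigma>\<^esub>" x] tors_smult[of "\<ominus>\<^bsub>Rloc \<sigma>\<^esub> \<one>\<^bsub>Rloc \<sigma>\<^esub>" x i] tors_carrier[of x i]
    smult_one[of x] R.one_closed by (simp del: Rloc_simps)

lemma tors_diff: "x \<in> tors i M \<Longrightarrow> y \<in> tors i M \<Longrightarrow> x \<ominus> y \<in> tors i M"
  by (simp add: a_minus_def tors_add tors_uminus)

lemma tors_saturated:
  assumes x: "x \<in> carrier M" and "mon (axis i (int n)) 1 \<odot> x \<in> tors i M"
  shows "x \<in> tors i M"
proof -
  obtain k where "mon (axis i (int k)) 1 \<odot> (mon (axis i (int n)) 1 \<odot> x) = \<zero>"
    using assms by (auto simp: tors_iff)
  then have "mon (axis i (int (k + n))) 1 \<odot> x = \<zero>" using x by (simp add: mon_mon axis_add)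
  then show ?thesis using x unfolding tors_iff by blast
qed

lemma tors_gcomp:
  assumes "x \<in> tors i M"
  shows "gcomp M x d \<in> tors i M"
proof -
  obtain n where n: "mon (axis i (int n)) 1 \<odot> x = \<zero>" and x: "x \<in> carrier M"
    using assms by (auto simp: tors_iff)
  have "mon (axis i (int n)) 1 \<odot> gcomp M x d = \<zero>"
    using gcomp_monomial[of "axis i (int n)" x 1 d] n x by (simp add: gcomp_zero)
  then show ?thesis using x gcomp_closed by (auto simp: tors_iff)
qed

end

section \<open>A graded complement of the torsion submodule\<close>

text \<open>Every monomial of \<open>R\<^sub>\<sigma>\<close> for \<open>\<sigma> = [m] - {i}\<close> is a unit times a power of \<open>t\<^sub>i\<close>.\<close>

lemma vec_split_axis:
  fixes e :: "int ^ 'm::finite"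
  assumes "e \<in> cone (- {i})"
  obtains e' n where "e = e' + axis i (int n)" "e' \<in> cone (- {i})" "- e' \<in> cone (- {i})"
proof
  let ?e = "\<chi> j. if j = i then 0 else e $ j"
  have "e $ i \<ge> 0" using assms by (simp add: cone_def)
  then show "e = ?e + axis i (int (nat (e $ i)))"
    by (simp add: vec_eq_iff axis_def)
  show "?e \<in> cone (- {i})" "- ?e \<in> cone (- {i})" by (simp_all add: cone_def)
qed

text \<open>Graded submodules meeting the torsion submodule \<open>T\<close> trivially, given by their homogeneous elements.
The elements carry their degree because zero is homogeneous of every degree.  The last condition
says that \<open>C + T\<close> is closed under division by \<open>t\<^sub>i\<close>.  It is essential that the
family ordered by inclusion includes this condition: in \<open>R a \<oplus> R b\<close> with \<open>t\<^sub>i b = 0\<close> and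
\<open>b\<close> in the degree of \<open>t\<^sub>i a\<close>, the submodule generated by \<open>t\<^sub>i a + b\<close> meets \<open>T\<close> trivially, but no
complement of \<open>T\<close> contains it.\<close>

definition partial_complement ::
  "'m::finite \<Rightarrow> ('k::field, 'm, 'a) gmodule \<Rightarrow> ((int ^ 'm) \<times> 'a) set \<Rightarrow> bool" where
  "partial_complement i M C \<longleftrightarrow>
     (\<forall>d x. (d, x) \<in> C \<longrightarrow> x \<in> grade M d) \<and>
     (\<forall>d. (d, \<zero>\<^bsub>M\<^esub>) \<in> C) \<and>
     (\<forall>d x y. (d, x) \<in> C \<longrightarrow> (d, y) \<in> C \<longrightarrow> (d, x \<oplus>\<^bsub>M\<^esub> y) \<in> C) \<and>
     (\<forall>e a d x. e \<in> cone (- {i}) \<longrightarrow> (d, x) \<in> C \<longrightarrow> (e + d, mon e a \<odot>\<^bsub>M\<^esub> x) \<in> C) \<and>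
     (\<forall>d x. (d, x) \<in> C \<longrightarrow> x \<in> tors i M \<longrightarrow> x = \<zero>\<^bsub>M\<^esub>) \<and>
     (\<forall>d x y. x \<in> grade M d \<longrightarrow> (axis i 1 + d, y) \<in> C \<longrightarrow> mon (axis i 1) 1 \<odot>\<^bsub>M\<^esub> x \<ominus>\<^bsub>M\<^esub> y \<in> tors i M \<longrightarrow>
        (\<exists>z. (d, z) \<in> C \<and> x \<ominus>\<^bsub>M\<^esub> z \<in> tors i M))"

context gmod
begin

lemma partial_complementD:
  assumes "partial_complement i M C"
  shows "\<And>d x. (d, x) \<in> C \<Longrightarrow> x \<in> grade M d" "\<And>d. (d, \<zero>) \<in> C"
    "\<And>d x y. (d, x) \<in> C \<Longrightarrow> (d, y) \<in> C \<Longrightarrow> (d, x \<oplus> y) \<in> C"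
    "\<And>e a d x. e \<in> cone (- {i}) \<Longrightarrow> (d, x) \<in> C \<Longrightarrow> (e + d, mon e a \<odot> x) \<in> C"
    "\<And>d x. (d, x) \<in> C \<Longrightarrow> x \<in> tors i M \<Longrightarrow> x = \<zero>"
    "\<And>d x y. x \<in> grade M d \<Longrightarrow> (axis i 1 + d, y) \<in> C \<Longrightarrow> mon (axis i 1) 1 \<odot> x \<ominus> y \<in> tors i M \<Longrightarrow>
        \<exists>z. (d, z) \<in> C \<and> x \<ominus> z \<in> tors i M"
  using assms unfolding partial_complement_def by metis+

lemma partial_complement_Union:
  assumes "\<C> \<noteq> {}" "subset.chain {C. partial_complement i M C} \<C>"
  shows "partial_complement i M (\<Union>\<C>)"
proof -
  have C: "partial_complement i M C" if "C \<in> \<C>" for C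
    using assms that by (auto simp: subset.chain_def)
  have tot: "C \<subseteq> D \<or> D \<subseteq> C" if "C \<in> \<C>" "D \<in> \<C>" for C D
    using assms that by (auto simp: subset.chain_def)
  show ?thesis
    unfolding partial_complement_def
  proof (intro conjI allI impI)
    show "x \<in> grade M d" if "(d, x) \<in> \<Union>\<C>" for d x
      using that partial_complementD(1)[OF C] by blast
    show "(d, \<zero>) \<in> \<Union>\<C>" for d
      using assms(1) partial_complementD(2)[OF C] by blast
    show "(d, x \<oplus> y) \<in> \<Union>\<C>" if xy: "(d, x) \<in> \<Union>\<C>" "(d, y) \<in> \<Union>\<C>" for d x y
    proof -
      obtain C D where CD: "C \<in> \<C>" "(d, x) \<in> C" "D \<in> \<C>" "(d, y) \<in> D" using xy by blast
      with tot[of C D] have "\<exists>E\<in>\<C>. (d, x) \<in> E \<and> (d, y) \<in> E" by blast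
      then show ?thesis using partial_complementD(3)[OF C] by blast
    qed
    show "(e + d, mon e a \<odot> x) \<in> \<Union>\<C>" if "e \<in> cone (- {i})" "(d, x) \<in> \<Union>\<C>" for e a d x
      using that partial_complementD(4)[OF C] by blast
    show "x = \<zero>" if "(d, x) \<in> \<Union>\<C>" "x \<in> tors i M" for d x
      using that partial_complementD(5)[OF C] by blast
    show "\<exists>z. (d, z) \<in> \<Union>\<C> \<and> x \<ominus> z \<in> tors i M"
      if x: "x \<in> grade M d" "(axis i 1 + d, y) \<in> \<Union>\<C>" "mon (axis i 1) 1 \<odot> x \<ominus> y \<in> tors i M" for d x y
    proof -
      obtain D where D: "D \<in> \<C>" "(axis i 1 + d, y) \<in> D" using x(2) by blast
      show ?thesis using partial_complementD(6)[OF C[OF D(1)] x(1) D(2) x(3)] D(1) by blast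
    qed
  qed
qed

end

locale torsion_gmod = gmod "- {i}" M for i :: "'m::finite" and M :: "('k::field, 'm, 'a) gmodule" (structure)
begin

lemma partial_complement_zero: "partial_complement i M (UNIV \<times> {\<zero>})"
proof -
  have *: "x \<in> tors i M" if x: "x \<in> grade M d" "mon (axis i 1) 1 \<odot> x \<in> tors i M" for x d
    using tors_saturated[of x i 1] x grade_closed by simp
  show ?thesis unfolding partial_complement_def
    by (auto simp: diff_zero grade_closed single_in_Rloc dest: *)
qed

text \<open>Closure under division by \<open>t\<^sub>i\<close> gives closure under division by every nonzero homogeneous scalar,
since the remaining variables are invertible.\<close>

lemma partial_complement_saturated:
  assumes C: "partial_complement i M C" and x: "x \<in> grade M d" and e: "e \<in> cone (- {i})" and a: "a \<noteq> 0"
    and y: "(e + d, y) \<in> C" "mon e a \<odot> x \<ominus> y \<in> tors i M"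
  shows "\<exists>z. (d, z) \<in> C \<and> x \<ominus> z \<in> tors i M"
proof -
  note CD = partial_complementD[OF C]
  have iter: "\<exists>z. (d, z) \<in> C \<and> x \<ominus> z \<in> tors i M"
    if "(axis i (int n) + d, y) \<in> C" "mon (axis i (int n)) 1 \<odot> x \<ominus> y \<in> tors i M" for n y
    using that
  proof (induction n arbitrary: y)
    case 0
    then show ?case using grade_closed[OF x] mon_one by (auto simp: axis_zero)
  next
    case (Suc n)
    have xc: "x \<in> carrier M" by (rule grade_closed[OF x])
    have ax: "axis i 1 + axis i (int n) = axis i (int (Suc n))" by (simp add: axis_add)
    let ?x = "mon (axis i (int n)) 1 \<odot> x"
    have "mon (axis i 1) 1 \<odot> ?x = mon (axis i (int (Suc n))) 1 \<odot> x"
      using mon_mon[of "axis i 1" "axis i (int n)" x 1 1] xc unfolding ax by simp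
    moreover have "axis i 1 + (axis i (int n) + d) = axis i (int (Suc n)) + d"
      by (simp only: ax add.assoc[symmetric])
    ultimately obtain z where "(axis i (int n) + d, z) \<in> C" "?x \<ominus> z \<in> tors i M"
      using CD(6)[of ?x "axis i (int n) + d" y] grade_smult[OF axis_in_cone x] Suc.prems by metis
    then show ?case by (rule Suc.IH)
  qed
  obtain e' n where e': "e = e' + axis i (int n)" "e' \<in> cone (- {i})" "- e' \<in> cone (- {i})"
    using vec_split_axis[OF e] .
  let ?y = "mon (- e') (inverse a) \<odot> y"
  have xc: "x \<in> carrier M" by (rule grade_closed[OF x])
  have yc: "y \<in> carrier M" using CD(1)[OF y(1)] grade_closed by blast
  have "- e' + (e + d) = axis i (int n) + d" using e'(1) by simp
  then have "(axis i (int n) + d, ?y) \<in> C" using CD(4)[OF e'(3) y(1), of "inverse a"] by metis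
  moreover have "mon (- e') (inverse a) \<odot> (mon e a \<odot> x \<ominus> y) \<in> tors i M"
    using e' y by (intro tors_smult) auto
  moreover have "mon (- e') (inverse a) \<odot> (mon e a \<odot> x \<ominus> y) = mon (axis i (int n)) 1 \<odot> x \<ominus> ?y"
    using e' e xc yc a mon_mon[OF e'(3) e xc, of "inverse a" a] by (simp add: smult_diff)
  ultimately show ?thesis using iter by simp
qed

text \<open>An element \<open>x\<close> outside \<open>C + T\<close> whose \<open>i\<close>-th degree is as small as possible can be adjoined to \<open>C\<close>.
The new submodule still meets \<open>T\<close> trivially because \<open>C + T\<close> is closed under division.  It stays
closed under division itself: if \<open>t\<^sub>i x'\<close> lies in \<open>C + R x + T\<close>, then either \<open>t\<^sub>i\<close> divides the coefficient of
\<open>x\<close> and the claim reduces to \<open>C\<close>, or \<open>x'\<close> has smaller \<open>i\<close>-th degree than \<open>x\<close> and lies in \<open>C + T\<close>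
by minimality.\<close>

lemma partial_complement_extend:
  assumes C: "partial_complement i M C" and x: "x \<in> grade M d"
    and bad: "\<And>z. (d, z) \<in> C \<Longrightarrow> x \<ominus> z \<notin> tors i M"
    and min: "\<And>d' x'. x' \<in> grade M d' \<Longrightarrow> d' $ i < d $ i \<Longrightarrow> \<exists>z. (d', z) \<in> C \<and> x' \<ominus> z \<in> tors i M"
  shows "\<exists>C'. partial_complement i M C' \<and> C \<subseteq> C' \<and> (d, x) \<in> C'"
proof -
  note CD = partial_complementD[OF C]
  let ?S = "cone (- {i})"
  define C' where "C' = {(f, y). if f - d \<in> ?S then \<exists>z a. (f, z) \<in> C \<and> y = z \<oplus> mon (f - d) a \<odot> x else (f, y) \<in> C}"
  have xc: "x \<in> carrier M" by (rule grade_closed[OF x])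
  have Cc: "z \<in> carrier M" if "(f, z) \<in> C" for f z using CD(1)[OF that] grade_closed by blast
  have mc [simp]: "mon e a \<odot> x \<in> carrier M" if "e \<in> ?S" for e a using that xc by simp
  have sub: "(f, y) \<in> C'" if "(f, y) \<in> C" for f y
  proof -
    have "y = y \<oplus> mon (f - d) 0 \<odot> x" using mon_zero[OF xc] Cc[OF that] by simp
    then have "\<exists>z a. (f, z) \<in> C \<and> y = z \<oplus> mon (f - d) a \<odot> x" using that by blast
    then show ?thesis using that unfolding C'_def by simp
  qed
  have in1: "(f, z \<oplus> mon (f - d) a \<odot> x) \<in> C'" if "(f, z) \<in> C" "f - d \<in> ?S" for f z a
    using that unfolding C'_def by auto
  have elim: "(\<exists>z a. f - d \<in> ?S \<and> (f, z) \<in> C \<and> y = z \<oplus> mon (f - d) a \<odot> x) \<or> (f - d \<notin> ?S \<and> (f, y) \<in> C)"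
    if "(f, y) \<in> C'" for f y using that unfolding C'_def by (auto split: if_splits)
  have "partial_complement i M C'"
    unfolding partial_complement_def
  proof (intro conjI allI impI)
    fix f y assume "(f, y) \<in> C'"
    from elim[OF this] show "y \<in> grade M f"
    proof (elim disjE exE conjE)
      fix z a assume *: "f - d \<in> ?S" "(f, z) \<in> C" "y = z \<oplus> mon (f - d) a \<odot> x"
      then show ?thesis using grade_smult[OF *(1) x, of a] CD(1)[OF *(2)] by (simp add: grade_add)
    qed (rule CD(1))
  next
    show "(f, \<zero>) \<in> C'" for f using sub CD(2) by blast
  next
    fix f y y' assume y: "(f, y) \<in> C'" and y': "(f, y') \<in> C'"
    show "(f, y \<oplus> y') \<in> C'"
    proof (cases "f - d \<in> ?S")
      case True
      obtain z a where 1: "(f, z) \<in> C" "y = z \<oplus> mon (f - d) a \<odot> x" using elim[OF y] True by blast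
      obtain z' a' where 2: "(f, z') \<in> C" "y' = z' \<oplus> mon (f - d) a' \<odot> x" using elim[OF y'] True by blast
      have "y \<oplus> y' = (z \<oplus> z') \<oplus> (mon (f - d) a \<odot> x \<oplus> mon (f - d) a' \<odot> x)"
        using 1 2 Cc True by (simp add: M.add.m_ac)
      also have "\<dots> = (z \<oplus> z') \<oplus> mon (f - d) (a + a') \<odot> x"
        using True xc by (simp add: mon_add)
      finally show ?thesis using in1[OF CD(3)[OF 1(1) 2(1)] True] by simp
    next
      case False
      then show ?thesis using elim[OF y] elim[OF y'] CD(3) sub by blast
    qed
  next
    fix e a f y assume e: "e \<in> ?S" and y: "(f, y) \<in> C'"
    from elim[OF y] show "(e + f, mon e a \<odot> y) \<in> C'"
    proof (elim disjE exE conjE)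
      fix z b assume *: "f - d \<in> ?S" "(f, z) \<in> C" "y = z \<oplus> mon (f - d) b \<odot> x"
      have ef: "e + (f - d) = e + f - d" by simp
      have S: "e + f - d \<in> ?S" using cone_add[OF e *(1)] by (simp only: ef)
      have "mon e a \<odot> y = mon e a \<odot> z \<oplus> mon (e + f - d) (a * b) \<odot> x"
        using * e xc Cc[OF *(2)] mon_mon[OF e *(1) xc, of a b] by (simp add: smult_r_distr ef)
      then show ?thesis using in1[OF CD(4)[OF e *(2)] S] by simp
    next
      assume "(f, y) \<in> C" then show ?thesis using sub CD(4)[OF e] by blast
    qed
  next
    fix f y assume y: "(f, y) \<in> C'" and T: "y \<in> tors i M"
    from elim[OF y] show "y = \<zero>"
    proof (elim disjE exE conjE)
      fix z a assume *: "f - d \<in> ?S" "(f, z) \<in> C" "y = z \<oplus> mon (f - d) a \<odot> x"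
      have zc: "z \<in> carrier M" by (rule Cc[OF *(2)])
      show "y = \<zero>"
      proof (cases "a = 0")
        case True
        then have "y = z" using * mon_zero[OF xc] zc by simp
        then show ?thesis using CD(5)[OF *(2)] T by simp
      next
        case False
        \<comment> \<open>otherwise \<open>x\<close> would lie in \<open>C + T\<close> by saturation\<close>
        let ?w = "mon 0 (- 1) \<odot> z"
        have w: "(f, ?w) \<in> C" using CD(4)[OF zero_in_cone *(2), of "- 1"] by simp
        have "?w \<oplus> z = \<zero>" using mon_add[OF zero_in_cone zc, of "- 1" 1] mon_one[OF zc] mon_zero[OF zc] by simp
        then have wz: "\<ominus> ?w = z" using zc Cc[OF w] by (metis M.minus_equality M.add.m_comm M.minus_minus)
        have "mon (f - d) a \<odot> x \<ominus> ?w = y" using * zc by (simp add: a_minus_def wz M.add.m_comm)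
        then have "\<exists>z. (d, z) \<in> C \<and> x \<ominus> z \<in> tors i M"
          using partial_complement_saturated[OF C x *(1) False, of ?w] w T by simp
        then show ?thesis using bad by blast
      qed
    qed (rule CD(5)[OF _ T])
  next
    fix f x' y assume x': "x' \<in> grade M f" and y: "(axis i 1 + f, y) \<in> C'"
      and T: "mon (axis i 1) 1 \<odot> x' \<ominus> y \<in> tors i M"
    have xc': "x' \<in> carrier M" by (rule grade_closed[OF x'])
    from elim[OF y] show "\<exists>z. (f, z) \<in> C' \<and> x' \<ominus> z \<in> tors i M"
    proof (elim disjE exE conjE)
      fix z a assume *: "axis i 1 + f - d \<in> ?S" "(axis i 1 + f, z) \<in> C" "y = z \<oplus> mon (axis i 1 + f - d) a \<odot> x"
      have zc: "z \<in> carrier M" by (rule Cc[OF *(2)])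
      show ?thesis
      proof (cases "f - d \<in> ?S")
        case True
        let ?u = "mon (f - d) a \<odot> x"
        have u: "?u \<in> grade M f" using grade_smult[OF True x, of a] by simp
        have uc: "?u \<in> carrier M" using True by simp
        have "y = z \<oplus> mon (axis i 1) 1 \<odot> ?u"
          using *(3) mon_mon[OF axis_one_in_cone True xc, of i 1 a] by (simp add: add_diff_eq)
        then have "mon (axis i 1) 1 \<odot> x' \<ominus> y = mon (axis i 1) 1 \<odot> (x' \<ominus> ?u) \<ominus> z"
          using xc' uc zc by (simp add: smult_diff M.diff_add_right)
        then obtain v where v: "(f, v) \<in> C" "x' \<ominus> ?u \<ominus> v \<in> tors i M"
          using CD(6)[OF grade_minus[OF x' u] *(2)] T by auto
        have "x' \<ominus> (v \<oplus> ?u) = x' \<ominus> ?u \<ominus> v"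
          using xc' uc Cc[OF v(1)] by (simp add: M.diff_add_right)
        then show ?thesis using in1[OF v(1) True, of a] v(2) by metis
      next
        case False
        then have "f $ i < d $ i" by (simp add: cone_def)
        then show ?thesis using min[OF x'] sub by blast
      qed
    next
      assume "(axis i 1 + f, y) \<in> C"
      then show ?thesis using CD(6)[OF x' _ T] sub by blast
    qed
  qed
  moreover have "(d, x) \<in> C'" using in1[OF CD(2), of d 1] mon_one[OF xc] xc by simp
  ultimately show ?thesis using sub by auto
qed

text \<open>A maximal partial complement is a complement: an element of least \<open>i\<close>-th degree outside \<open>C + T\<close>
would exist, as nonzero elements have nonnegative \<open>i\<close>-th degree, and could be adjoined.\<close>

lemma ex_complement:
  "\<exists>C. partial_complement i M C \<and> (\<forall>d. \<forall>x\<in>grade M d. \<exists>z. (d, z) \<in> C \<and> x \<ominus> z \<in> tors i M)"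
proof -
  have "\<exists>C\<in>{C. partial_complement i M C}. \<forall>X\<in>{C. partial_complement i M C}. C \<subseteq> X \<longrightarrow> X = C"
    using partial_complement_zero partial_complement_Union by (intro subset_Zorn_nonempty) auto
  then obtain C where C: "partial_complement i M C"
    and max: "\<And>X. partial_complement i M X \<Longrightarrow> C \<subseteq> X \<Longrightarrow> X = C" by auto
  note CD = partial_complementD[OF C]
  define good where "good d x \<longleftrightarrow> (\<exists>z. (d, z) \<in> C \<and> x \<ominus> z \<in> tors i M)" for d x
  have "good d x" if "x \<in> grade M d" for d x
    using that
  proof (induction "nat (d $ i)" arbitrary: d x rule: less_induct)
    case less
    show ?case
    proof (rule ccontr)
      assume bad: "\<not> good d x"
      then have "d \<in> cone (- {i})"
        using less.prems grade_outside_cone CD(2) tors_zero unfolding good_def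
        by (metis M.zero_closed diff_zero)
      then have d: "d $ i \<ge> 0" by (simp add: cone_def)
      have "\<exists>z. (d', z) \<in> C \<and> x' \<ominus> z \<in> tors i M" if x': "x' \<in> grade M d'" and lt: "d' $ i < d $ i" for d' x'
      proof -
        have "nat (d' $ i) < nat (d $ i)" if "d' $ i \<ge> 0" using that lt by simp
        moreover have "x' = \<zero>" if "\<not> d' $ i \<ge> 0"
          using that x' grade_outside_cone[of d' x'] by (simp add: cone_def)
        moreover have "good d' \<zero>"
          using CD(2) tors_zero unfolding good_def by (metis M.zero_closed diff_zero)
        ultimately show ?thesis
          using less.hyps[OF _ x'] unfolding good_def by blast
      qed
      then obtain C' where "partial_complement i M C'" "C \<subseteq> C'" "(d, x) \<in> C'"
        using partial_complement_extend[OF C less.prems] bad unfolding good_def by blast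
      then have "(d, x) \<in> C" using max by blast
      moreover have "x \<ominus> x = \<zero>" using less.prems grade_closed by (simp add: diff_eq_zero_iff)
      ultimately show False using bad tors_zero unfolding good_def by metis
    qed
  qed
  then show ?thesis using C unfolding good_def by blast
qed

text \<open>The projection onto the complement along the torsion submodule.  Its additivity and linearity come
from uniqueness: \<open>P x\<close> is the only \<open>w\<close> with components in \<open>C\<close> such that \<open>x - w\<close> is torsion.\<close>

theorem torsion_complement_projection:
  "\<exists>P. ghom (- {i}) M M P \<and> (\<forall>x\<in>carrier M. x \<ominus> P x \<in> tors i M) \<and> (\<forall>x\<in>tors i M. P x = \<zero>)"
proof -
  obtain C where C: "partial_complement i M C"
    and span: "\<And>d x. x \<in> grade M d \<Longrightarrow> \<exists>z. (d, z) \<in> C \<and> x \<ominus> z \<in> tors i M"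
    using ex_complement by blast
  note CD = partial_complementD[OF C]
  define K where "K = {w \<in> carrier M. \<forall>d. (d, gcomp M w d) \<in> C}"
  have Kc: "w \<in> carrier M" if "w \<in> K" for w using that by (simp add: K_def)
  have K0: "\<zero> \<in> K" using CD(2) by (simp add: K_def gcomp_zero)
  have Kadd: "w \<oplus> w' \<in> K" if "w \<in> K" "w' \<in> K" for w w'
    using that CD(3) by (simp add: K_def gcomp_add)
  have Kmon: "mon e a \<odot> w \<in> K" if e: "e \<in> cone (- {i})" and "w \<in> K" for e a w
  proof -
    have w: "w \<in> carrier M" "\<And>d. (d, gcomp M w d) \<in> C" using that by (auto simp: K_def)
    have "(d, gcomp M (mon e a \<odot> w) d) \<in> C" for d
      using gcomp_monomial[OF e w(1), of a "d - e"] CD(4)[OF e w(2), of "d - e" a] by simp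
    then show ?thesis using w e by (simp add: K_def)
  qed
  have Ksm: "p \<odot> w \<in> K" if "p \<in> carrier (Rloc (- {i}))" and w: "w \<in> K" for p w
    using that(1)
  proof (induction p rule: Rloc_induct)
    case zero
    then show ?case using w Kc smult_l_null[of w] K0 by simp
  next
    case (mon e a)
    then show ?case using Kmon w by blast
  next
    case (add p q)
    then show ?case using w Kc smult_l_distr[of p q w] Kadd by simp
  qed
  have Ktors: "w = \<zero>" if w: "w \<in> K" "w \<in> tors i M" for w
  proof -
    have "gcomp M w d = \<zero>" for d
      using w tors_gcomp[OF w(2)] CD(5) by (auto simp: K_def)
    then show ?thesis
      using finsum_gcomp[OF Kc[OF w(1)], of "{}"] by simp
  qed
  have Kgr: "z \<in> K" if "(d, z) \<in> C" for d z
    using that CD(1)[OF that] CD(2) grade_closed by (auto simp: K_def gcomp_homogeneous)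
  have ex: "\<exists>w\<in>K. x \<ominus> w \<in> tors i M" if "x \<in> carrier M" for x
    using that
  proof (induction x rule: homogeneous_induct)
    case zero
    then show ?case using K0 tors_zero diff_zero by (intro bexI[of _ \<zero>]) auto
  next
    case (homogeneous d x)
    then show ?case using span Kgr by blast
  next
    case (add x y)
    then obtain w w' where w: "w \<in> K" "x \<ominus> w \<in> tors i M" "w' \<in> K" "y \<ominus> w' \<in> tors i M" by blast
    then have "(x \<oplus> y) \<ominus> (w \<oplus> w') \<in> tors i M"
      using add Kc by (simp add: add_diff_add tors_add)
    then show ?case using Kadd w by blast
  qed
  \<comment> \<open>\<open>K\<close> and the torsion submodule meet in zero\<close>
  have uniq: "w = w'" if w: "w \<in> K" "w' \<in> K" "x \<ominus> w \<in> tors i M" "x \<ominus> w' \<in> tors i M" and x: "x \<in> carrier M" for w w' x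
  proof -
    have m: "\<ominus> u \<in> K" if "u \<in> K" for u
      using Ksm[of "\<ominus>\<^bsub>Rloc (- {i})\<^esub> \<one>\<^bsub>Rloc (- {i})\<^esub>" u] that Kc[OF that] smult_l_minus[of "\<one>\<^bsub>Rloc (- {i})\<^esub>" u]
        smult_one[of u] R.one_closed by (simp del: Rloc_simps)
    have "w' \<ominus> w \<in> K" using Kadd[OF w(2) m[OF w(1)]] by (simp add: a_minus_def)
    moreover have "w' \<ominus> w \<in> tors i M"
      using tors_diff[OF w(3,4)] diff_diff_diff[OF x Kc[OF w(1)] Kc[OF w(2)]] by simp
    ultimately have "w' \<ominus> w = \<zero>" by (rule Ktors)
    then show ?thesis using w Kc by (simp add: diff_eq_zero_iff)
  qed
  define P where "P x = (SOME w. w \<in> K \<and> x \<ominus> w \<in> tors i M)" for x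
  have P: "P x \<in> K" "x \<ominus> P x \<in> tors i M" if x: "x \<in> carrier M" for x
    using someI_ex[of "\<lambda>w. w \<in> K \<and> x \<ominus> w \<in> tors i M"] ex[OF x] unfolding P_def by blast+
  have PI: "P x = w" if "x \<in> carrier M" "w \<in> K" "x \<ominus> w \<in> tors i M" for x w
    using uniq[OF P(1) that(2) P(2) that(3)] that(1) by blast
  have "ghom (- {i}) M M P"
    unfolding ghom_def
  proof (intro conjI ballI allI)
    show "P \<in> carrier M \<rightarrow> carrier M" using P Kc by blast
    show "P (x \<oplus> y) = P x \<oplus> P y" if "x \<in> carrier M" "y \<in> carrier M" for x y
      using that P Kc by (intro PI) (auto simp: add_diff_add intro: Kadd tors_add)
    show "P (p \<odot> x) = p \<odot> P x" if "p \<in> carrier (Rloc (- {i}))" "x \<in> carrier M" for p x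
      using that P Kc by (intro PI) (auto simp: smult_diff[symmetric] intro: Ksm tors_smult)
    show "P ` grade M d \<subseteq> grade M d" for d
    proof
      fix y assume "y \<in> P ` grade M d"
      then obtain x where x: "x \<in> grade M d" "y = P x" by blast
      obtain z where z: "(d, z) \<in> C" "x \<ominus> z \<in> tors i M" using span[OF x(1)] by blast
      then have "y = z" using x grade_closed Kgr PI by blast
      then show "y \<in> grade M d" using CD(1) z by blast
    qed
  qed
  moreover have "P x = \<zero>" if "x \<in> tors i M" for x
    using that tors_carrier[OF that] K0 by (intro PI) (simp_all add: diff_zero)
  ultimately show ?thesis using P by blast
qed

end

section \<open>Extension of scalars as a localization\<close>

lemma carrier_Rloc_UNIV [simp]: "carrier (Rloc UNIV) = UNIV"
  by (auto simp: carrier_Rloc cone_def)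

lemma ex_clear_denominator:
  fixes r :: "('k::field, 'm::finite) laurent"
  shows "\<exists>n. \<forall>k\<ge>n. mon (axis i (int k)) 1 * r \<in> carrier (Rloc (- {i}))"
proof -
  interpret cring "Rloc (- {i}) :: ('k, 'm) laurent ring" by (rule cring_Rloc)
  have "r \<in> carrier (Rloc UNIV)" by simp
  then show ?thesis
  proof (induction r rule: Rloc_induct)
    case zero
    then show ?case using zero_closed by simp
  next
    case (mon e a)
    have "axis i (int k) + e \<in> cone (- {i})" if "k \<ge> nat (- (e $ i))" for k
      using that by (simp add: cone_def)
    then show ?case by (intro exI[of _ "nat (- (e $ i))"]) (auto simp: mult_single single_in_Rloc)
  next
    case (add p q)
    then obtain n n' where "\<forall>k\<ge>n. mon (axis i (int k)) 1 * p \<in> carrier (Rloc (- {i}))"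
      "\<forall>k\<ge>n'. mon (axis i (int k)) 1 * q \<in> carrier (Rloc (- {i}))" by blast
    then show ?case using add.m_closed
      by (intro exI[of _ "max n n'"]) (simp add: distrib_left)
  qed
qed

lemma tensor_rels_cases:
  assumes "z \<in> tensor_rels \<sigma> M"
  obtains (left) r s x where "z = frag_of (r + s, x) - frag_of (r, x) - frag_of (s, x)" "x \<in> carrier M"
  | (right) r x y where "z = frag_of (r, x \<oplus>\<^bsub>M\<^esub> y) - frag_of (r, x) - frag_of (r, y)" "x \<in> carrier M" "y \<in> carrier M"
  | (balance) r a x where "z = frag_of (r * a, x) - frag_of (r, a \<odot>\<^bsub>M\<^esub> x)" "a \<in> carrier (Rloc \<sigma>)" "x \<in> carrier M"
  using assms unfolding tensor_rels_def by blast

lemma tensor_relsI: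
  "x \<in> carrier M \<Longrightarrow> frag_of (r + s, x) - frag_of (r, x) - frag_of (s, x) \<in> tensor_rels \<sigma> M"
  "x \<in> carrier M \<Longrightarrow> y \<in> carrier M \<Longrightarrow> frag_of (r, x \<oplus>\<^bsub>M\<^esub> y) - frag_of (r, x) - frag_of (r, y) \<in> tensor_rels \<sigma> M"
  "a \<in> carrier (Rloc \<sigma>) \<Longrightarrow> x \<in> carrier M \<Longrightarrow> frag_of (r * a, x) - frag_of (r, a \<odot>\<^bsub>M\<^esub> x) \<in> tensor_rels \<sigma> M"
  unfolding tensor_rels_def by auto

text \<open>A homomorphism out of a free abelian group, with additive notation on both sides.\<close>

lemma frag_hom:
  assumes "abelian_group N" and H: "H \<in> hom (free_Abelian_group S) (add_monoid N)"
    and a: "Poly_Mapping.keys a \<subseteq> S" and b: "Poly_Mapping.keys b \<subseteq> S"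
  shows "H a \<in> carrier N" "H 0 = \<zero>\<^bsub>N\<^esub>" "H (a + b) = H a \<oplus>\<^bsub>N\<^esub> H b"
    "H (- a) = \<ominus>\<^bsub>N\<^esub> H a" "H (a - b) = H a \<ominus>\<^bsub>N\<^esub> H b"
proof -
  interpret N: abelian_group N by fact
  interpret H: group_hom "free_Abelian_group S" "add_monoid N" H
    using H N.a_group by (simp add: group_hom_def group_hom_axioms_def)
  show "H a \<in> carrier N" "H 0 = \<zero>\<^bsub>N\<^esub>" "H (a + b) = H a \<oplus>\<^bsub>N\<^esub> H b"
    using H.hom_closed[of a] H.hom_one H.hom_mult[of a b] a b by simp_all
  show m: "H (- a) = \<ominus>\<^bsub>N\<^esub> H a" using H.hom_inv[of a] a by (simp add: a_inv_def)
  have "H (- b) = \<ominus>\<^bsub>N\<^esub> H b" using H.hom_inv[of b] b by (simp add: a_inv_def)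
  then show "H (a - b) = H a \<ominus>\<^bsub>N\<^esub> H b"
    using H.hom_mult[of a "- b"] a b by (simp add: a_minus_def)
qed

context gmod
begin

abbreviation "Fr \<equiv> tensor_free M"
abbreviation "Null \<equiv> tensor_null \<sigma> M"
abbreviation "Ext \<equiv> ext_scalars \<sigma> M"
abbreviation "pairs \<equiv> (UNIV :: ('k, 'm) laurent set) \<times> carrier M"
abbreviation "coset c \<equiv> Null #>\<^bsub>Fr\<^esub> c"

lemma tensor_free_eq: "tensor_free M = free_Abelian_group pairs"
  by (simp add: tensor_free_def)

lemma carrier_Fr: "c \<in> carrier Fr \<longleftrightarrow> Poly_Mapping.keys c \<subseteq> pairs"
  by (simp add: tensor_free_eq)

lemma mult_Fr [simp]: "a \<otimes>\<^bsub>Fr\<^esub> b = a + b" and one_Fr [simp]: "\<one>\<^bsub>Fr\<^esub> = 0"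
  by (simp_all add: tensor_free_eq)

lemma keys_diff_pairs:
  "Poly_Mapping.keys a \<subseteq> pairs \<Longrightarrow> Poly_Mapping.keys b \<subseteq> pairs \<Longrightarrow> Poly_Mapping.keys (a - b) \<subseteq> pairs"
  using keys_diff[of a b] by blast

lemma keys_frag_pairs: "x \<in> carrier M \<Longrightarrow> Poly_Mapping.keys (frag_of (r, x)) \<subseteq> pairs"
  by simp

lemma rels_keys:
  assumes "z \<in> tensor_rels \<sigma> M"
  shows "Poly_Mapping.keys z \<subseteq> pairs"
  using assms
proof (cases rule: tensor_rels_cases)
  case (left r s x)
  then show ?thesis by (simp only:) (intro keys_diff_pairs keys_frag_pairs)
next
  case (right r x y)
  then show ?thesis by (simp only:) (intro keys_diff_pairs keys_frag_pairs M.a_closed)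
next
  case (balance r a x)
  then show ?thesis by (simp only:) (intro keys_diff_pairs keys_frag_pairs smult_closed)
qed

lemma subgroup_null: "subgroup Null Fr"
  unfolding tensor_null_def
  by (rule group.generate_is_subgroup) (use rels_keys in \<open>auto simp: tensor_free_eq\<close>)

lemma null_keys: "c \<in> Null \<Longrightarrow> Poly_Mapping.keys c \<subseteq> pairs"
  using subgroup.subset[OF subgroup_null] by (auto simp: carrier_Fr[symmetric])

lemma null_zero [simp]: "0 \<in> Null"
  using subgroup.one_closed[OF subgroup_null] by simp

lemma null_add: "a \<in> Null \<Longrightarrow> b \<in> Null \<Longrightarrow> a + b \<in> Null"
  using subgroup.m_closed[OF subgroup_null] by simp

lemma null_uminus: "a \<in> Null \<Longrightarrow> - a \<in> Null"
  using subgroup.m_inv_closed[OF subgroup_null, of a] null_keys[of a] by (simp add: tensor_free_eq)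

lemma null_diff: "a \<in> Null \<Longrightarrow> b \<in> Null \<Longrightarrow> a - b \<in> Null"
  using null_add[of a "- b"] null_uminus[of b] by simp

lemma rels_null: "z \<in> tensor_rels \<sigma> M \<Longrightarrow> z \<in> Null"
  unfolding tensor_null_def by (rule generate.incl)

lemma null_induct [consumes 1, case_names zero rel uminus add]:
  assumes "c \<in> Null" "P 0" "\<And>z. z \<in> tensor_rels \<sigma> M \<Longrightarrow> P z" "\<And>z. z \<in> tensor_rels \<sigma> M \<Longrightarrow> P (- z)"
    "\<And>a b. a \<in> Null \<Longrightarrow> b \<in> Null \<Longrightarrow> P a \<Longrightarrow> P b \<Longrightarrow> P (a + b)"
  shows "P c"
  using assms(1) unfolding tensor_null_def
proof (induction c rule: generate.induct)
  case one
  then show ?case using assms(2) by simp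
next
  case (incl h)
  then show ?case by (rule assms(3))
next
  case (inv h)
  have "inv\<^bsub>Fr\<^esub> h = - h" using rels_keys[OF inv] by (simp add: tensor_free_eq)
  then show ?case using assms(4)[OF inv] by simp
next
  case (eng h1 h2)
  then show ?case using assms(5)[of h1 h2] by (simp add: tensor_null_def)
qed

lemma coset_eq: "coset a = {h + a |h. h \<in> Null}"
  by (auto simp: r_coset_def)

lemma coset_eq_iff: "coset a = coset b \<longleftrightarrow> a - b \<in> Null"
proof
  assume "coset a = coset b"
  moreover have "a \<in> coset a" using null_zero by (auto simp: coset_eq intro: exI[of _ 0])
  ultimately show "a - b \<in> Null" by (auto simp: coset_eq)
next
  have sub: "coset a \<subseteq> coset b" if "a - b \<in> Null" for a b
    using null_add[OF _ that] by (force simp: coset_eq)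
  assume "a - b \<in> Null"
  then show "coset a = coset b" using sub[of a b] sub[of b a] null_uminus[of "a - b"] by auto
qed

lemma normal_null: "Null \<lhd> Fr"
  by (rule comm_group.normal_iff_subgroup[THEN iffD2])
     (simp_all add: subgroup_null tensor_free_eq abelian_free_Abelian_group subgroup_null[unfolded tensor_free_eq])

lemma carrier_Ext: "carrier Ext = coset ` carrier Fr"
  by (auto simp: ext_scalars_def FactGroup_def RCOSETS_def)

lemma carrier_Ext_iff: "X \<in> carrier Ext \<longleftrightarrow> (\<exists>c. Poly_Mapping.keys c \<subseteq> pairs \<and> X = coset c)"
  unfolding carrier_Ext image_iff carrier_Fr[symmetric] by blast

lemma add_Ext: "coset a \<oplus>\<^bsub>Ext\<^esub> coset b = coset (a + b)"
proof -
  have "coset a \<oplus>\<^bsub>Ext\<^esub> coset b = {u + v |u v. u \<in> coset a \<and> v \<in> coset b}"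
    by (auto simp: ext_scalars_def FactGroup_def set_mult_def)
  also have "\<dots> = coset (a + b)"
  proof safe
    fix u v assume "u \<in> coset a" "v \<in> coset b"
    then obtain h h' where "h \<in> Null" "h' \<in> Null" "u = h + a" "v = h' + b" by (auto simp: coset_eq)
    then show "u + v \<in> coset (a + b)"
      using null_add[of h h'] by (auto simp: coset_eq intro!: exI[of _ "h + h'"])
  next
    fix w assume "w \<in> coset (a + b)"
    then obtain h where h: "h \<in> Null" "w = h + (a + b)" by (auto simp: coset_eq)
    then have "w = (h + a) + (0 + b)" by simp
    moreover have "h + a \<in> coset a" "0 + b \<in> coset b" using h by (auto simp: coset_eq intro: exI[of _ 0])
    ultimately show "\<exists>u v. w = u + v \<and> u \<in> coset a \<and> v \<in> coset b" by blast
  qed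
  finally show ?thesis .
qed

abbreviation scale :: "('k, 'm) laurent \<Rightarrow> _" where
  "scale p \<equiv> frag_extend (\<lambda>(r, x). frag_of (p * r, x))"

lemma scale_rels:
  assumes "z \<in> tensor_rels \<sigma> M"
  shows "scale p z \<in> Null"
  using assms
proof (cases rule: tensor_rels_cases)
  case (left r s x)
  then show ?thesis using tensor_relsI(1)[of x M "p * r" "p * s"]
    by (auto intro!: rels_null simp: frag_extend_diff distrib_left)
next
  case (right r x y)
  then show ?thesis using tensor_relsI(2)[of x M y "p * r"]
    by (auto intro!: rels_null simp: frag_extend_diff)
next
  case (balance r a x)
  then show ?thesis using tensor_relsI(3)[of a \<sigma> x M "p * r"]
    by (auto intro!: rels_null simp: frag_extend_diff mult.assoc)
qed

lemma scale_null: "c \<in> Null \<Longrightarrow> scale p c \<in> Null"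
  by (induction c rule: null_induct)
     (simp_all add: scale_rels frag_extend_add frag_extend_minus null_add null_uminus)

lemma smult_Ext: "p \<odot>\<^bsub>Ext\<^esub> coset a = coset (scale p a)"
proof -
  have "coset (scale p c) = coset (scale p a)" if "c \<in> coset a" for c
  proof -
    from that obtain h where "h \<in> Null" "c = h + a" by (auto simp: coset_eq)
    then show ?thesis using scale_null[of h p] by (simp add: coset_eq_iff frag_extend_add)
  qed
  moreover have "a \<in> coset a" by (auto simp: coset_eq intro: exI[of _ 0])
  ultimately have "(\<Union>c\<in>coset a. coset (scale p c)) = coset (scale p a)" by blast
  then show ?thesis by (simp add: ext_scalars_def)
qed

lemma scale_keys: "Poly_Mapping.keys a \<subseteq> pairs \<Longrightarrow> Poly_Mapping.keys (scale p a) \<subseteq> pairs"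
  using keys_frag_extend[of "\<lambda>(r, x). frag_of (p * r, x)" a] by (fastforce simp: keys_frag_of)

lemma pure_tensor_eq: "pure_tensor \<sigma> M r x = coset (frag_of (r, x))"
  by (simp add: pure_tensor_def)

lemma pure_tensor_closed: "x \<in> carrier M \<Longrightarrow> pure_tensor \<sigma> M r x \<in> carrier Ext"
  unfolding carrier_Ext_iff pure_tensor_eq using keys_frag_pairs[of x r] by blast

lemma pure_tensor_grade:
  assumes "r \<in> Rgrade UNIV e" "x \<in> grade M f"
  shows "pure_tensor \<sigma> M r x \<in> grade Ext (e + f)"
proof -
  have "pure_tensor \<sigma> M r x \<in> {pure_tensor \<sigma> M r' x' | r' x' e' f'. r' \<in> Rgrade UNIV e' \<and> x' \<in> grade M f' \<and> e' + f' = e + f}"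
    using assms by blast
  then show ?thesis unfolding ext_scalars_def gmodule.simps by (rule generate.incl)
qed

lemma frag_zero_null: "frag_of (r, \<zero>) \<in> Null"
  using null_uminus[OF rels_null[OF tensor_relsI(2)[of \<zero> M \<zero> r]]] by simp

lemma frag_diff_null:
  assumes "x \<in> carrier M" "y \<in> carrier M"
  shows "frag_of (r, x) - frag_of (r, y) - frag_of (r, x \<ominus> y) \<in> Null"
proof -
  have "(x \<ominus> y) \<oplus> y = x" using assms by (simp add: a_minus_def M.a_assoc M.l_neg)
  then show ?thesis
    using rels_null[OF tensor_relsI(2)[of "x \<ominus> y" M y r]] assms by (simp add: algebra_simps)
qed

end

context torsion_gmod
begin

abbreviation tinv :: "nat \<Rightarrow> ('k, 'm) laurent" where
  "tinv n \<equiv> mon (axis i (- int n)) 1"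

abbreviation tpow :: "nat \<Rightarrow> ('k, 'm) laurent" where
  "tpow n \<equiv> mon (axis i (int n)) 1"

lemma tinv_tpow: "tinv (n + k) * tpow k = tinv n"
  by (simp add: mult_single axis_add)

lemma tensor_common_denominator:
  assumes "x \<in> carrier M"
  shows "frag_of (tinv n, x) - frag_of (tinv (n + k), tpow k \<odot> x) \<in> Null"
  using rels_null[OF tensor_relsI(3)[of "tpow k" "- {i}" x M "tinv (n + k)"]] assms
  unfolding tinv_tpow by simp

text \<open>Clearing denominators and passing to a common one, every tensor is of the form
\<open>t\<^sub>i\<^sup>-\<^sup>n \<otimes> x\<close>.\<close>

lemma tensor_is_fraction:
  assumes "Poly_Mapping.keys c \<subseteq> pairs"
  shows "\<exists>n. \<exists>x\<in>carrier M. c - frag_of (tinv n, x) \<in> Null"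
  using assms
proof (induction c rule: frag_induction)
  case zero
  have "0 - frag_of (tinv 0, \<zero>) \<in> Null" using null_uminus[OF frag_zero_null] by simp
  then show ?case by blast
next
  case (one rx)
  obtain r x where rx: "rx = (r, x)" "x \<in> carrier M" using one by auto
  obtain n where n: "tpow n * r \<in> carrier (Rloc (- {i}))" using ex_clear_denominator by blast
  have "tinv n * (tpow n * r) = r"
    using tinv_tpow[of 0 n] by (simp add: mult.assoc[symmetric] axis_zero)
  then have "frag_of (r, x) - frag_of (tinv n, (tpow n * r) \<odot> x) \<in> Null"
    using rels_null[OF tensor_relsI(3)[OF n rx(2), of "tinv n"]] by simp
  then show ?case using rx n by blast
next
  case (diff a b)
  then obtain n x k y where x: "x \<in> carrier M" "a - frag_of (tinv n, x) \<in> Null"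
    and y: "y \<in> carrier M" "b - frag_of (tinv k, y) \<in> Null" by blast
  let ?x = "tpow k \<odot> x" and ?y = "tpow n \<odot> y" and ?r = "tinv (n + k)"
  have xy: "?x \<in> carrier M" "?y \<in> carrier M" using x y by simp_all
  have 1: "frag_of (tinv n, x) - frag_of (?r, ?x) \<in> Null"
    by (rule tensor_common_denominator[OF x(1)])
  have 2: "frag_of (tinv k, y) - frag_of (?r, ?y) \<in> Null"
    using tensor_common_denominator[OF y(1), of k n] by (simp only: add.commute)
  have 3: "frag_of (?r, ?x) - frag_of (?r, ?y) - frag_of (?r, ?x \<ominus> ?y) \<in> Null"
    by (rule frag_diff_null[OF xy])
  have "(a - frag_of (tinv n, x)) + (frag_of (tinv n, x) - frag_of (?r, ?x))
      - ((b - frag_of (tinv k, y)) + (frag_of (tinv k, y) - frag_of (?r, ?y)))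
      + (frag_of (?r, ?x) - frag_of (?r, ?y) - frag_of (?r, ?x \<ominus> ?y)) \<in> Null"
    by (intro null_add null_diff x(2) y(2) 1 2 3)
  then have "a - b - frag_of (?r, ?x \<ominus> ?y) \<in> Null" by (simp add: algebra_simps)
  then show ?case using xy by blast
qed

text \<open>For every \<open>k\<close> there is a homomorphism \<open>H k\<close> on the free abelian group with
\<open>H k (r, x) = (t\<^sub>i\<^sup>k r) x\<close> whenever \<open>t\<^sub>i\<^sup>k r\<close> is a scalar of \<open>M\<close>; the value zero on the other pairs is
arbitrary.  Each defining relation of the tensor product involves finitely many scalars, so it is
killed by \<open>H k\<close> for all large \<open>k\<close>, and hence so is every element of the subgroup they generate.
Applied to the pair \<open>(1, x)\<close> this gives \<open>t\<^sub>i\<^sup>k x = 0\<close>.\<close>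

lemma tensor_null_torsion:
  assumes x: "x \<in> carrier M" and null: "frag_of (1, x) \<in> Null"
  shows "x \<in> tors i M"
proof -
  let ?f = "\<lambda>k (r, x). if tpow k * r \<in> carrier (Rloc (- {i})) then (tpow k * r) \<odot> x else \<zero>"
  have "\<exists>H. H \<in> hom (free_Abelian_group pairs) (add_monoid M) \<and> (\<forall>z\<in>pairs. H (frag_of z) = ?f k z)" for k
  proof -
    have "?f k ` pairs \<subseteq> carrier (add_monoid M)" by auto
    then show ?thesis by (rule comm_group.free_Abelian_group_universal[OF M.a_comm_group]) blast
  qed
  then have "\<exists>H. \<forall>k. H k \<in> hom (free_Abelian_group pairs) (add_monoid M) \<and> (\<forall>z\<in>pairs. H k (frag_of z) = ?f k z)"
    by (intro choice allI)
  then obtain H where H: "\<forall>k. H k \<in> hom (free_Abelian_group pairs) (add_monoid M) \<and> (\<forall>z\<in>pairs. H k (frag_of z) = ?f k z)"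
    by (rule exE)
  have hom: "H k \<in> hom (free_Abelian_group pairs) (add_monoid M)" for k
    by (rule conjunct1[OF spec[OF H]])
  have Hf: "H k (frag_of z) = ?f k z" if "z \<in> pairs" for k z
    by (rule bspec[OF conjunct2[OF spec[OF H]] that])
  have Hval: "H k (frag_of (r, x)) = (tpow k * r) \<odot> x"
    if "x \<in> carrier M" "tpow k * r \<in> carrier (Rloc (- {i}))" for k r x
    using that Hf[of "(r, x)" k] by simp
  note Hdiff = frag_hom(5)[OF M.abelian_group_axioms hom]
  have vanish: "\<exists>n. \<forall>k\<ge>n. H k z = \<zero>" if "z \<in> tensor_rels (- {i}) M" for z
    using that
  proof (cases rule: tensor_rels_cases)
    case (left r s x)
    obtain n n' where n: "\<And>k. k \<ge> n \<Longrightarrow> tpow k * r \<in> carrier (Rloc (- {i}))"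
      "\<And>k. k \<ge> n' \<Longrightarrow> tpow k * s \<in> carrier (Rloc (- {i}))" using ex_clear_denominator by metis
    have "H k z = \<zero>" if "k \<ge> max n n'" for k
    proof -
      have c: "tpow k * r \<in> carrier (Rloc (- {i}))" "tpow k * s \<in> carrier (Rloc (- {i}))" using n that by auto
      then have c': "tpow k * (r + s) \<in> carrier (Rloc (- {i}))" using R.add.m_closed by (simp add: distrib_left)
      have "H k z = (tpow k * (r + s)) \<odot> x \<ominus> (tpow k * r) \<odot> x \<ominus> (tpow k * s) \<odot> x"
        unfolding left using left(2) c c' by (simp add: Hdiff keys_diff_pairs Hval)
      also have "(tpow k * (r + s)) \<odot> x = (tpow k * r) \<odot> x \<oplus> (tpow k * s) \<odot> x"
        using smult_l_distr[OF c left(2)] by (simp add: distrib_left)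
      finally show ?thesis using c left(2) by (simp add: M.add_diff_diff)
    qed
    then show ?thesis by blast
  next
    case (right r x y)
    obtain n where n: "\<And>k. k \<ge> n \<Longrightarrow> tpow k * r \<in> carrier (Rloc (- {i}))" using ex_clear_denominator by metis
    have "H k z = \<zero>" if "k \<ge> n" for k
    proof -
      have "H k z = (tpow k * r) \<odot> (x \<oplus> y) \<ominus> (tpow k * r) \<odot> x \<ominus> (tpow k * r) \<odot> y"
        unfolding right using right(2,3) n[OF that] by (simp add: Hdiff keys_diff_pairs Hval)
      then show ?thesis using n[OF that] right(2,3)
        by (simp add: smult_r_distr M.add_diff_diff)
    qed
    then show ?thesis by blast
  next
    case (balance r a x)
    obtain n where n: "\<And>k. k \<ge> n \<Longrightarrow> tpow k * r \<in> carrier (Rloc (- {i}))" using ex_clear_denominator by metis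
    have "H k z = \<zero>" if "k \<ge> n" for k
    proof -
      have c: "tpow k * (r * a) \<in> carrier (Rloc (- {i}))"
        using R.m_closed[OF n[OF that] balance(2)] by (simp add: mult.assoc)
      have "H k z = (tpow k * (r * a)) \<odot> x \<ominus> (tpow k * r) \<odot> (a \<odot> x)"
        unfolding balance using balance(2,3) n[OF that] c by (simp add: Hdiff Hval)
      then show ?thesis using smult_assoc1[OF n[OF that] balance(2,3)] balance(2,3) n[OF that]
        by (simp add: mult.assoc diff_eq_zero_iff)
    qed
    then show ?thesis by blast
  qed
  have "\<exists>n. \<forall>k\<ge>n. H k c = \<zero>" if "c \<in> Null" for c
    using that
  proof (induction c rule: null_induct)
    case zero
    then show ?case using frag_hom(2)[OF M.abelian_group_axioms hom, of 0 0] by simp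
  next
    case (rel z)
    then show ?case by (rule vanish)
  next
    case (uminus z)
    obtain n where "\<forall>k\<ge>n. H k z = \<zero>" using vanish[OF uminus] by blast
    then show ?case
      using frag_hom(4)[OF M.abelian_group_axioms hom, of z 0] rels_keys[OF uminus]
      by (intro exI[of _ n]) simp
  next
    case (add a b)
    then obtain n n' where "\<forall>k\<ge>n. H k a = \<zero>" "\<forall>k\<ge>n'. H k b = \<zero>" by blast
    then show ?case
      using frag_hom(3)[OF M.abelian_group_axioms hom null_keys[OF add.hyps(1)] null_keys[OF add.hyps(2)]]
      by (intro exI[of _ "max n n'"]) simp
  qed
  then obtain n where "H n (frag_of (1, x)) = \<zero>" using null by blast
  then have "tpow n \<odot> x = \<zero>" using x by (simp add: Hval)
  then show ?thesis using x unfolding tors_iff by blast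
qed

end

text \<open>The elementwise form of the condition that \<open>\<phi>\<close> exhibits \<open>N\<close> as \<open>M[t\<^sub>i\<^sup>-\<^sup>1]\<close>; the next locale shows that it is
equivalent to \<open>induced_iso\<close>.\<close>

definition localizes ::
  "'m::finite \<Rightarrow> ('k::field, 'm, 'a) gmodule \<Rightarrow> ('k, 'm, 'b) gmodule \<Rightarrow> ('a \<Rightarrow> 'b) \<Rightarrow> bool" where
  "localizes i M N \<phi> \<longleftrightarrow>
     (\<forall>y\<in>carrier N. \<exists>n. \<exists>x\<in>carrier M. mon (axis i (int n)) 1 \<odot>\<^bsub>N\<^esub> y = \<phi> x) \<and>
     (\<forall>x\<in>carrier M. \<phi> x = \<zero>\<^bsub>N\<^esub> \<longrightarrow> x \<in> tors i M)"

locale localization_map = M: torsion_gmod i M + N: gmod UNIV N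
  for i :: "'m::finite" and M :: "('k::field, 'm, 'a) gmodule" and N :: "('k, 'm, 'b) gmodule" +
  fixes \<phi> :: "'a \<Rightarrow> 'b"
  assumes ghom: "ghom (- {i}) M N \<phi>"
begin

lemmas phi = ghomD[OF ghom]

lemma tinv_tpow_N: "y \<in> carrier N \<Longrightarrow> mon (axis i (- int n)) 1 \<odot>\<^bsub>N\<^esub> (mon (axis i (int n)) 1 \<odot>\<^bsub>N\<^esub> y) = y"
  "y \<in> carrier N \<Longrightarrow> mon (axis i (int n)) 1 \<odot>\<^bsub>N\<^esub> (mon (axis i (- int n)) 1 \<odot>\<^bsub>N\<^esub> y) = y"
  by (simp_all add: N.mon_mon cone_def axis_add axis_zero N.mon_one)

lemma induced_iso_imp_localizes:
  assumes "induced_iso (- {i}) M N \<phi>"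
  shows "localizes i M N \<phi>"
proof -
  obtain h where "giso UNIV M.Ext N h"
    and hp: "\<And>r x. x \<in> carrier M \<Longrightarrow> h (pure_tensor (- {i}) M r x) = r \<odot>\<^bsub>N\<^esub> \<phi> x"
    using assms unfolding induced_iso_def by auto
  then obtain g where g0: "ghom UNIV N M.Ext g" "\<forall>X\<in>carrier M.Ext. g (h X) = X" "\<forall>y\<in>carrier N. h (g y) = y"
    unfolding giso_def by (elim conjE exE) (rule that)
  have g: "g \<in> carrier N \<rightarrow> carrier M.Ext" "\<And>X. X \<in> carrier M.Ext \<Longrightarrow> g (h X) = X"
    "\<And>y. y \<in> carrier N \<Longrightarrow> h (g y) = y"
    using ghomD(1)[OF g0(1)] g0(2,3) by simp_all
  note pure = M.pure_tensor_closed
  show ?thesis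
    unfolding localizes_def
  proof (intro conjI ballI impI)
    fix y assume y: "y \<in> carrier N"
    then obtain c where c: "Poly_Mapping.keys c \<subseteq> M.pairs" "g y = M.coset c"
      using Pi_mem[OF g(1) y] M.carrier_Ext_iff by blast
    obtain n x where x: "x \<in> carrier M" "c - frag_of (M.tinv n, x) \<in> M.Null"
      using M.tensor_is_fraction[OF c(1)] by blast
    then have "g y = pure_tensor (- {i}) M (M.tinv n) x"
      using c(2) by (simp add: M.pure_tensor_eq M.coset_eq_iff)
    then have "y = M.tinv n \<odot>\<^bsub>N\<^esub> \<phi> x" using g(3)[OF y] hp[OF x(1)] by simp
    then have "M.tpow n \<odot>\<^bsub>N\<^esub> y = \<phi> x" using tinv_tpow_N(2) phi(2)[OF x(1)] by simp
    then show "\<exists>n. \<exists>x\<in>carrier M. M.tpow n \<odot>\<^bsub>N\<^esub> y = \<phi> x" using x(1) by blast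
  next
    fix x assume x: "x \<in> carrier M" "\<phi> x = \<zero>\<^bsub>N\<^esub>"
    have z: "\<zero>\<^bsub>M\<^esub> \<in> carrier M" by simp
    have phi0: "\<phi> \<zero>\<^bsub>M\<^esub> = \<zero>\<^bsub>N\<^esub>"
      by (rule additive_zero[OF M.abelian_group_axioms N.abelian_group_axioms phi(1,3)])
    have "h (pure_tensor (- {i}) M 1 x) = h (pure_tensor (- {i}) M 1 \<zero>\<^bsub>M\<^esub>)"
      using hp[OF x(1)] hp[OF z] x(2) phi0 by simp
    then have "pure_tensor (- {i}) M 1 x = pure_tensor (- {i}) M 1 \<zero>\<^bsub>M\<^esub>"
      using g(2) pure[OF x(1)] pure[OF z] by metis
    then have "frag_of (1, x) - frag_of (1, \<zero>\<^bsub>M\<^esub>) \<in> M.Null"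
      by (simp add: M.pure_tensor_eq M.coset_eq_iff)
    then have "frag_of (1, x) \<in> M.Null" using M.null_add[OF _ M.frag_zero_null[of 1]] by fastforce
    then show "x \<in> tors i M" by (rule M.tensor_null_torsion[OF x(1)])
  qed
qed

text \<open>The induced map is injective because a tensor \<open>t\<^sub>i\<^sup>-\<^sup>n \<otimes> x\<close> with \<open>t\<^sub>i\<^sup>-\<^sup>n \<phi>(x) = 0\<close> has \<open>t\<^sub>i\<^sup>l x = 0\<close> for some \<open>l\<close> and
so equals \<open>t\<^sub>i\<^sup>-\<^sup>n\<^sup>-\<^sup>l \<otimes> t\<^sub>i\<^sup>l x = 0\<close>.  It is surjective in each degree because in \<open>t\<^sub>i\<^sup>n y = \<phi>(x)\<close> with \<open>y\<close>
homogeneous, \<open>x\<close> may be replaced by its component in the degree of \<open>t\<^sub>i\<^sup>n y\<close>.\<close>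

lemma localizes_imp_induced_iso:
  assumes "localizes i M N \<phi>"
  shows "induced_iso (- {i}) M N \<phi>"
proof -
  have surj: "\<exists>n. \<exists>x\<in>carrier M. M.tpow n \<odot>\<^bsub>N\<^esub> y = \<phi> x" if "y \<in> carrier N" for y
    using assms that unfolding localizes_def by blast
  have ker: "x \<in> tors i M" if "x \<in> carrier M" "\<phi> x = \<zero>\<^bsub>N\<^esub>" for x
    using assms that unfolding localizes_def by blast
  have "(\<lambda>(r, x). r \<odot>\<^bsub>N\<^esub> \<phi> x) ` M.pairs \<subseteq> carrier (add_monoid N)" using phi(2) by auto
  then obtain H where hom: "H \<in> hom (free_Abelian_group M.pairs) (add_monoid N)"
    and Hf: "\<And>z. z \<in> M.pairs \<Longrightarrow> H (frag_of z) = (\<lambda>(r, x). r \<odot>\<^bsub>N\<^esub> \<phi> x) z"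
    by (rule comm_group.free_Abelian_group_universal[OF N.M.a_comm_group]) blast
  have Hval: "H (frag_of (r, x)) = r \<odot>\<^bsub>N\<^esub> \<phi> x" if "x \<in> carrier M" for r x
    using Hf[of "(r, x)"] that by simp
  note Hh = frag_hom[OF N.abelian_group_axioms hom]
  have Hrel: "H z = \<zero>\<^bsub>N\<^esub>" if "z \<in> tensor_rels (- {i}) M" for z
    using that
  proof (cases rule: tensor_rels_cases)
    case (left r s x)
    then show ?thesis using N.smult_l_distr[of r s "\<phi> x"] phi(2)
      by (simp add: Hh(5) M.keys_diff_pairs Hval N.M.add_diff_diff)
  next
    case (right r x y)
    then show ?thesis using phi(2)
      by (simp add: Hh(5) M.keys_diff_pairs Hval phi(3) N.smult_r_distr N.M.add_diff_diff)
  next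
    case (balance r a x)
    then show ?thesis using phi(2) N.smult_assoc1[of r a "\<phi> x"]
      by (simp add: Hh(5) Hval phi(4) N.diff_eq_zero_iff)
  qed
  have Hnull: "H c = \<zero>\<^bsub>N\<^esub>" if "c \<in> M.Null" for c
    using that
  proof (induction c rule: M.null_induct)
    case zero
    then show ?case using Hh(2)[of 0 0] by simp
  next
    case (rel z) then show ?case by (rule Hrel)
  next
    case (uminus z)
    then show ?case using Hrel[OF uminus] Hh(4)[OF M.rels_keys[OF uminus], of 0] by simp
  next
    case (add a b)
    then show ?case using Hh(3)[OF M.null_keys[OF add.hyps(1)] M.null_keys[OF add.hyps(2)]] by simp
  qed
  have Hscale: "H (M.scale p c) = p \<odot>\<^bsub>N\<^esub> H c" if "Poly_Mapping.keys c \<subseteq> M.pairs" for p c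
  proof -
    have "Poly_Mapping.keys c \<subseteq> M.pairs \<and> H (M.scale p c) = p \<odot>\<^bsub>N\<^esub> H c"
      using that
    proof (induction c rule: frag_induction)
      case zero
      then show ?case using Hh(2)[of 0 0] by simp
    next
      case (one z)
      then obtain r x where z: "z = (r, x)" "x \<in> carrier M" by auto
      then show ?case using N.smult_assoc1[of p r "\<phi> x"] phi(2) by (simp add: Hval)
    next
      case (diff a b)
      then show ?case
        using Hh(1)[of a 0] Hh(1)[of b 0] Hh(5)[of a b] Hh(5)[of "M.scale p a" "M.scale p b"] M.scale_keys[of a p] M.scale_keys[of b p]
        by (simp add: M.keys_diff_pairs frag_extend_diff N.smult_diff)
    qed
    then show ?thesis by blast
  qed
  define h where "h X = H (SOME c. c \<in> X)" for X
  have h: "h (M.coset c) = H c" if c: "Poly_Mapping.keys c \<subseteq> M.pairs" for c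
  proof -
    have "c \<in> M.coset c" by (auto simp: M.coset_eq intro: exI[of _ 0])
    then have "(SOME d. d \<in> M.coset c) \<in> M.coset c" by (rule someI)
    then obtain u where u: "u \<in> M.Null" "(SOME d. d \<in> M.coset c) = u + c" by (auto simp: M.coset_eq)
    then show ?thesis using Hh(3)[OF M.null_keys[OF u(1)] c] Hnull[OF u(1)] Hh(1)[OF c c] by (simp add: h_def)
  qed
  have hpure: "h (pure_tensor (- {i}) M r x) = r \<odot>\<^bsub>N\<^esub> \<phi> x" if "x \<in> carrier M" for r x
    using that by (simp add: M.pure_tensor_eq h Hval)
  note carE = M.carrier_Ext_iff
  have keys_add_pairs: "Poly_Mapping.keys (a + b) \<subseteq> M.pairs"
    if "Poly_Mapping.keys a \<subseteq> M.pairs" "Poly_Mapping.keys b \<subseteq> M.pairs" for a b :: "(('k, 'm) laurent \<times> 'a) \<Rightarrow>\<^sub>0 int"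
    using that keys_add[of a b] by blast
  have closedE: "X \<oplus>\<^bsub>M.Ext\<^esub> Y \<in> carrier M.Ext" "h (X \<oplus>\<^bsub>M.Ext\<^esub> Y) = h X \<oplus>\<^bsub>N\<^esub> h Y"
    if XY: "X \<in> carrier M.Ext" "Y \<in> carrier M.Ext" for X Y
  proof -
    obtain a b where "Poly_Mapping.keys a \<subseteq> M.pairs" "X = M.coset a" "Poly_Mapping.keys b \<subseteq> M.pairs" "Y = M.coset b"
      using XY[unfolded carE] by blast
    then show "X \<oplus>\<^bsub>M.Ext\<^esub> Y \<in> carrier M.Ext" "h (X \<oplus>\<^bsub>M.Ext\<^esub> Y) = h X \<oplus>\<^bsub>N\<^esub> h Y"
      using keys_add_pairs[of a b] by (auto simp: carE M.add_Ext h Hh(3))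
  qed
  have smultE: "p \<odot>\<^bsub>M.Ext\<^esub> X \<in> carrier M.Ext" "h (p \<odot>\<^bsub>M.Ext\<^esub> X) = p \<odot>\<^bsub>N\<^esub> h X"
    if X: "X \<in> carrier M.Ext" for p X
  proof -
    obtain a where "Poly_Mapping.keys a \<subseteq> M.pairs" "X = M.coset a"
      using X[unfolded carE] by blast
    then show "p \<odot>\<^bsub>M.Ext\<^esub> X \<in> carrier M.Ext" "h (p \<odot>\<^bsub>M.Ext\<^esub> X) = p \<odot>\<^bsub>N\<^esub> h X"
      using M.scale_keys[of a p] by (auto simp: carE M.smult_Ext h Hscale)
  qed
  have hclosed: "h X \<in> carrier N" if "X \<in> carrier M.Ext" for X
    using that Hh(1) by (auto simp: carE h)
  have frac: "\<exists>n. \<exists>x\<in>carrier M. X = pure_tensor (- {i}) M (M.tinv n) x" if "X \<in> carrier M.Ext" for X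
    using that M.tensor_is_fraction by (fastforce simp: carE M.pure_tensor_eq M.coset_eq_iff)
  have inj: "X = Y" if XY: "X \<in> carrier M.Ext" "Y \<in> carrier M.Ext" "h X = h Y" for X Y
  proof -
    obtain a b where ab: "Poly_Mapping.keys a \<subseteq> M.pairs" "X = M.coset a" "Poly_Mapping.keys b \<subseteq> M.pairs" "Y = M.coset b"
      using XY(1,2)[unfolded carE] by blast
    have k: "Poly_Mapping.keys (a - b) \<subseteq> M.pairs" using M.keys_diff_pairs ab by blast
    have z: "H (a - b) = \<zero>\<^bsub>N\<^esub>" using ab XY(3) Hh(1,5) by (simp add: h N.diff_eq_zero_iff)
    obtain n x where x: "x \<in> carrier M" "a - b - frag_of (M.tinv n, x) \<in> M.Null"
      using M.tensor_is_fraction[OF k] by blast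
    have "M.coset (a - b) = M.coset (frag_of (M.tinv n, x))" using x(2) M.coset_eq_iff by blast
    then have "H (a - b) = H (frag_of (M.tinv n, x))"
      using h[OF k] h[OF M.keys_frag_pairs[OF x(1)], of "M.tinv n"] by simp
    then have "M.tinv n \<odot>\<^bsub>N\<^esub> \<phi> x = \<zero>\<^bsub>N\<^esub>" using z Hval[OF x(1)] by simp
    then have "\<phi> x = \<zero>\<^bsub>N\<^esub>" using tinv_tpow_N(2)[OF phi(2)[OF x(1)], of n] by simp
    then obtain l where l: "M.tpow l \<odot>\<^bsub>M\<^esub> x = \<zero>\<^bsub>M\<^esub>" using ker[OF x(1)] M.tors_iff by blast
    have "frag_of (M.tinv n, x) \<in> M.Null"
      using M.null_add[OF M.tensor_common_denominator[OF x(1), of n l] M.frag_zero_null[of "M.tinv (n + l)"]]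
      by (simp add: l)
    then have "a - b \<in> M.Null" using M.null_add[OF x(2)] by fastforce
    then show "X = Y" using ab by (simp add: M.coset_eq_iff)
  qed
  have surjE: "\<exists>X\<in>grade M.Ext d. h X = y" if y: "y \<in> grade N d" for y d
  proof -
    have yc: "y \<in> carrier N" by (rule N.grade_closed[OF y])
    obtain n x where x: "x \<in> carrier M" "M.tpow n \<odot>\<^bsub>N\<^esub> y = \<phi> x" using surj[OF yc] by blast
    let ?d = "axis i (int n) + d"
    have "\<phi> (gcomp M x ?d) = gcomp N (M.tpow n \<odot>\<^bsub>N\<^esub> y) ?d"
      unfolding x(2)
      by (rule additive_gcomp[OF M.gmod_axioms N.gmod_axioms phi(1,3,5) x(1)])
    also have "\<dots> = M.tpow n \<odot>\<^bsub>N\<^esub> y"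
      using N.gcomp_monomial[of "axis i (int n)" y 1 d] yc N.gcomp_homogeneous[OF y] by simp
    finally have e: "\<phi> (gcomp M x ?d) = M.tpow n \<odot>\<^bsub>N\<^esub> y" .
    let ?X = "pure_tensor (- {i}) M (M.tinv n) (gcomp M x ?d)"
    have "h ?X = y"
      using hpure[OF M.gcomp_closed[OF x(1)]] e tinv_tpow_N(1)[OF yc] by simp
    moreover have "M.tinv n \<in> Rgrade UNIV (axis i (- int n))" by (rule single_in_Rgrade) (simp add: cone_def)
    moreover have "axis i (- int n) + ?d = d" by (simp add: add.assoc[symmetric] axis_add axis_zero)
    ultimately show ?thesis
      using M.pure_tensor_grade[OF _ M.gcomp_grade[OF x(1), of ?d], of "M.tinv n"] by metis
  qed
  interpret Q: group "tensor_free M Mod M.Null" by (rule normal.factorgroup_is_group[OF M.normal_null])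
  interpret hQ: group_hom "tensor_free M Mod M.Null" "add_monoid N" h
  proof unfold_locales
    have "carrier (tensor_free M Mod M.Null) = carrier M.Ext"
      "\<And>X Y. X \<otimes>\<^bsub>tensor_free M Mod M.Null\<^esub> Y = X \<oplus>\<^bsub>M.Ext\<^esub> Y" by (simp_all add: ext_scalars_def)
    then show "h \<in> hom (tensor_free M Mod M.Null) (add_monoid N)"
      using closedE hclosed by (auto simp: hom_def)
  qed
  have gradeE: "h X \<in> grade N d" and gradeEc: "X \<in> carrier M.Ext" if X: "X \<in> grade M.Ext d" for X d
  proof -
    define G where "G = {pure_tensor (- {i}) M r x | r x e f. r \<in> Rgrade UNIV e \<and> x \<in> grade M f \<and> e + f = d}"
    have X: "X \<in> generate (tensor_free M Mod M.Null) G" using X by (simp add: ext_scalars_def G_def)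
    have "G \<subseteq> carrier M.Ext"
      using M.grade_closed M.pure_tensor_closed unfolding G_def by blast
    then have GQ: "G \<subseteq> carrier (tensor_free M Mod M.Null)" by (simp add: ext_scalars_def)
    show "X \<in> carrier M.Ext" using Q.generate_in_carrier[OF GQ X] by (simp add: ext_scalars_def)
    have "h ` G \<subseteq> grade N d"
    proof
      fix y assume "y \<in> h ` G"
      then obtain r x e f where *: "y = h (pure_tensor (- {i}) M r x)" "r \<in> Rgrade UNIV e" "x \<in> grade M f" "e + f = d"
        unfolding G_def by blast
      have "r \<odot>\<^bsub>N\<^esub> \<phi> x \<in> grade N (e + f)"
        using N.graded *(2) phi(5)[OF *(3)] unfolding graded_module_def by blast
      then show "y \<in> grade N d" using * hpure[OF M.grade_closed[OF *(3)]] by simp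
    qed
    then have "generate (add_monoid N) (h ` G) \<subseteq> grade N d"
      by (rule group.generate_subgroup_incl[OF N.M.a_group _ N.subgroup_grade])
    then show "h X \<in> grade N d" using hQ.generate_img[OF GQ] X by auto
  qed
  define g where "g y = (THE X. X \<in> carrier M.Ext \<and> h X = y)" for y
  have gh: "g (h X) = X" if "X \<in> carrier M.Ext" for X
    unfolding g_def by (rule the_equality) (simp_all add: that inj)
  have surjc: "\<exists>X\<in>carrier M.Ext. h X = y" if y: "y \<in> carrier N" for y
  proof -
    obtain n x where x: "x \<in> carrier M" "M.tpow n \<odot>\<^bsub>N\<^esub> y = \<phi> x" using surj[OF y] by blast
    have "h (pure_tensor (- {i}) M (M.tinv n) x) = y" using hpure[OF x(1)] x(2)[symmetric] tinv_tpow_N(1)[OF y] by simp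
    then show ?thesis using M.pure_tensor_closed[OF x(1)] by blast
  qed
  have "ghom UNIV M.Ext N h"
    unfolding ghom_def using hclosed closedE(2) smultE(2) gradeE by (simp add: image_subset_iff)
  moreover have "ghom UNIV N M.Ext g"
    unfolding ghom_def
  proof (intro conjI ballI allI)
    show "g \<in> carrier N \<rightarrow> carrier M.Ext"
    proof
      fix y assume "y \<in> carrier N"
      then show "g y \<in> carrier M.Ext" using surjc gh by metis
    qed
    show "g (y \<oplus>\<^bsub>N\<^esub> z) = g y \<oplus>\<^bsub>M.Ext\<^esub> g z" if yz: "y \<in> carrier N" "z \<in> carrier N" for y z
    proof -
      obtain X Y where "X \<in> carrier M.Ext" "Y \<in> carrier M.Ext" "y = h X" "z = h Y" using surjc yz by metis
      then show ?thesis using gh closedE by metis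
    qed
    show "g (p \<odot>\<^bsub>N\<^esub> y) = p \<odot>\<^bsub>M.Ext\<^esub> g y" if y: "y \<in> carrier N" for p y
    proof -
      obtain X where "X \<in> carrier M.Ext" "y = h X" using surjc y by metis
      then show ?thesis using gh smultE by metis
    qed
    show "g ` grade N d \<subseteq> grade M.Ext d" for d
    proof (rule image_subsetI)
      fix y assume "y \<in> grade N d"
      then show "g y \<in> grade M.Ext d" using surjE gh gradeEc by metis
    qed
  qed
  moreover have "\<forall>y\<in>carrier N. h (g y) = y" using surjc gh by metis
  ultimately have "giso UNIV M.Ext N h" unfolding giso_def using gh by blast
  then show ?thesis unfolding induced_iso_def using hpure by auto
qed

end

section \<open>Projections with a given kernel\<close>

lemma ghomI:
  assumes "\<And>x. x \<in> carrier M \<Longrightarrow> f x \<in> carrier N"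
    "\<And>x y. x \<in> carrier M \<Longrightarrow> y \<in> carrier M \<Longrightarrow> f (x \<oplus>\<^bsub>M\<^esub> y) = f x \<oplus>\<^bsub>N\<^esub> f y"
    "\<And>p x. p \<in> carrier (Rloc \<sigma>) \<Longrightarrow> x \<in> carrier M \<Longrightarrow> f (p \<odot>\<^bsub>M\<^esub> x) = p \<odot>\<^bsub>N\<^esub> f x"
    "\<And>d x. x \<in> grade M d \<Longrightarrow> f x \<in> grade N d"
  shows "ghom \<sigma> M N f"
  unfolding ghom_def using assms by (simp add: image_subset_iff)

lemma ghom_comp:
  assumes f: "ghom \<sigma> M N f" and g: "ghom \<sigma> N P g"
  shows "ghom \<sigma> M P (\<lambda>x. g (f x))"
  by (rule ghomI) (simp_all add: ghomD[OF f] ghomD[OF g])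

lemma ghom_restrict_scalars: "ghom UNIV M N f \<Longrightarrow> ghom \<sigma> M N f"
  by (rule ghomI) (simp_all add: ghomD)

lemma ghom_factor:
  fixes M :: "('k::field, 'm::finite, 'a) gmodule"
  assumes M: "Module.module (Rloc \<sigma>) M" and f: "gepi \<sigma> M N f" and g: "ghom \<sigma> M P g"
    and h: "\<And>x. x \<in> carrier M \<Longrightarrow> h (f x) = g x"
    and gr: "\<And>d x. x \<in> grade M d \<Longrightarrow> x \<in> carrier M"
  shows "ghom \<sigma> N P h"
proof -
  interpret M: Module.module "Rloc \<sigma>" M by (rule M)
  note F = gepiD[OF f] and G = ghomD[OF g]
  have rep: "\<exists>x\<in>carrier M. y = f x" if "y \<in> carrier N" for y using that F(1) by auto
  show ?thesis
  proof (rule ghomI)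
    fix y assume "y \<in> carrier N"
    then show "h y \<in> carrier P" using rep h G(2) by metis
  next
    fix y z assume "y \<in> carrier N" "z \<in> carrier N"
    then obtain u v where uv: "u \<in> carrier M" "v \<in> carrier M" "y = f u" "z = f v" using rep by metis
    then have "h (y \<oplus>\<^bsub>N\<^esub> z) = h (f (u \<oplus>\<^bsub>M\<^esub> v))" by (simp add: F(3))
    then show "h (y \<oplus>\<^bsub>N\<^esub> z) = h y \<oplus>\<^bsub>P\<^esub> h z" using uv by (simp add: h G(3))
  next
    fix p :: "('k, 'm) laurent" and y assume p: "p \<in> carrier (Rloc \<sigma>)" and "y \<in> carrier N"
    then obtain u where u: "u \<in> carrier M" "y = f u" using rep by metis
    then have "h (p \<odot>\<^bsub>N\<^esub> y) = h (f (p \<odot>\<^bsub>M\<^esub> u))" using p by (simp add: F(4))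
    then show "h (p \<odot>\<^bsub>N\<^esub> y) = p \<odot>\<^bsub>P\<^esub> h y" using u p by (simp add: h G(4))
  next
    fix d y assume "y \<in> grade N d"
    then obtain u where "u \<in> grade M d" "y = f u" unfolding F(5) by blast
    then show "h y \<in> grade P d" using G(5) h gr by simp
  qed
qed

text \<open>An idempotent graded endomorphism \<open>P\<close> with kernel \<open>T\<close>, so that \<open>M\<close> is the direct sum of \<open>T\<close> and
\<open>P(M)\<close>.\<close>

locale projection = gmod \<sigma> M
  for \<sigma> :: "'m::finite set" and M :: "('k::field, 'm, 'a) gmodule" (structure) +
  fixes T :: "'a set" and P :: "'a \<Rightarrow> 'a"
  assumes P: "ghom \<sigma> M M P"
    and T_subset: "T \<subseteq> carrier M"
    and diff_in_T: "x \<in> carrier M \<Longrightarrow> x \<ominus> P x \<in> T"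
    and P_T: "x \<in> T \<Longrightarrow> P x = \<zero>"
begin

lemmas Phom = ghomD[OF P]

lemma P_zero [simp]: "P \<zero> = \<zero>"
  by (rule additive_zero[OF M.abelian_group_axioms M.abelian_group_axioms Phom(1,3)])

lemma P_closed [simp]: "x \<in> carrier M \<Longrightarrow> P x \<in> carrier M"
  by (rule Phom(2))

lemma T_iff: "x \<in> T \<longleftrightarrow> x \<in> carrier M \<and> P x = \<zero>"
  using T_subset P_T diff_in_T[of x] by (auto simp: M.diff_zero)

lemma P_uminus: "x \<in> carrier M \<Longrightarrow> P (\<ominus> x) = \<ominus> P x"
  using Phom(3)[of "\<ominus> x" x] by (intro M.minus_equality[symmetric]) (auto simp: M.l_neg)

lemma P_diff: "x \<in> carrier M \<Longrightarrow> y \<in> carrier M \<Longrightarrow> P (x \<ominus> y) = P x \<ominus> P y"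
  by (simp add: a_minus_def Phom(3) P_uminus)

lemma P_P [simp]: "x \<in> carrier M \<Longrightarrow> P (P x) = P x"
  using P_T[OF diff_in_T[of x]] by (simp add: P_diff M.diff_eq_zero_iff)

lemma P_gcomp: "x \<in> carrier M \<Longrightarrow> P (gcomp M x d) = gcomp M (P x) d"
  by (rule additive_gcomp[OF gmod_axioms gmod_axioms Phom(1,3,5)])

lemma diff_diff_P: "x \<in> carrier M \<Longrightarrow> y \<in> carrier M \<Longrightarrow> x \<ominus> P x = y \<ominus> P y \<Longrightarrow> P x = P y \<Longrightarrow> x = y"
  by (simp add: a_minus_def)

lemma eq_T: "x \<in> T \<Longrightarrow> x \<ominus> P x = x"
  using T_iff by (simp add: M.diff_zero)

lemma complement_ghom: "ghom \<sigma> M M (\<lambda>x. x \<ominus> P x)"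
  by (rule ghomI) (auto simp: Phom M.add_diff_add smult_diff grade_minus)

lemma gepi_image: "gepi \<sigma> M (gsub M (P ` carrier M)) P"
proof -
  have "grade M d \<inter> P ` carrier M = P ` grade M d" for d
  proof
    show "grade M d \<inter> P ` carrier M \<subseteq> P ` grade M d"
    proof
      fix y assume "y \<in> grade M d \<inter> P ` carrier M"
      then have "y \<in> grade M d" "P y = y" by auto
      then show "y \<in> P ` grade M d" by (metis imageI)
    qed
    show "P ` grade M d \<subseteq> grade M d \<inter> P ` carrier M" using Phom(5) grade_closed by auto
  qed
  then show ?thesis
    unfolding gepi_def gsub_def by (simp add: Phom(3,4) P_gcomp gcomp_zero)
qed

lemma gepi_kernel: "gepi \<sigma> M (gsub M T) (\<lambda>x. x \<ominus> P x)"
proof -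
  let ?Q = "\<lambda>x. x \<ominus> P x"
  note Q = ghomD[OF complement_ghom]
  have "T = ?Q ` carrier M"
  proof
    show "T \<subseteq> ?Q ` carrier M"
    proof
      fix x assume "x \<in> T"
      then show "x \<in> ?Q ` carrier M" using eq_T[of x] T_subset by (intro image_eqI[of _ _ x]) auto
    qed
    show "?Q ` carrier M \<subseteq> T" using diff_in_T by auto
  qed
  moreover have "grade M d \<inter> T = ?Q ` grade M d" for d
  proof
    show "grade M d \<inter> T \<subseteq> ?Q ` grade M d"
    proof
      fix x assume "x \<in> grade M d \<inter> T"
      then show "x \<in> ?Q ` grade M d" using eq_T[of x] by (intro image_eqI[of _ _ x]) auto
    qed
    show "?Q ` grade M d \<subseteq> grade M d \<inter> T" using Q(5) diff_in_T grade_closed by auto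
  qed
  moreover have "?Q (gcomp M x d) = gcomp M (?Q x) d" if "x \<in> carrier M" for x d
    by (rule additive_gcomp[OF gmod_axioms gmod_axioms Q(1,3,5) that])
  ultimately show ?thesis
    unfolding gepi_def gsub_def by (simp add: Q(3,4) M.diff_zero gcomp_zero)
qed

text \<open>Cosets of the kernel are fibres of \<open>P\<close>, so computations with cosets reduce to the
linearity of \<open>P\<close>.\<close>

lemma coset_eq_fibre: "x \<in> carrier M \<Longrightarrow> T +> x = {z \<in> carrier M. P z = P x}"
proof safe
  assume x: "x \<in> carrier M"
  fix z assume "z \<in> T +> x"
  then obtain u where "u \<in> T" "z = u \<oplus> x" by (auto simp: a_r_coset_def r_coset_def)
  then show "z \<in> carrier M" "P z = P x" using x T_iff by (auto simp: Phom(3))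
next
  fix z assume *: "x \<in> carrier M" "z \<in> carrier M" "P z = P x"
  then have "z \<ominus> x \<in> T" "z = (z \<ominus> x) \<oplus> x"
    by (simp_all add: T_iff P_diff M.diff_eq_zero_iff) (simp add: a_minus_def M.a_assoc M.l_neg)
  then show "z \<in> T +> x" by (auto simp: a_r_coset_def r_coset_def)
qed

lemma coset_eq_iff_P: "x \<in> carrier M \<Longrightarrow> y \<in> carrier M \<Longrightarrow> T +> x = T +> y \<longleftrightarrow> P x = P y"
  by (auto simp: coset_eq_fibre)

lemma coset_zero_T: "T +> \<zero> = T"
  by (auto simp: coset_eq_fibre T_iff)

lemma coset_eq_T_iff: "x \<in> carrier M \<Longrightarrow> T +> x = T \<longleftrightarrow> P x = \<zero>"
  using coset_eq_iff_P[of x \<zero>] by (simp add: coset_zero_T)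

lemma coset_add: 
  assumes x: "x \<in> carrier M" and y: "y \<in> carrier M"
  shows "(T +> x) <+> (T +> y) = T +> (x \<oplus> y)"
proof -
  have "(T +> x) <+> (T +> y) = {u \<oplus> v |u v. u \<in> T +> x \<and> v \<in> T +> y}"
    by (auto simp: set_add_def set_mult_def)
  also have "\<dots> = T +> (x \<oplus> y)"
  proof safe
    fix u v assume "u \<in> T +> x" "v \<in> T +> y"
    then show "u \<oplus> v \<in> T +> (x \<oplus> y)" using x y by (simp add: coset_eq_fibre Phom(3))
  next
    fix z assume "z \<in> T +> (x \<oplus> y)"
    then have z: "z \<in> carrier M" "P z = P x \<oplus> P y" using x y by (simp_all add: coset_eq_fibre Phom(3))
    have "P x \<oplus> P y \<ominus> P y = P x" using x y by (simp add: a_minus_def M.a_assoc M.r_neg)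
    then have "z \<ominus> y \<in> T +> x" using x y z by (simp add: coset_eq_fibre P_diff)
    moreover have "y \<in> T +> y" using y by (simp add: coset_eq_fibre)
    moreover have "z = (z \<ominus> y) \<oplus> y" using y z by (simp add: a_minus_def M.a_assoc M.l_neg)
    ultimately show "\<exists>u v. z = u \<oplus> v \<and> u \<in> T +> x \<and> v \<in> T +> y" by blast
  qed
  finally show ?thesis .
qed

lemma coset_smult:
  assumes p: "p \<in> carrier (Rloc \<sigma>)" and x: "x \<in> carrier M"
  shows "(\<Union>z\<in>T +> x. T +> (p \<odot> z)) = T +> (p \<odot> x)"
proof -
  have "T +> (p \<odot> z) = T +> (p \<odot> x)" if "z \<in> T +> x" for z
    using that p x by (simp add: coset_eq_fibre Phom(4))
  moreover have "x \<in> T +> x" using x by (simp add: coset_eq_fibre)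
  ultimately show ?thesis by blast
qed

lemma gepi_quotient: "gepi \<sigma> M (gquot M T) (\<lambda>x. T +> x)"
proof -
  have "a_rcosets T = (\<lambda>x. T +> x) ` carrier M"
    by (auto simp: A_RCOSETS_def RCOSETS_def a_r_coset_def)
  then show ?thesis
    unfolding gepi_def gquot_def
    by (simp add: coset_zero_T coset_add coset_smult coset_eq_T_iff P_gcomp gcomp_zero gcomp_closed)
qed

lemma gepi_direct_sum: "gepi \<sigma> M (gdsum (gsub M T) (gquot M T)) (\<lambda>x. (x \<ominus> P x, T +> x))"
proof -
  let ?f = "\<lambda>x. (x \<ominus> P x, T +> x)"
  note K = gepiD[OF gepi_kernel] and Q = gepiD[OF gepi_quotient]
  have *: "(u, X) \<in> ?f ` {x \<in> carrier M. x \<in> A}"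
    if u: "u \<in> T" "u \<in> A" and X: "X = T +> y" "y \<in> A" "y \<in> carrier M"
      and A: "\<And>x y. x \<in> A \<Longrightarrow> y \<in> A \<Longrightarrow> x \<oplus> P y \<in> A" for u X y A
  proof (rule image_eqI)
    \<comment> \<open>the preimage of \<open>(u, T + y)\<close> is \<open>u + P y\<close>\<close>
    have uc: "u \<in> carrier M" "P u = \<zero>" using u T_iff by auto
    have Pz: "P (u \<oplus> P y) = P y" using uc X(3) by (simp add: Phom(3))
    have "(u \<oplus> P y) \<ominus> P y = u" using uc X(3) by (simp add: a_minus_def M.a_assoc M.r_neg)
    then show "(u, X) = ?f (u \<oplus> P y)"
      using Pz uc X(1,3) coset_eq_iff_P[of "u \<oplus> P y" y] by simp
    show "u \<oplus> P y \<in> {x \<in> carrier M. x \<in> A}" using A u X uc by simp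
  qed
  have car: "T \<times> (\<lambda>x. T +> x) ` carrier M = ?f ` carrier M"
  proof
    show "?f ` carrier M \<subseteq> T \<times> (\<lambda>x. T +> x) ` carrier M" using diff_in_T by auto
    show "T \<times> (\<lambda>x. T +> x) ` carrier M \<subseteq> ?f ` carrier M"
      using *[of _ "carrier M"] T_subset by fastforce
  qed
  have gr: "(grade M d \<inter> T) \<times> (\<lambda>x. T +> x) ` grade M d = ?f ` grade M d" for d
  proof
    show "?f ` grade M d \<subseteq> (grade M d \<inter> T) \<times> (\<lambda>x. T +> x) ` grade M d"
      using diff_in_T grade_closed grade_minus Phom(5) by auto
    have "{x \<in> carrier M. x \<in> grade M d} = grade M d" using grade_closed by auto
    then show "(grade M d \<inter> T) \<times> (\<lambda>x. T +> x) ` grade M d \<subseteq> ?f ` grade M d"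
      using *[of _ "grade M d"] grade_closed grade_add Phom(5) by fastforce
  qed
  have "carrier (gquot M T) = (\<lambda>x. T +> x) ` carrier M" "\<And>d. grade (gquot M T) d = (\<lambda>x. T +> x) ` grade M d"
    using Q by auto
  moreover have "carrier (gsub M T) = T" "\<And>d. grade (gsub M T) d = grade M d \<inter> T" "\<zero>\<^bsub>gsub M T\<^esub> = \<zero>"
    by (simp_all add: gsub_def)
  moreover have "gcomp M x d \<ominus> P (gcomp M x d) = \<zero> \<and> T +> gcomp M x d = T +> \<zero>"
    if "x \<in> carrier M" "x \<ominus> P x = \<zero>" "T +> x = T +> \<zero>" for x d
  proof -
    have "x = \<zero>" using that coset_eq_T_iff[of x] by (simp add: coset_zero_T M.diff_zero)
    then show ?thesis by (simp add: gcomp_zero M.diff_zero)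
  qed
  ultimately show ?thesis
    unfolding gepi_def gdsum_def using K(3,4) Q(2-4)
    by (simp add: car gr M.diff_zero)
qed

end

lemma gepi_tors:
  assumes "gmod \<sigma> M" and f: "gepi \<sigma> M N f" and x: "x \<in> tors i M"
  shows "f x \<in> tors i N"
proof -
  interpret M: gmod \<sigma> M by fact
  obtain n where n: "mon (axis i (int n)) 1 \<odot>\<^bsub>M\<^esub> x = \<zero>\<^bsub>M\<^esub>" and xc: "x \<in> carrier M"
    using x M.tors_iff by blast
  have "mon (axis i (int n)) 1 \<odot>\<^bsub>N\<^esub> f x = f (mon (axis i (int n)) 1 \<odot>\<^bsub>M\<^esub> x)"
    using gepiD(4)[OF f _ xc] by simp
  also have "\<dots> = \<zero>\<^bsub>N\<^esub>" using n gepiD(2)[OF f] by simp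
  finally have "\<exists>n. tvar i ^ n \<odot>\<^bsub>N\<^esub> f x = \<zero>\<^bsub>N\<^esub>" unfolding tvar_power by blast
  then show ?thesis using gepiD(1)[OF f] xc by (simp add: tors_def)
qed

text \<open>Dividing out exactly the torsion leaves no torsion: \<open>t\<^sub>i\<^sup>n x \<in> T\<close> implies \<open>x \<in> T\<close>.\<close>

lemma gepi_torsion_free:
  assumes "gmod \<sigma> M" and f: "gepi \<sigma> M N f"
    and ker: "\<And>x. x \<in> carrier M \<Longrightarrow> f x = \<zero>\<^bsub>N\<^esub> \<longleftrightarrow> x \<in> tors i M"
  shows "tors i N = {\<zero>\<^bsub>N\<^esub>}"
proof -
  interpret M: gmod \<sigma> M by fact
  have "y = \<zero>\<^bsub>N\<^esub>" if y: "y \<in> tors i N" for y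
  proof -
    obtain n where n: "mon (axis i (int n)) 1 \<odot>\<^bsub>N\<^esub> y = \<zero>\<^bsub>N\<^esub>" and "y \<in> carrier N"
      using y unfolding tors_def tvar_power by blast
    then obtain x where x: "x \<in> carrier M" "y = f x" using gepiD(1)[OF f] by auto
    have "f (mon (axis i (int n)) 1 \<odot>\<^bsub>M\<^esub> x) = \<zero>\<^bsub>N\<^esub>" using n x gepiD(4)[OF f _ x(1)] by simp
    then have "mon (axis i (int n)) 1 \<odot>\<^bsub>M\<^esub> x \<in> tors i M" using ker x(1) by simp
    then have "x \<in> tors i M" by (rule M.tors_saturated[OF x(1)])
    then show ?thesis using ker x by simp
  qed
  moreover have "\<zero>\<^bsub>N\<^esub> \<in> tors i N"
    using gepi_tors[OF assms(1) f M.tors_zero[of i]] gepiD(2)[OF f] by simp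
  ultimately show ?thesis by blast
qed

section \<open>Images of localized persistence modules\<close>

lemma UNIV_notin_Km [simp]: "UNIV \<notin> Km" and Compl_notin_Km [simp]: "- {i} \<notin> Km"
  by (auto simp: notin_Km_iff)

lemma Compl_singleton_neq_UNIV [simp]: "- {i} \<noteq> UNIV"
  by auto

lemma LKmD:
  assumes "M \<in> LKm"
  shows "\<And>\<sigma>. \<sigma> \<notin> Km \<Longrightarrow> gmod \<sigma> (lmod M \<sigma>)" "\<And>\<sigma>. \<sigma> \<notin> Km \<Longrightarrow> fin_gen \<sigma> (lmod M \<sigma>)"
    "\<And>i. ghom (- {i}) (lmod M (- {i})) (lmod M UNIV) (lmap M i)"
    "\<And>i. localizes i (lmod M (- {i})) (lmod M UNIV) (lmap M i)"
proof -
  show g: "gmod \<sigma> (lmod M \<sigma>)" "fin_gen \<sigma> (lmod M \<sigma>)" if "\<sigma> \<notin> Km" for \<sigma>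
    using assms that by (auto simp: LKm_def gmod_def)
  show h: "ghom (- {i}) (lmod M (- {i})) (lmod M UNIV) (lmap M i)" for i
    using assms by (simp add: LKm_def)
  show "localizes i (lmod M (- {i})) (lmod M UNIV) (lmap M i)" for i
  proof (rule localization_map.induced_iso_imp_localizes)
    show "localization_map i (lmod M (- {i})) (lmod M UNIV) (lmap M i)"
      using g(1)[of UNIV] g(1)[of "- {i}"] h
      by (simp add: localization_map_def torsion_gmod_def localization_map_axioms_def)
    show "induced_iso (- {i}) (lmod M (- {i})) (lmod M UNIV) (lmap M i)"
      using assms by (simp add: LKm_def)
  qed
qed

lemma LKmI:
  assumes "\<And>\<sigma>. \<sigma> \<notin> Km \<Longrightarrow> graded_module \<sigma> (lmod M \<sigma>)" "\<And>\<sigma>. \<sigma> \<notin> Km \<Longrightarrow> fin_gen \<sigma> (lmod M \<sigma>)"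
    "\<And>i. ghom (- {i}) (lmod M (- {i})) (lmod M UNIV) (lmap M i)"
    "\<And>i. localizes i (lmod M (- {i})) (lmod M UNIV) (lmap M i)"
  shows "M \<in> LKm"
proof -
  have "induced_iso (- {i}) (lmod M (- {i})) (lmod M UNIV) (lmap M i)" for i
  proof (rule localization_map.localizes_imp_induced_iso)
    show "localization_map i (lmod M (- {i})) (lmod M UNIV) (lmap M i)"
      using assms(1)[of UNIV] assms(1)[of "- {i}"] assms(3)
      by (simp add: localization_map_def torsion_gmod_def localization_map_axioms_def gmod_def)
  qed (rule assms(4))
  then show ?thesis using assms by (simp add: LKm_def)
qed

text \<open>Pointwise graded epimorphisms compatible with the structure maps.  The last clause says that
elements of \<open>N\<close> at \<open>\<sigma>\<^sub>i\<close> killed by the structure map are torsion; it does not follow from the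
corresponding property of \<open>M\<close>, since \<open>f\<close> may have a kernel at \<open>[m]\<close>.\<close>

definition lepi ::
  "('k::field, 'm::finite, 'a) lpm \<Rightarrow> ('k, 'm, 'b) lpm \<Rightarrow> ('m set \<Rightarrow> 'a \<Rightarrow> 'b) \<Rightarrow> bool" where
  "lepi M N f \<longleftrightarrow> M \<in> LKm \<and>
     (\<forall>\<sigma>. \<sigma> \<notin> Km \<longrightarrow> gepi \<sigma> (lmod M \<sigma>) (lmod N \<sigma>) (f \<sigma>)) \<and>
     (\<forall>i. \<forall>x\<in>carrier (lmod M (- {i})). f UNIV (lmap M i x) = lmap N i (f (- {i}) x)) \<and>
     (\<forall>i. \<forall>x\<in>carrier (lmod M (- {i})). f UNIV (lmap M i x) = \<zero>\<^bsub>lmod N UNIV\<^esub> \<longrightarrow>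
        f (- {i}) x \<in> tors i (lmod N (- {i})))"

lemma lepiD:
  assumes "lepi M N f"
  shows "M \<in> LKm" "\<And>\<sigma>. \<sigma> \<notin> Km \<Longrightarrow> gepi \<sigma> (lmod M \<sigma>) (lmod N \<sigma>) (f \<sigma>)"
    "\<And>i x. x \<in> carrier (lmod M (- {i})) \<Longrightarrow> lmap N i (f (- {i}) x) = f UNIV (lmap M i x)"
    "\<And>i x. x \<in> carrier (lmod M (- {i})) \<Longrightarrow> f UNIV (lmap M i x) = \<zero>\<^bsub>lmod N UNIV\<^esub> \<Longrightarrow>
        f (- {i}) x \<in> tors i (lmod N (- {i}))"
  using assms by (simp_all add: lepi_def)

lemma gmod_ghom_factor:
  assumes M: "gmod \<sigma> M" and "gepi \<sigma> M N f" "ghom \<sigma> M P g"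
    "\<And>x. x \<in> carrier M \<Longrightarrow> h (f x) = g x"
  shows "ghom \<sigma> N P h"
proof -
  interpret M: gmod \<sigma> M by (rule M)
  show ?thesis
    by (rule ghom_factor[OF M.module_axioms assms(2-4) M.grade_closed])
qed

text \<open>The structure of an object passes to the image: the module structures by the results on \<open>gepi\<close>, and the isomorphism
condition in its elementwise form \<open>localizes\<close>, where \<open>t\<^sub>i\<^sup>n z = \<phi>(x)\<close> is mapped forward by \<open>f\<close>.\<close>

lemma lepi_codomain:
  assumes f: "lepi M N f"
  shows "N \<in> LKm"
proof (rule LKmI)
  note M = LKmD[OF lepiD(1)[OF f]] and F = lepiD(2)[OF f]
  fix \<sigma> :: "'b set" assume \<sigma>: "\<sigma> \<notin> Km"
  interpret m: gmod \<sigma> "lmod M \<sigma>" by (rule M(1)[OF \<sigma>])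
  show "graded_module \<sigma> (lmod N \<sigma>)" by (rule gepi_graded_module[OF m.graded F[OF \<sigma>]])
  show "fin_gen \<sigma> (lmod N \<sigma>)" by (rule gepi_fin_gen[OF m.module_axioms F[OF \<sigma>] M(2)[OF \<sigma>]])
next
  note M = LKmD[OF lepiD(1)[OF f]] and F = lepiD(2)[OF f]
  fix i :: 'b
  have FU: "ghom (- {i}) (lmod M UNIV) (lmod N UNIV) (f UNIV)"
    by (rule ghom_restrict_scalars[OF gepi_ghom[OF F[OF UNIV_notin_Km]]])
  show "ghom (- {i}) (lmod N (- {i})) (lmod N UNIV) (lmap N i)"
    by (rule gmod_ghom_factor[OF M(1) F ghom_comp[OF M(3) FU]]) (simp_all add: lepiD(3)[OF f])
  interpret U: gmod UNIV "lmod M UNIV" by (rule M(1)) simp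
  note FUD = gepiD[OF F[OF UNIV_notin_Km]] and FiD = gepiD[OF F[OF Compl_notin_Km[of i]]]
  show "localizes i (lmod N (- {i})) (lmod N UNIV) (lmap N i)"
    unfolding localizes_def
  proof (intro conjI ballI impI)
    fix y assume "y \<in> carrier (lmod N UNIV)"
    then obtain z where z: "z \<in> carrier (lmod M UNIV)" "y = f UNIV z" using FUD(1) by auto
    obtain n x where x: "x \<in> carrier (lmod M (- {i}))" "mon (axis i (int n)) 1 \<odot>\<^bsub>lmod M UNIV\<^esub> z = lmap M i x"
      using M(4)[of i] z(1) unfolding localizes_def by blast
    have "mon (axis i (int n)) 1 \<odot>\<^bsub>lmod N UNIV\<^esub> y = lmap N i (f (- {i}) x)"
      using FUD(4)[OF _ z(1), of "mon (axis i (int n)) 1"] z x lepiD(3)[OF f x(1)] by simp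
    moreover have "f (- {i}) x \<in> carrier (lmod N (- {i}))" using x(1) FiD(1) by simp
    ultimately show "\<exists>n. \<exists>x\<in>carrier (lmod N (- {i})). mon (axis i (int n)) 1 \<odot>\<^bsub>lmod N UNIV\<^esub> y = lmap N i x"
      by blast
  next
    fix y assume y: "y \<in> carrier (lmod N (- {i}))" "lmap N i y = \<zero>\<^bsub>lmod N UNIV\<^esub>"
    then obtain x where x: "x \<in> carrier (lmod M (- {i}))" "y = f (- {i}) x" using FiD(1) by auto
    then show "y \<in> tors i (lmod N (- {i}))" using lepiD(3,4)[OF f x(1)] y(2) by simp
  qed
qed

lemma lepi_lhom: "lepi M N f \<Longrightarrow> lhom M N f"
  unfolding lhom_def by (simp add: lepi_codomain lepiD gepi_ghom)

lemma lhom_factor: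
  assumes f: "lepi M N f" and g: "lhom M P g"
    and h: "\<And>\<sigma> x. \<sigma> \<notin> Km \<Longrightarrow> x \<in> carrier (lmod M \<sigma>) \<Longrightarrow> h \<sigma> (f \<sigma> x) = g \<sigma> x"
  shows "lhom N P h"
proof -
  note M = LKmD[OF lepiD(1)[OF f]] and F = lepiD(2)[OF f]
  have "ghom \<sigma> (lmod N \<sigma>) (lmod P \<sigma>) (h \<sigma>)" if "\<sigma> \<notin> Km" for \<sigma>
    using g that by (intro gmod_ghom_factor[OF M(1)[OF that] F[OF that]]) (auto simp: lhom_def h)
  moreover have "h UNIV (lmap N i y) = lmap P i (h (- {i}) y)" if y: "y \<in> carrier (lmod N (- {i}))" for i y
  proof -
    obtain x where x: "x \<in> carrier (lmod M (- {i}))" "y = f (- {i}) x"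
      using y gepiD(1)[OF F[OF Compl_notin_Km[of i]]] by auto
    have "lmap M i x \<in> carrier (lmod M UNIV)" by (rule ghomD(2)[OF M(3) x(1)])
    then show ?thesis using x g lepiD(3)[OF f x(1)] by (simp add: h lhom_def)
  qed
  ultimately show ?thesis using lepi_codomain[OF f] g by (simp add: lhom_def)
qed

section \<open>The torsion and torsion-free parts\<close>

lemma Tcarrier_Compl [simp]: "Tcarrier M (- {i}) = tors i (lmod M (- {i}))"
  by (simp add: Tcarrier_def)

lemma Tcarrier_UNIV [simp]: "Tcarrier M UNIV = {\<zero>\<^bsub>lmod M UNIV\<^esub>}"
  by (simp add: Tcarrier_def)

locale split_object =
  fixes M :: "('k::field, 'm::finite, 'a) lpm" and P :: "'m set \<Rightarrow> 'a \<Rightarrow> 'a"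
  assumes M: "M \<in> LKm"
    and projection: "\<sigma> \<notin> Km \<Longrightarrow> projection \<sigma> (lmod M \<sigma>) (Tcarrier M \<sigma>) (P \<sigma>)"

text \<open>At \<open>\<sigma>\<^sub>i\<close> the projection comes from a graded complement of the torsion; at \<open>[m]\<close> the torsion part is
zero and the identity serves.\<close>

lemma ex_split_object:
  assumes M: "M \<in> LKm"
  obtains P where "split_object M P"
proof -
  have "\<exists>P. \<sigma> \<notin> Km \<longrightarrow> projection \<sigma> (lmod M \<sigma>) (Tcarrier M \<sigma>) P" for \<sigma>
  proof (cases "\<sigma> \<notin> Km")
    case True
    from True consider "\<sigma> = UNIV" | i where "\<sigma> = - {i}" by (auto simp: notin_Km_iff)
    then show ?thesis
    proof cases
      case 1
      interpret U: gmod UNIV "lmod M UNIV" by (rule LKmD(1)[OF M]) simp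
      have "ghom UNIV (lmod M UNIV) (lmod M UNIV) (\<lambda>x. x)" by (rule ghomI) simp_all
      then have "projection UNIV (lmod M UNIV) (Tcarrier M UNIV) (\<lambda>x. x)"
        by unfold_locales (simp_all add: U.M.diff_eq_zero_iff)
      then show ?thesis using 1 by blast
    next
      case (2 i)
      interpret S: torsion_gmod i "lmod M (- {i})"
        using LKmD(1)[OF M Compl_notin_Km] by (simp add: torsion_gmod_def)
      obtain P where "ghom (- {i}) (lmod M (- {i})) (lmod M (- {i})) P"
        "\<forall>x\<in>carrier (lmod M (- {i})). x \<ominus>\<^bsub>lmod M (- {i})\<^esub> P x \<in> tors i (lmod M (- {i}))"
        "\<forall>x\<in>tors i (lmod M (- {i})). P x = \<zero>\<^bsub>lmod M (- {i})\<^esub>"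
        using S.torsion_complement_projection by (elim exE conjE) (rule that)
      then have "projection (- {i}) (lmod M (- {i})) (Tcarrier M (- {i})) P"
        by unfold_locales (auto simp: S.tors_carrier)
      then show ?thesis using 2 by blast
    qed
  qed blast
  then have "\<exists>P. \<forall>\<sigma>. \<sigma> \<notin> Km \<longrightarrow> projection \<sigma> (lmod M \<sigma>) (Tcarrier M \<sigma>) (P \<sigma>)" by (intro choice allI)
  then show ?thesis using that M by (auto simp: split_object_def)
qed

context split_object
begin

lemma gm: "\<sigma> \<notin> Km \<Longrightarrow> gmod \<sigma> (lmod M \<sigma>)"
  by (rule LKmD(1)[OF M])

lemmas phi = LKmD(3)[OF M]

lemma P_kernel: "\<sigma> \<notin> Km \<Longrightarrow> x \<in> carrier (lmod M \<sigma>) \<Longrightarrow> P \<sigma> x = \<zero>\<^bsub>lmod M \<sigma>\<^esub> \<longleftrightarrow> x \<in> Tcarrier M \<sigma>"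
  using projection.T_iff[OF projection] by blast

lemma P_closed: "\<sigma> \<notin> Km \<Longrightarrow> x \<in> carrier (lmod M \<sigma>) \<Longrightarrow> P \<sigma> x \<in> carrier (lmod M \<sigma>)"
  by (rule projection.P_closed[OF projection])

lemma P_UNIV: 
  assumes "y \<in> carrier (lmod M UNIV)"
  shows "P UNIV y = y"
proof -
  interpret U: projection UNIV "lmod M UNIV" "Tcarrier M UNIV" "P UNIV" by (rule projection) simp
  show ?thesis using U.diff_in_T[OF assms] assms by (simp add: U.M.diff_eq_zero_iff)
qed

text \<open>\<open>t\<^sub>i\<close> acts invertibly at \<open>[m]\<close>, so the structure map kills torsion.  Hence it does not
distinguish \<open>x\<close> from \<open>P x\<close>, and the projections at the various \<open>\<sigma>\<close> form a morphism.\<close>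

lemma lmap_torsion:
  assumes "x \<in> tors i (lmod M (- {i}))"
  shows "lmap M i x = \<zero>\<^bsub>lmod M UNIV\<^esub>"
proof -
  interpret m: gmod "- {i}" "lmod M (- {i})" by (rule gm) simp
  interpret U: gmod UNIV "lmod M UNIV" by (rule gm) simp
  obtain n where n: "mon (axis i (int n)) 1 \<odot>\<^bsub>lmod M (- {i})\<^esub> x = \<zero>\<^bsub>lmod M (- {i})\<^esub>"
    and x: "x \<in> carrier (lmod M (- {i}))" using assms m.tors_iff by blast
  have phi0: "lmap M i \<zero>\<^bsub>lmod M (- {i})\<^esub> = \<zero>\<^bsub>lmod M UNIV\<^esub>"
    by (rule additive_zero[OF m.abelian_group_axioms U.abelian_group_axioms ghomD(1,3)[OF phi]])
  have "mon (axis i (int n)) 1 \<odot>\<^bsub>lmod M UNIV\<^esub> lmap M i x = \<zero>\<^bsub>lmod M UNIV\<^esub>"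
    using ghomD(4)[OF phi _ x, of "mon (axis i (int n)) 1"] n phi0 by simp
  then have "mon (axis i (- int n)) 1 \<odot>\<^bsub>lmod M UNIV\<^esub> (mon (axis i (int n)) 1 \<odot>\<^bsub>lmod M UNIV\<^esub> lmap M i x) = \<zero>\<^bsub>lmod M UNIV\<^esub>"
    by simp
  moreover have "mon (axis i (- int n)) 1 \<odot>\<^bsub>lmod M UNIV\<^esub> (mon (axis i (int n)) 1 \<odot>\<^bsub>lmod M UNIV\<^esub> lmap M i x) = lmap M i x"
    using ghomD(2)[OF phi x] by (simp add: U.mon_mon cone_def axis_add axis_zero)
  ultimately show ?thesis by simp
qed

lemma lmap_P:
  assumes x: "x \<in> carrier (lmod M (- {i}))"
  shows "lmap M i (P (- {i}) x) = lmap M i x"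
proof -
  interpret m: projection "- {i}" "lmod M (- {i})" "Tcarrier M (- {i})" "P (- {i})" by (rule projection) simp
  interpret U: gmod UNIV "lmod M UNIV" by (rule gm) simp
  let ?u = "x \<ominus>\<^bsub>lmod M (- {i})\<^esub> P (- {i}) x"
  have "x = ?u \<oplus>\<^bsub>lmod M (- {i})\<^esub> P (- {i}) x"
    using x by (simp add: a_minus_def m.M.a_assoc m.M.l_neg)
  then have "lmap M i x = lmap M i ?u \<oplus>\<^bsub>lmod M UNIV\<^esub> lmap M i (P (- {i}) x)"
    using ghomD(3)[OF phi, of ?u i "P (- {i}) x"] x by simp
  moreover have "lmap M i ?u = \<zero>\<^bsub>lmod M UNIV\<^esub>"
    using m.diff_in_T[OF x] by (intro lmap_torsion) simp
  ultimately show ?thesis using ghomD(2)[OF phi, of "P (- {i}) x"] x by simp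
qed

lemma lepiI:
  assumes "\<And>\<sigma>. \<sigma> \<notin> Km \<Longrightarrow> gepi \<sigma> (lmod M \<sigma>) (lmod N \<sigma>) (f \<sigma>)"
    "\<And>i x. x \<in> carrier (lmod M (- {i})) \<Longrightarrow> f UNIV (lmap M i x) = lmap N i (f (- {i}) x)"
    and inj: "\<And>y. y \<in> carrier (lmod M UNIV) \<Longrightarrow> f UNIV y = \<zero>\<^bsub>lmod N UNIV\<^esub> \<Longrightarrow> y = \<zero>\<^bsub>lmod M UNIV\<^esub>"
  shows "lepi M N f"
proof -
  have "f (- {i}) x \<in> tors i (lmod N (- {i}))"
    if x: "x \<in> carrier (lmod M (- {i}))" "f UNIV (lmap M i x) = \<zero>\<^bsub>lmod N UNIV\<^esub>" for i x
  proof -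
    have "lmap M i x = \<zero>\<^bsub>lmod M UNIV\<^esub>" using inj ghomD(2)[OF phi x(1)] x(2) by simp
    then have "x \<in> tors i (lmod M (- {i}))" using LKmD(4)[OF M, of i] x(1) by (simp add: localizes_def)
    then show ?thesis by (rule gepi_tors[OF gm[OF Compl_notin_Km] assms(1)[OF Compl_notin_Km]])
  qed
  then show ?thesis unfolding lepi_def using M assms(1,2) by simp
qed

definition Tproj :: "'m set \<Rightarrow> 'a \<Rightarrow> 'a" where
  "Tproj \<sigma> x = x \<ominus>\<^bsub>lmod M \<sigma>\<^esub> P \<sigma> x"

lemma Tproj_in_T: "\<sigma> \<notin> Km \<Longrightarrow> x \<in> carrier (lmod M \<sigma>) \<Longrightarrow> Tproj \<sigma> x \<in> Tcarrier M \<sigma>"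
  unfolding Tproj_def by (rule projection.diff_in_T[OF projection])

lemma Tproj_UNIV: "y \<in> carrier (lmod M UNIV) \<Longrightarrow> Tproj UNIV y = \<zero>\<^bsub>lmod M UNIV\<^esub>"
  using Tproj_in_T[of UNIV y] by simp

lemma lmap_Tproj: "x \<in> carrier (lmod M (- {i})) \<Longrightarrow> lmap M i (Tproj (- {i}) x) = \<zero>\<^bsub>lmod M UNIV\<^esub>"
  using Tproj_in_T[of "- {i}" x] by (intro lmap_torsion) simp

text \<open>The complement \<open>P(M)\<close>, an isomorphic copy of \<open>Fpart M\<close> whose carriers are in the type of \<open>M\<close>; it is
the torsion-free term in the definition of a torsion pair.\<close>

definition Cpart :: "('k, 'm, 'a) lpm" where
  "Cpart = \<lparr>lmod = (\<lambda>\<sigma>. gsub (lmod M \<sigma>) (P \<sigma> ` carrier (lmod M \<sigma>))), lmap = lmap M\<rparr>"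

lemma tors_gsub_tors: "tors i (gsub N (tors i N)) = tors i N"
  by (auto simp: tors_def gsub_def)

lemma lepi_Tpart: "lepi M (Tpart M) Tproj"
  unfolding lepi_def
proof (intro conjI allI impI ballI)
  show "M \<in> LKm" by (rule M)
  show "gepi \<sigma> (lmod M \<sigma>) (lmod (Tpart M) \<sigma>) (Tproj \<sigma>)" if "\<sigma> \<notin> Km" for \<sigma>
    using projection.gepi_kernel[OF projection[OF that]] unfolding Tpart_def Tproj_def by simp
  show "Tproj UNIV (lmap M i x) = lmap (Tpart M) i (Tproj (- {i}) x)" if "x \<in> carrier (lmod M (- {i}))" for i x
    using that ghomD(2)[OF phi that] by (simp add: Tpart_def Tproj_UNIV lmap_Tproj)
  show "Tproj (- {i}) x \<in> tors i (lmod (Tpart M) (- {i}))" if "x \<in> carrier (lmod M (- {i}))" for i x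
    using Tproj_in_T[OF _ that] by (simp add: Tpart_def tors_gsub_tors)
qed

lemma lepi_Cpart: "lepi M Cpart P"
proof (rule lepiI)
  show "gepi \<sigma> (lmod M \<sigma>) (lmod Cpart \<sigma>) (P \<sigma>)" if "\<sigma> \<notin> Km" for \<sigma>
    using projection.gepi_image[OF projection[OF that]] unfolding Cpart_def by simp
  show "P UNIV (lmap M i x) = lmap Cpart i (P (- {i}) x)" if "x \<in> carrier (lmod M (- {i}))" for i x
    using that ghomD(2)[OF phi that] by (simp add: Cpart_def P_UNIV lmap_P)
  show "y = \<zero>\<^bsub>lmod M UNIV\<^esub>" if "y \<in> carrier (lmod M UNIV)" "P UNIV y = \<zero>\<^bsub>lmod Cpart UNIV\<^esub>" for y
    using that by (simp add: Cpart_def gsub_def P_UNIV)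
qed

lemma Fproj_eq_iff:
  "\<sigma> \<notin> Km \<Longrightarrow> x \<in> carrier (lmod M \<sigma>) \<Longrightarrow> y \<in> carrier (lmod M \<sigma>) \<Longrightarrow> Fproj M \<sigma> x = Fproj M \<sigma> y \<longleftrightarrow> P \<sigma> x = P \<sigma> y"
  unfolding Fproj_def by (rule projection.coset_eq_iff_P[OF projection])

lemma Fproj_kernel:
  "\<sigma> \<notin> Km \<Longrightarrow> x \<in> carrier (lmod M \<sigma>) \<Longrightarrow> Fproj M \<sigma> x = \<zero>\<^bsub>lmod (Fpart M) \<sigma>\<^esub> \<longleftrightarrow> x \<in> Tcarrier M \<sigma>"
  using projection.coset_eq_T_iff[OF projection] P_kernel
  by (simp add: Fproj_def Fpart_def gquot_def)

lemma lmap_Fpart: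
  assumes x: "x \<in> carrier (lmod M (- {i}))"
  shows "lmap (Fpart M) i (Fproj M (- {i}) x) = Fproj M UNIV (lmap M i x)"
proof -
  interpret m: projection "- {i}" "lmod M (- {i})" "Tcarrier M (- {i})" "P (- {i})" by (rule projection) simp
  have "Fproj M UNIV (lmap M i z) = Fproj M UNIV (lmap M i x)" if "z \<in> Fproj M (- {i}) x" for z
  proof -
    have "z \<in> carrier (lmod M (- {i}))" "P (- {i}) z = P (- {i}) x"
      using that unfolding Fproj_def m.coset_eq_fibre[OF x] by simp_all
    then show ?thesis using lmap_P[of z i] lmap_P[OF x] by simp
  qed
  moreover have "x \<in> Fproj M (- {i}) x" unfolding Fproj_def m.coset_eq_fibre[OF x] using x by simp
  ultimately have "(\<Union>z\<in>Fproj M (- {i}) x. Fproj M UNIV (lmap M i z)) = Fproj M UNIV (lmap M i x)" by blast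
  then show ?thesis by (simp add: Fpart_def Fproj_def)
qed

lemma lepi_Fpart: "lepi M (Fpart M) (Fproj M)"
proof (rule lepiI)
  show "gepi \<sigma> (lmod M \<sigma>) (lmod (Fpart M) \<sigma>) (Fproj M \<sigma>)" if "\<sigma> \<notin> Km" for \<sigma>
    using projection.gepi_quotient[OF projection[OF that]] unfolding Fpart_def Fproj_def by simp
  show "Fproj M UNIV (lmap M i x) = lmap (Fpart M) i (Fproj M (- {i}) x)" if "x \<in> carrier (lmod M (- {i}))" for i x
    using lmap_Fpart[OF that] by simp
  show "y = \<zero>\<^bsub>lmod M UNIV\<^esub>" if "y \<in> carrier (lmod M UNIV)" "Fproj M UNIV y = \<zero>\<^bsub>lmod (Fpart M) UNIV\<^esub>" for y
    using that Fproj_kernel[of UNIV y] by simp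
qed

lemma lepi_direct_sum: "lepi M (ldsum (Tpart M) (Fpart M)) (\<lambda>\<sigma> x. (Tproj \<sigma> x, Fproj M \<sigma> x))"
proof (rule lepiI)
  show "gepi \<sigma> (lmod M \<sigma>) (lmod (ldsum (Tpart M) (Fpart M)) \<sigma>) (\<lambda>x. (Tproj \<sigma> x, Fproj M \<sigma> x))" if "\<sigma> \<notin> Km" for \<sigma>
    using projection.gepi_direct_sum[OF projection[OF that]]
    unfolding ldsum_def Tpart_def Fpart_def Fproj_def Tproj_def by simp
  show "(Tproj UNIV (lmap M i x), Fproj M UNIV (lmap M i x)) =
      lmap (ldsum (Tpart M) (Fpart M)) i (Tproj (- {i}) x, Fproj M (- {i}) x)" if "x \<in> carrier (lmod M (- {i}))" for i x
    using lmap_Fpart[OF that] that ghomD(2)[OF phi that] by (simp add: ldsum_def Tpart_def Tproj_UNIV lmap_Tproj)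
  show "y = \<zero>\<^bsub>lmod M UNIV\<^esub>" if "y \<in> carrier (lmod M UNIV)"
    "(Tproj UNIV y, Fproj M UNIV y) = \<zero>\<^bsub>lmod (ldsum (Tpart M) (Fpart M)) UNIV\<^esub>" for y
    using that Fproj_kernel[of UNIV y] by (simp add: ldsum_def gdsum_def)
qed

lemma Tpart_TT: "Tpart M \<in> TT"
proof -
  have "tors i (lmod (Tpart M) (- {i})) = carrier (lmod (Tpart M) (- {i}))" for i
    by (simp add: Tpart_def tors_gsub_tors) (simp add: gsub_def)
  then show ?thesis using lepi_codomain[OF lepi_Tpart] by (simp add: TT_def)
qed

lemma Fpart_FF: "Fpart M \<in> FF"
proof -
  have "tors i (lmod (Fpart M) (- {i})) = {\<zero>\<^bsub>lmod (Fpart M) (- {i})\<^esub>}" for i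
    using Fproj_kernel[of "- {i}"] by (intro gepi_torsion_free[OF gm lepiD(2)[OF lepi_Fpart]]) simp_all
  then show ?thesis using lepi_codomain[OF lepi_Fpart] by (simp add: FF_def)
qed

lemma Cpart_FF: "Cpart \<in> FF"
proof -
  have "tors i (lmod Cpart (- {i})) = {\<zero>\<^bsub>lmod Cpart (- {i})\<^esub>}" for i
    using P_kernel[of "- {i}"]
    by (intro gepi_torsion_free[OF gm lepiD(2)[OF lepi_Cpart]]) (simp_all add: Cpart_def gsub_def)
  then show ?thesis using lepi_codomain[OF lepi_Cpart] by (simp add: FF_def)
qed

lemma lhom_Tincl: "lhom (Tpart M) M (Tincl M)"
proof -
  have "ghom \<sigma> (lmod (Tpart M) \<sigma>) (lmod M \<sigma>) (Tincl M \<sigma>)" if "\<sigma> \<notin> Km" for \<sigma>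
    using projection.T_subset[OF projection[OF that]]
    by (intro ghomI) (auto simp: Tpart_def gsub_def Tincl_def)
  then show ?thesis using lepi_codomain[OF lepi_Tpart] M
    by (simp add: lhom_def Tincl_def Tpart_def)
qed

lemma short_exact_Tpart:
  assumes g: "lepi M B g"
    and ker: "\<And>\<sigma> x. \<sigma> \<notin> Km \<Longrightarrow> x \<in> carrier (lmod M \<sigma>) \<Longrightarrow> g \<sigma> x = \<zero>\<^bsub>lmod B \<sigma>\<^esub> \<longleftrightarrow> x \<in> Tcarrier M \<sigma>"
  shows "short_exact (Tpart M) (Tincl M) M g B"
  unfolding short_exact_def
proof (intro conjI allI impI)
  fix \<sigma> :: "'m set" assume \<sigma>: "\<sigma> \<notin> Km"
  have T: "carrier (lmod (Tpart M) \<sigma>) = Tcarrier M \<sigma>" by (simp add: Tpart_def gsub_def)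
  show "inj_on (Tincl M \<sigma>) (carrier (lmod (Tpart M) \<sigma>))" by (simp add: Tincl_def)
  show "Tincl M \<sigma> ` carrier (lmod (Tpart M) \<sigma>) = {x \<in> carrier (lmod M \<sigma>). g \<sigma> x = \<zero>\<^bsub>lmod B \<sigma>\<^esub>}"
    using ker[OF \<sigma>] projection.T_subset[OF projection[OF \<sigma>]] unfolding T by (auto simp: Tincl_def)
  show "g \<sigma> ` carrier (lmod M \<sigma>) = carrier (lmod B \<sigma>)"
    using gepiD(1)[OF lepiD(2)[OF g \<sigma>]] by simp
qed (rule lhom_Tincl lepi_lhom[OF g])+

lemma short_exact_Fpart: "short_exact (Tpart M) (Tincl M) M (Fproj M) (Fpart M)"
  by (rule short_exact_Tpart[OF lepi_Fpart Fproj_kernel])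

lemma short_exact_Cpart: "short_exact (Tpart M) (Tincl M) M P Cpart"
  by (rule short_exact_Tpart[OF lepi_Cpart]) (simp add: Cpart_def gsub_def P_kernel)

lemma lhom_P: "lhom M M P"
proof -
  have "ghom \<sigma> (lmod M \<sigma>) (lmod M \<sigma>) (P \<sigma>)" if "\<sigma> \<notin> Km" for \<sigma>
    by (rule projection.P[OF projection[OF that]])
  then show ?thesis using M ghomD(2)[OF phi] by (simp add: lhom_def P_UNIV lmap_P)
qed

lemma lhom_id: "lhom M M (\<lambda>\<sigma> x. x)"
  using M by (auto simp: lhom_def intro: ghomI)

text \<open>\<open>P\<close> vanishes on the torsion part, so it descends along the quotient map to a section of it.\<close>

lemma split_exact_Fpart: "split_exact (Tpart M) (Tincl M) M (Fproj M) (Fpart M)"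
proof -
  let ?s = "\<lambda>\<sigma> X. P \<sigma> (inv_into (carrier (lmod M \<sigma>)) (Fproj M \<sigma>) X)"
  have s: "?s \<sigma> (Fproj M \<sigma> x) = P \<sigma> x" if "\<sigma> \<notin> Km" "x \<in> carrier (lmod M \<sigma>)" for \<sigma> x
  proof -
    let ?y = "inv_into (carrier (lmod M \<sigma>)) (Fproj M \<sigma>) (Fproj M \<sigma> x)"
    have "?y \<in> carrier (lmod M \<sigma>)" "Fproj M \<sigma> ?y = Fproj M \<sigma> x"
      by (rule inv_into_into[OF imageI[OF that(2)]], rule f_inv_into_f[OF imageI[OF that(2)]])
    then show ?thesis using Fproj_eq_iff that by blast
  qed
  have "lhom (Fpart M) M ?s" by (rule lhom_factor[OF lepi_Fpart lhom_P s])
  moreover have "lhom_eq (Fpart M) (\<lambda>\<sigma>. Fproj M \<sigma> \<circ> ?s \<sigma>) (\<lambda>\<sigma>. id)"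
    unfolding lhom_eq_def
  proof (intro allI impI ballI)
    fix \<sigma> X assume \<sigma>: "\<sigma> \<notin> Km" and "X \<in> carrier (lmod (Fpart M) \<sigma>)"
    then obtain x where x: "x \<in> carrier (lmod M \<sigma>)" "X = Fproj M \<sigma> x"
      using gepiD(1)[OF lepiD(2)[OF lepi_Fpart \<sigma>]] by auto
    have "Fproj M \<sigma> (P \<sigma> x) = Fproj M \<sigma> x"
      using Fproj_eq_iff[OF \<sigma> P_closed[OF \<sigma> x(1)] x(1)] projection.P_P[OF projection[OF \<sigma>] x(1)] by simp
    then show "(Fproj M \<sigma> \<circ> ?s \<sigma>) X = id X" using s[OF \<sigma> x(1)] x(2) by simp
  qed
  ultimately show ?thesis unfolding split_exact_def using short_exact_Fpart by blast
qed

lemma lisomorphic_direct_sum: "lisomorphic M (ldsum (Tpart M) (Fpart M))"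
proof -
  let ?f = "\<lambda>\<sigma> x. (Tproj \<sigma> x, Fproj M \<sigma> x)"
  let ?g = "\<lambda>\<sigma>. inv_into (carrier (lmod M \<sigma>)) (?f \<sigma>)"
  have inj: "inj_on (?f \<sigma>) (carrier (lmod M \<sigma>))" if "\<sigma> \<notin> Km" for \<sigma>
  proof (rule inj_onI)
    fix x y assume *: "x \<in> carrier (lmod M \<sigma>)" "y \<in> carrier (lmod M \<sigma>)" "?f \<sigma> x = ?f \<sigma> y"
    then have "P \<sigma> x = P \<sigma> y" using Fproj_eq_iff[OF that] by simp
    then show "x = y" using projection.diff_diff_P[OF projection[OF that] *(1,2)] *(3) by (simp add: Tproj_def)
  qed
  have g: "?g \<sigma> (?f \<sigma> x) = x" if "\<sigma> \<notin> Km" "x \<in> carrier (lmod M \<sigma>)" for \<sigma> x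
    by (rule inv_into_f_f[OF inj[OF that(1)] that(2)])
  have "lhom (ldsum (Tpart M) (Fpart M)) M ?g"
    by (rule lhom_factor[OF lepi_direct_sum lhom_id g])
  moreover have "lhom_eq M (\<lambda>\<sigma>. ?g \<sigma> \<circ> ?f \<sigma>) (\<lambda>\<sigma>. id)"
    using g by (simp add: lhom_eq_def)
  moreover have "lhom_eq (ldsum (Tpart M) (Fpart M)) (\<lambda>\<sigma>. ?f \<sigma> \<circ> ?g \<sigma>) (\<lambda>\<sigma>. id)"
    unfolding lhom_eq_def
  proof (intro allI impI ballI)
    fix \<sigma> z assume \<sigma>: "\<sigma> \<notin> Km" and "z \<in> carrier (lmod (ldsum (Tpart M) (Fpart M)) \<sigma>)"
    then obtain x where x: "x \<in> carrier (lmod M \<sigma>)" "z = ?f \<sigma> x"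
      using gepiD(1)[OF lepiD(2)[OF lepi_direct_sum \<sigma>]] by auto
    then show "(?f \<sigma> \<circ> ?g \<sigma>) z = id z" using g[OF \<sigma> x(1)] by simp
  qed
  ultimately show ?thesis unfolding lisomorphic_def using lepi_lhom[OF lepi_direct_sum] by blast
qed

end

section \<open>The torsion pair\<close>

lemma lhomD:
  assumes "lhom A B f"
  shows "A \<in> LKm" "B \<in> LKm" "\<And>\<sigma>. \<sigma> \<notin> Km \<Longrightarrow> ghom \<sigma> (lmod A \<sigma>) (lmod B \<sigma>) (f \<sigma>)"
    "\<And>i x. x \<in> carrier (lmod A (- {i})) \<Longrightarrow> f UNIV (lmap A i x) = lmap B i (f (- {i}) x)"
  using assms by (simp_all add: lhom_def)

lemma lhom_zero:
  assumes f: "lhom A B f" and \<sigma>: "\<sigma> \<notin> Km"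
  shows "f \<sigma> \<zero>\<^bsub>lmod A \<sigma>\<^esub> = \<zero>\<^bsub>lmod B \<sigma>\<^esub>"
proof -
  interpret A: gmod \<sigma> "lmod A \<sigma>" by (rule LKmD(1)[OF lhomD(1)[OF f] \<sigma>])
  interpret B: gmod \<sigma> "lmod B \<sigma>" by (rule LKmD(1)[OF lhomD(2)[OF f] \<sigma>])
  show ?thesis
    by (rule additive_zero[OF A.abelian_group_axioms B.abelian_group_axioms ghomD(1,3)[OF lhomD(3)[OF f \<sigma>]]])
qed

lemma lhom_tors:
  assumes f: "lhom A B f" and x: "x \<in> tors i (lmod A (- {i}))"
  shows "f (- {i}) x \<in> tors i (lmod B (- {i}))"
proof -
  interpret A: gmod "- {i}" "lmod A (- {i})" by (rule LKmD(1)[OF lhomD(1)[OF f]]) simp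
  interpret B: gmod "- {i}" "lmod B (- {i})" by (rule LKmD(1)[OF lhomD(2)[OF f]]) simp
  note F = ghomD[OF lhomD(3)[OF f Compl_notin_Km[of i]]]
  obtain n where n: "mon (axis i (int n)) 1 \<odot>\<^bsub>lmod A (- {i})\<^esub> x = \<zero>\<^bsub>lmod A (- {i})\<^esub>"
    and xc: "x \<in> carrier (lmod A (- {i}))" using x A.tors_iff by blast
  have "mon (axis i (int n)) 1 \<odot>\<^bsub>lmod B (- {i})\<^esub> f (- {i}) x = \<zero>\<^bsub>lmod B (- {i})\<^esub>"
    using F(4)[OF _ xc, of "mon (axis i (int n)) 1"] n lhom_zero[OF f Compl_notin_Km] by simp
  then show ?thesis using F(2)[OF xc] B.tors_iff by blast
qed

text \<open>At \<open>\<sigma>\<^sub>i\<close> a morphism sends torsion to torsion, which is zero in the target.  At \<open>[m]\<close> the source itself is zero: its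
elements are \<open>t\<^sub>i\<^sup>-\<^sup>n \<phi>(y)\<close> with \<open>y\<close> torsion.\<close>

lemma Hom_zero_torsion:
  assumes A: "A \<in> TT" and B: "B \<in> FF"
  shows "Hom_zero A B"
  unfolding Hom_zero_def
proof (intro allI impI)
  fix f assume f: "lhom A B f"
  have At: "tors i (lmod A (- {i})) = carrier (lmod A (- {i}))" and AL: "A \<in> LKm" for i
    using A by (auto simp: TT_def)
  have "f \<sigma> x = \<zero>\<^bsub>lmod B \<sigma>\<^esub>" if \<sigma>: "\<sigma> \<notin> Km" and x: "x \<in> carrier (lmod A \<sigma>)" for \<sigma> x
  proof -
    from \<sigma> consider "\<sigma> = UNIV" | i where "\<sigma> = - {i}" by (auto simp: notin_Km_iff)
    then show ?thesis
    proof cases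
      case 1
      fix i
      interpret U: gmod UNIV "lmod A UNIV" by (rule LKmD(1)[OF AL]) simp
      obtain P where "split_object A P" using ex_split_object[OF AL] .
      then interpret split_object A P .
      obtain n y where y: "y \<in> carrier (lmod A (- {i}))" "mon (axis i (int n)) 1 \<odot>\<^bsub>lmod A UNIV\<^esub> x = lmap A i y"
        using LKmD(4)[OF AL, of i] x 1 unfolding localizes_def by blast
      have "lmap A i y = \<zero>\<^bsub>lmod A UNIV\<^esub>" using y(1) At[of i] by (intro lmap_torsion) simp
      then have "mon (axis i (- int n)) 1 \<odot>\<^bsub>lmod A UNIV\<^esub> (mon (axis i (int n)) 1 \<odot>\<^bsub>lmod A UNIV\<^esub> x) = \<zero>\<^bsub>lmod A UNIV\<^esub>"
        using y(2) by simp
      then have "x = \<zero>\<^bsub>lmod A UNIV\<^esub>"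
        using x 1 by (simp add: U.mon_mon cone_def axis_add axis_zero)
      then show ?thesis using lhom_zero[OF f \<sigma>] 1 by simp
    next
      case (2 i)
      then have "f (- {i}) x \<in> tors i (lmod B (- {i}))" using x At by (intro lhom_tors[OF f]) simp
      then show ?thesis using B 2 by (simp add: FF_def)
    qed
  qed
  then show "lhom_eq A f (lzero B)" by (simp add: lhom_eq_def lzero_def)
qed

lemma lisomorphicE:
  assumes "lisomorphic A B"
  obtains f g where "lhom A B f" "lhom B A g"
    "\<And>i x. x \<in> carrier (lmod A (- {i})) \<Longrightarrow> g (- {i}) (f (- {i}) x) = x"
    "\<And>i y. y \<in> carrier (lmod B (- {i})) \<Longrightarrow> f (- {i}) (g (- {i}) y) = y"
proof -
  obtain f g where *: "lhom A B f" "lhom B A g"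
    "lhom_eq A (\<lambda>\<sigma>. g \<sigma> \<circ> f \<sigma>) (\<lambda>\<sigma>. id)" "lhom_eq B (\<lambda>\<sigma>. f \<sigma> \<circ> g \<sigma>) (\<lambda>\<sigma>. id)"
    using assms unfolding lisomorphic_def by (elim exE conjE) (rule that)
  show ?thesis by (rule that[OF *(1,2)]) (use *(3,4) in \<open>simp_all add: lhom_eq_def\<close>)
qed

lemma TT_iso:
  assumes A: "A \<in> TT" and iso: "lisomorphic A B"
  shows "B \<in> TT"
proof -
  obtain f g where f: "lhom A B f" and g: "lhom B A g"
    and fg: "\<And>i y. y \<in> carrier (lmod B (- {i})) \<Longrightarrow> f (- {i}) (g (- {i}) y) = y"
    using lisomorphicE[OF iso] by metis
  have "y \<in> tors i (lmod B (- {i}))" if y: "y \<in> carrier (lmod B (- {i}))" for i y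
  proof -
    have "g (- {i}) y \<in> tors i (lmod A (- {i}))"
      using A ghomD(2)[OF lhomD(3)[OF g Compl_notin_Km] y] by (simp add: TT_def)
    then show ?thesis using lhom_tors[OF f] fg[OF y] by metis
  qed
  then have "tors i (lmod B (- {i})) = carrier (lmod B (- {i}))" for i by (auto simp: tors_def)
  then show ?thesis using lhomD(2)[OF f] by (simp add: TT_def)
qed

lemma FF_iso:
  assumes A: "A \<in> FF" and iso: "lisomorphic A B"
  shows "B \<in> FF"
proof -
  obtain f g where f: "lhom A B f" and g: "lhom B A g"
    and fg: "\<And>i y. y \<in> carrier (lmod B (- {i})) \<Longrightarrow> f (- {i}) (g (- {i}) y) = y"
    using lisomorphicE[OF iso] by metis
  have "y = \<zero>\<^bsub>lmod B (- {i})\<^esub>" if y: "y \<in> tors i (lmod B (- {i}))" for i y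
  proof -
    have "g (- {i}) y = \<zero>\<^bsub>lmod A (- {i})\<^esub>"
      using A lhom_tors[OF g y] by (simp add: FF_def)
    moreover have "y \<in> carrier (lmod B (- {i}))" using y by (simp add: tors_def)
    ultimately show ?thesis using fg[of y i] lhom_zero[OF f Compl_notin_Km[of i]] by simp
  qed
  moreover have "\<zero>\<^bsub>lmod B (- {i})\<^esub> \<in> tors i (lmod B (- {i}))" for i
    by (rule gmod.tors_zero[OF LKmD(1)[OF lhomD(2)[OF f]]]) simp
  ultimately have "tors i (lmod B (- {i})) = {\<zero>\<^bsub>lmod B (- {i})\<^esub>}" for i by blast
  then show ?thesis using lhomD(2)[OF f] by (simp add: FF_def)
qed

lemma torsion_pair_TT_FF: "torsion_pair (TT :: ('k::field, 'm::finite, 'a) lpm set) FF"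
proof -
  have "\<exists>A\<in>(TT :: ('k, 'm, 'a) lpm set). \<exists>B\<in>(FF :: ('k, 'm, 'a) lpm set). \<exists>f g. short_exact A f M g B"
    if M: "M \<in> LKm" for M :: "('k, 'm, 'a) lpm"
  proof -
    obtain P where "split_object M P" using ex_split_object[OF M] .
    then interpret split_object M P .
    show ?thesis using Tpart_TT Cpart_FF short_exact_Cpart by blast
  qed
  moreover have "(TT :: ('k, 'm, 'a) lpm set) \<subseteq> LKm" "(FF :: ('k, 'm, 'a) lpm set) \<subseteq> LKm"
    by (auto simp: TT_def FF_def)
  ultimately show ?thesis
    unfolding torsion_pair_def by (simp add: TT_iso FF_iso Hom_zero_torsion)
qed

theorem proposition5p5:
  shows "(\<forall>M \<in> (LKm :: ('k::field, 'm::finite, 'a) lpm set).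
            Tpart M \<in> TT \<and> Fpart M \<in> FF \<and>
            short_exact (Tpart M) (Tincl M) M (Fproj M) (Fpart M)) \<and>
         (\<forall>A \<in> (TT :: ('k, 'm, 'b) lpm set). \<forall>B \<in> (FF :: ('k, 'm, 'c) lpm set). Hom_zero A B) \<and>
         torsion_pair (TT :: ('k, 'm, 'a) lpm set) FF \<and>
         (\<forall>M \<in> (LKm :: ('k, 'm, 'a) lpm set).
            split_exact (Tpart M) (Tincl M) M (Fproj M) (Fpart M) \<and>
            lisomorphic M (ldsum (Tpart M) (Fpart M)))"
proof (intro conjI ballI)
  fix M :: "('k, 'm, 'a) lpm" assume "M \<in> LKm"
  then obtain P where "split_object M P" by (rule ex_split_object)
  then interpret split_object M P .
  show "Tpart M \<in> TT" "Fpart M \<in> FF" "short_exact (Tpart M) (Tincl M) M (Fproj M) (Fpart M)"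
    "split_exact (Tpart M) (Tincl M) M (Fproj M) (Fpart M)"
    "lisomorphic M (ldsum (Tpart M) (Fpart M))"
    by (rule Tpart_TT Fpart_FF short_exact_Fpart split_exact_Fpart lisomorphic_direct_sum)+
qed (rule Hom_zero_torsion torsion_pair_TT_FF; assumption?)+

end
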